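(* Let $(x_i,y_j)$ be an interior irregular grid point, with base point $(x_i^*,y_j^* )\in\Gamma_I$, $x_i^*=x_i-v_0h$, $y_j^*=y_j-w_0h$, $-1<v_0,w_0<1$. Let $S=\{-1,0,1\}^2\cup\{(-2,0),(2,0),(0,-2),(0,2)\}$, and let $C_{k,\ell}(h)=\sum_{i=0}^{5}c_{k,\ell,i}h^i$, $(k,\ell)\in S$, be a non-trivial solution of the linear system (in the unknowns $c_{k,\ell,i}\in\mathbb{R}$) induced by $$\sum_{(k,\ell)\in d_{i,j}^-\cup e_{i,j}^-}C_{k,\ell}(h)\sum_{\substack{(m',n')\in\Lambda_5^{V,1} \\ m'+n'\ge m+n}}G^{-,V}_{4,m',n'}((v_0+k)h,(w_0+\ell)h)\,T^{u_+}_{m',n',m,n}+\sum_{(k,\ell)\in d_{i,j}^+\cup e_{i,j}^+}C_{k,\ell}(h)\,G^{+,V}_{4,m,n}((v_0+k)h,(w_0+\ell)h)=\mathcal{O}(h^6)$$ for all $(m,n)\in\Lambda_5^{V,1}$. Define $$I^-_{m,n}:=\sum_{(k,\ell)\in d_{i,j}^-\cup e_{i,j}^-}C_{k,\ell}G^{-,V}_{4,m,n}((v_0+k)h,(w_0+\ell)h),\quad(m,n)\in\Lambda_5^{V,1},$$ $$J^{\pm}_{m,n}:=\sum_{(k,\ell)\in d_{i,j}^\pm\cup e_{i,j}^\pm}C_{k,\ell}Q^{\pm,V}_{4,m,n}((v_0+k)h,(w_0+\ell)h)+\sum_{(m',n')\in\Lambda_5^{V,1}}I^-_{m',n'}T^\pm_{m',n',m,n},\quad(m,n)\in\Lambda_3,$$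 $$J^{g_D}_{m,n}:=\sum_{(m',n')\in\Lambda_5^{V,1}}I^-_{m',n'}T^{g_D}_{m',n',m,n},\ (m,n)\in\Lambda_5,\qquad J^{g_N}_{m,n}:=\sum_{(m',n')\in\Lambda_5^{V,1}}I^-_{m',n'}T^{g_N}_{m',n',m,n},\ (m,n)\in\Lambda_4.$$ Then the 13-point scheme centered at $(x_i,y_j)$, $$\sum_{(k,\ell)\in S}C_{k,\ell}(u_h)_{i+k,j+\ell}=\sum_{(m,n)\in\Lambda_3}f_+^{(m,n)}J^+_{m,n}+\sum_{(m,n)\in\Lambda_3}f_-^{(m,n)}J^-_{m,n}+\sum_{(m,n)\in\Lambda_5}g_D^{(m,n)}J^{g_D}_{m,n}+\sum_{(m,n)\in\Lambda_4}g_N^{(m,n)}J^{g_N}_{m,n},$$ achieves fifth order accuracy. Moreover, the maximum accuracy order of a 13-point finite difference stencil for the interface problem at an interior irregular point $(x_i,y_j)$ is five.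
   Context: **Problem.** $\Omega=(l_1,l_2)\times(l_3,l_4)$ with uniform grid $x_i=l_1+ih$, $y_j=l_3+jh$. For a smooth $\psi$, the smooth curve $\Gamma_I=\{\psi=0\}$ splits $\Omega$ into $\Omega^+=\{\psi>0\}$ and $\Omega^-=\{\psi<0\}$. The interface problem is $$-\nabla\cdot(a\nabla u)=f\text{ in }\Omega\setminus\Gamma_I,\qquad[u]=g_D,\ [a\nabla u\cdot\vec n]=g_N\text{ on }\Gamma_I$$ (with boundary conditions on $\partial\Omega$), where $[w]$ is the limit from $\Omega^+$ minus the limit from $\Omega^-$ and $\vec n$ is the unit normal of $\Gamma_I$ pointing towards $\Omega^+$. The restrictions $a_\pm,u_\pm,f_\pm$ of $a,u,f$ to $\Omega^\pm$ are smooth up to $\Gamma_I$ (and extended smoothly across it near the base point when needed), $a>0$, and $g_D,g_N$ are regarded as smooth functions near the base point. Near $(x_i^*,y_j^* )$, $\Gamma_I$ is given by $x=r(t)+x_i^*$, $y=s(t)+y_j^*$ with $r,s$ smooth, $r(0)=s(0)=0$, $(r')^2+(s')^2>0$. $(u_h)_{i,j}$ is the numerical approximation of $u(x_i,y_j)$. **Stencil sets.** $d_{i,j}^+$ (resp. $d_{i,j}^-$) is the set of $(k,\ell)\in\{-1,0,1\}^2$ with $\psi(x_i+kh,y_j+\ell h)\ge0$ (resp. $<0$); $e_{i,j}^+$ (resp. $e_{i,j}^-$) is the set of $(k,\ell)\in\{(-2,0),(0,-2),(0,2),(2,0)\}$ with $\psi(x_i+kh,y_j+\ell h)\ge0$ (resp.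 $<0$). The point is irregular if $d_{i,j}^+$ and $d_{i,j}^-$ are both nonempty; a base point $(x_i^*,y_j^* )\in\Gamma_I\cap(x_i-h,x_i+h)\times(y_j-h,y_j+h)$ is then chosen. **Notation.** $a_\pm^{(m,n)},u_\pm^{(m,n)},f_\pm^{(m,n)},g_D^{(m,n)},g_N^{(m,n)}$ denote $\partial_x^m\partial_y^n$ at the base point. For an integer $N\ge0$: $\Lambda_N=\{(m,n)\in\mathbb{N}_0^2:m+n\le N\}$, $\Lambda_N^{V,1}=\{(m,n)\in\Lambda_N:m\in\{0,1\}\}$, $\Lambda_N^{V,2}=\Lambda_N\setminus\Lambda_N^{V,1}$. **The functions $G^{\pm,V}_{M,m,n}$, $Q^{\pm,V}_{M,m,n}$.** For either sign, with $f_\pm=-\nabla\cdot(a_\pm\nabla u_\pm)$, solving for $(u_\pm)_{xx}$ and differentiating repeatedly, each $u_\pm^{(m',n')}$ with $(m',n')\in\Lambda_{M+1}^{V,2}$ is written uniquely (identically in $u_\pm$) as $$u_\pm^{(m',n')}=\sum_{(m,n)\in\Lambda_{M+1}^{V,1},\,m+n\le m'+n'}A^{\pm,u}_{m',n',m,n}u_\pm^{(m,n)}+\sum_{(m,n)\in\Lambda_{M-1},\,m+n\le m'+n'-2}A^{\pm,f}_{m',n',m,n}f_\pm^{(m,n)},$$ with constants determined by $\{a_\pm^{(m,n)}:(m,n)\in\Lambda_M\}$. For $(m,n)\in\Lambda_{M+1}^{V,1}$, $$G^{\pm,V}_{M,m,n}(x,y)=\sum_{\ell=0}^{\lfloor n/2\rfloor}\frac{(-1)^\ell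 x^{m+2\ell}y^{n-2\ell}}{(m+2\ell)!(n-2\ell)!}+\sum_{(m',n')\in\Lambda_{M+1}^{V,2},\,m'+n'>m+n}A^{\pm,u}_{m',n',m,n}\frac{x^{m'}y^{n'}}{m'!n'!},$$ and for $(m,n)\in\Lambda_{M-1}$, $$Q^{\pm,V}_{M,m,n}(x,y)=\frac1{a_\pm^{(0,0)}}\sum_{\ell=1}^{1+\lfloor n/2\rfloor}\frac{(-1)^\ell x^{m+2\ell}y^{n-2\ell+2}}{(m+2\ell)!(n-2\ell+2)!}+\sum_{(m',n')\in\Lambda_{M+1}^{V,2},\,m'+n'>m+n+2}A^{\pm,f}_{m',n',m,n}\frac{x^{m'}y^{n'}}{m'!n'!}.$$ **Transmission coefficients.** With $M=4$, the constants $T^{u_+},T^\pm,T^{g_D},T^{g_N}$ are those, determined by $r^{(k)}(0),s^{(k)}(0)$ ($0\le k\le M+1$) and $a_\pm^{(m,n)}$ ($(m,n)\in\Lambda_M$), for which every solution of the interface problem satisfies, for all $(m',n')\in\Lambda_{M+1}^{V,1}$, $$u_-^{(m',n')}=\sum_{\substack{(m,n)\in\Lambda_{M+1}^{V,1} \\ m+n\le m'+n'}}T^{u_+}_{m',n',m,n}u_+^{(m,n)}+\sum_{(m,n)\in\Lambda_{M-1}}\big(T^+_{m',n',m,n}f_+^{(m,n)}+T^-_{m',n',m,n}f_-^{(m,n)}\big)+\sum_{(m,n)\in\Lambda_{M+1}}T^{g_D}_{m',n',m,n}g_D^{(m,n)}+\sum_{(m,n)\in\Lambda_M}T^{g_N}_{m',n',m,n}g_N^{(m,n)}.$$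 **Non-trivial and accuracy order.** $\{C_{k,\ell}(h)\}$ is non-trivial if $C_{k,\ell}(0)\ne0$ for at least one $(k,\ell)$. Accuracy is understood locally: the base point, $v_0,w_0$ and the partition $d_{i,j}^\pm,e_{i,j}^\pm$ of the stencil are held fixed, $h\to0^+$, and the exact value at stencil index $(k,\ell)\in d_{i,j}^\pm\cup e_{i,j}^\pm$ is $u_\pm(x_i^*+(v_0+k)h,y_j^*+(w_0+\ell)h)$. A 13-point scheme is given by non-trivial polynomials $C_{k,\ell}(h)$, $(k,\ell)\in S$, and a right-hand side that is a finite linear combination of the $f_\pm^{(m,n)},g_D^{(m,n)},g_N^{(m,n)}$ with coefficients depending only on $a_\pm$, $\Gamma_I$, $v_0,w_0$, the partition and $h$. It has accuracy order $p$ if, for all smooth $u_\pm$ and corresponding $f_\pm,g_D,g_N$ satisfying the interface problem near the base point, the difference between $\sum_{(k,\ell)\in S}C_{k,\ell}(h)\cdot(\text{exact value at }(k,\ell))$ and the right-hand side is $\mathcal{O}(h^{p+1})$ as $h\to0$ (i.e. $\mathcal{O}(h^p)$ after division by $h$). That the maximum accuracy order is five means that five is the largest $p$ such that a 13-point scheme of accuracy order $p$ exists for all admissible data (coefficients $a_\pm$, interface, irregular point, base point). *)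

theory Defs
  imports "HOL-Analysis.Analysis" "HOL-Library.Landau_Symbols" "HOL-Computational_Algebra.Polynomial"
begin

type_synonym plane = "real \<times> real"

definition dx :: "(plane \<Rightarrow> real) \<Rightarrow> plane \<Rightarrow> real" where
  "dx F q = deriv (\<lambda>t. F (t, snd q)) (fst q)"

definition dy :: "(plane \<Rightarrow> real) \<Rightarrow> plane \<Rightarrow> real" where
  "dy F q = deriv (\<lambda>t. F (fst q, t)) (snd q)"

definition pd :: "nat \<Rightarrow> nat \<Rightarrow> (plane \<Rightarrow> real) \<Rightarrow> plane \<Rightarrow> real" where
  "pd m n F = (dx ^^ m) ((dy ^^ n) F)"

text \<open>A function is \<open>C\<^sup>\<infinity>\<close> on an open set iff all its iterated partial derivatives, taken in any
  order, are (Frechet) differentiable there.\<close>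

inductive_set iterated_partials :: "(plane \<Rightarrow> real) \<Rightarrow> (plane \<Rightarrow> real) set" for F where
  base: "F \<in> iterated_partials F"
| x: "G \<in> iterated_partials F \<Longrightarrow> dx G \<in> iterated_partials F"
| y: "G \<in> iterated_partials F \<Longrightarrow> dy G \<in> iterated_partials F"

definition smooth_on :: "plane set \<Rightarrow> (plane \<Rightarrow> real) \<Rightarrow> bool" where
  "smooth_on U F \<longleftrightarrow> open U \<and> (\<forall>G \<in> iterated_partials F. G differentiable_on U)"

definition smooth_near :: "plane \<Rightarrow> (plane \<Rightarrow> real) \<Rightarrow> bool" where
  "smooth_near p F \<longleftrightarrow> (\<exists>U. p \<in> U \<and> smooth_on U F)"

definition smooth_near_0 :: "(real \<Rightarrow> real) \<Rightarrow> bool" where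
  "smooth_near_0 r \<longleftrightarrow> (\<exists>\<delta>>0. \<forall>k. (deriv ^^ k) r differentiable_on {-\<delta><..<\<delta>})"

definition curve :: "(real \<Rightarrow> real) \<Rightarrow> (real \<Rightarrow> real) \<Rightarrow> plane \<Rightarrow> real \<Rightarrow> plane" where
  "curve r s p t = (r t + fst p, s t + snd p)"

text \<open>The two unit normals along the curve correspond to \<open>\<sigma> = 1\<close> and \<open>\<sigma> = -1\<close>.\<close>

definition curve_normal :: "(real \<Rightarrow> real) \<Rightarrow> (real \<Rightarrow> real) \<Rightarrow> real \<Rightarrow> real \<Rightarrow> plane" where
  "curve_normal r s \<sigma> t =
     (\<sigma> / sqrt ((deriv r t)\<^sup>2 + (deriv s t)\<^sup>2)) *\<^sub>R (deriv s t, - deriv r t)"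

text \<open>Near \<open>p\<close> the zero set of \<open>\<psi>\<close> is the smooth regular curve \<open>(r, s) + p\<close> (the two conditions on
  \<open>\<psi> = 0\<close> say that the germs at \<open>p\<close> coincide, so self-intersections at \<open>p\<close> are excluded), it separates
  \<open>\<psi> > 0\<close> from \<open>\<psi> < 0\<close>, and the normal selected by \<open>\<sigma>\<close> points towards \<open>\<psi> > 0\<close>.  The gradient of
  \<open>\<psi>\<close> is not required to be nonzero.\<close>

definition local_interface ::
  "(plane \<Rightarrow> real) \<Rightarrow> plane \<Rightarrow> (real \<Rightarrow> real) \<Rightarrow> (real \<Rightarrow> real) \<Rightarrow> real \<Rightarrow> bool" where
  "local_interface \<psi> p r s \<sigma> \<longleftrightarrow>
     smooth_near_0 r \<and> smooth_near_0 s \<and> r 0 = 0 \<and> s 0 = 0 \<and>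
     (\<forall>\<^sub>F t in nhds 0. (deriv r t)\<^sup>2 + (deriv s t)\<^sup>2 > 0) \<and>
     (\<forall>\<^sub>F t in nhds 0. \<psi> (curve r s p t) = 0) \<and>
     (\<forall>\<delta>>0. \<forall>\<^sub>F q in nhds p. \<psi> q = 0 \<longrightarrow> q \<in> curve r s p ` {-\<delta><..<\<delta>}) \<and>
     \<sigma> \<in> {-1, 1} \<and>
     (\<forall>\<^sub>F t in nhds 0. \<forall>\<^sub>F \<epsilon> in at_right 0.
        \<psi> (curve r s p t + \<epsilon> *\<^sub>R curve_normal r s \<sigma> t) > 0 \<and>
        \<psi> (curve r s p t - \<epsilon> *\<^sub>R curve_normal r s \<sigma> t) < 0)"

text \<open>\<open>mesh\<close> is the actual mesh size of the grid; it determines the partition of the stencil and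
  \<open>v0\<close>, \<open>w0\<close>.  The variable \<open>h \<rightarrow> 0\<close> of the accuracy analysis is a different one.
  \<open>a_plus\<close> and \<open>a_minus\<close> are the smooth extensions of the two restrictions of the coefficient.\<close>

record interface_data =
  L1 :: real
  L2 :: real
  L3 :: real
  L4 :: real
  mesh :: real
  num_x :: nat
  num_y :: nat
  idx_i :: nat
  idx_j :: nat
  level :: "plane \<Rightarrow> real"
  a_plus :: "plane \<Rightarrow> real"
  a_minus :: "plane \<Rightarrow> real"
  base_pt :: plane
  curve_r :: "real \<Rightarrow> real"
  curve_s :: "real \<Rightarrow> real"
  orient :: real

definition node :: "interface_data \<Rightarrow> int \<times> int \<Rightarrow> plane" where
  "node D = (\<lambda>(k, l). (L1 D + (real (idx_i D) + real_of_int k) * mesh D,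
                       L3 D + (real (idx_j D) + real_of_int l) * mesh D))"

definition inner_offsets :: "(int \<times> int) set" where
  "inner_offsets = {-1, 0, 1} \<times> {-1, 0, 1}"

definition outer_offsets :: "(int \<times> int) set" where
  "outer_offsets = {(-2, 0), (0, -2), (0, 2), (2, 0)}"

definition d_plus :: "interface_data \<Rightarrow> (int \<times> int) set" where
  "d_plus D = {kl \<in> inner_offsets. level D (node D kl) \<ge> 0}"

definition d_minus :: "interface_data \<Rightarrow> (int \<times> int) set" where
  "d_minus D = {kl \<in> inner_offsets. level D (node D kl) < 0}"

definition e_plus :: "interface_data \<Rightarrow> (int \<times> int) set" where
  "e_plus D = {kl \<in> outer_offsets. level D (node D kl) \<ge> 0}"

definition e_minus :: "interface_data \<Rightarrow> (int \<times> int) set" where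
  "e_minus D = {kl \<in> outer_offsets. level D (node D kl) < 0}"

definition stencil :: "(int \<times> int) set" where
  "stencil = inner_offsets \<union> outer_offsets"

definition v0 :: "interface_data \<Rightarrow> real" where
  "v0 D = (fst (node D (0, 0)) - fst (base_pt D)) / mesh D"

definition w0 :: "interface_data \<Rightarrow> real" where
  "w0 D = (snd (node D (0, 0)) - snd (base_pt D)) / mesh D"

text \<open>The grid point is interior in the sense that its whole 13-point stencil lies in the closed
  rectangle.\<close>

definition admissible :: "interface_data \<Rightarrow> bool" where
  "admissible D \<longleftrightarrow>
     L1 D < L2 D \<and> L3 D < L4 D \<and> mesh D > 0 \<and>
     L2 D - L1 D = real (num_x D) * mesh D \<and> L4 D - L3 D = real (num_y D) * mesh D \<and>
     2 \<le> idx_i D \<and> idx_i D + 2 \<le> num_x D \<and> 2 \<le> idx_j D \<and> idx_j D + 2 \<le> num_y D \<and>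
     (\<exists>U. {L1 D..L2 D} \<times> {L3 D..L4 D} \<subseteq> U \<and> smooth_on U (level D)) \<and>
     (\<forall>q \<in> {L1 D<..<L2 D} \<times> {L3 D<..<L4 D}. level D q = 0 \<longrightarrow>
        (\<exists>r s \<sigma>. local_interface (level D) q r s \<sigma>)) \<and>
     d_plus D \<noteq> {} \<and> d_minus D \<noteq> {} \<and>
     level D (base_pt D) = 0 \<and> -1 < v0 D \<and> v0 D < 1 \<and> -1 < w0 D \<and> w0 D < 1 \<and>
     local_interface (level D) (base_pt D) (curve_r D) (curve_s D) (orient D) \<and>
     smooth_near (base_pt D) (a_plus D) \<and> smooth_near (base_pt D) (a_minus D) \<and>
     (\<forall>\<^sub>F q in nhds (base_pt D). a_plus D q > 0 \<and> a_minus D q > 0)"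

definition neg_div_grad :: "(plane \<Rightarrow> real) \<Rightarrow> (plane \<Rightarrow> real) \<Rightarrow> plane \<Rightarrow> real" where
  "neg_div_grad a u q = - (dx (\<lambda>p. a p * dx u p) q + dy (\<lambda>p. a p * dy u p) q)"

definition flux :: "(plane \<Rightarrow> real) \<Rightarrow> (plane \<Rightarrow> real) \<Rightarrow> plane \<Rightarrow> plane \<Rightarrow> real" where
  "flux a u q \<nu> = (a q *\<^sub>R (dx u q, dy u q)) \<bullet> \<nu>"

text \<open>The interface problem near the base point for the smooth extensions of \<open>u\<close> and \<open>f\<close> from both
  sides.  By continuity of the extensions, the one-sided limits in the jumps are their values on the
  curve.\<close>

definition local_solution ::
  "interface_data \<Rightarrow> (plane \<Rightarrow> real) \<Rightarrow> (plane \<Rightarrow> real) \<Rightarrow> (plane \<Rightarrow> real) \<Rightarrow> (plane \<Rightarrow> real) \<Rightarrow>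
   (plane \<Rightarrow> real) \<Rightarrow> (plane \<Rightarrow> real) \<Rightarrow> bool" where
  "local_solution D up um fp fm gD gN \<longleftrightarrow>
     (let p = base_pt D; \<gamma> = curve (curve_r D) (curve_s D) p;
          \<nu> = curve_normal (curve_r D) (curve_s D) (orient D) in
      (\<forall>F \<in> {up, um, fp, fm, gD, gN}. smooth_near p F) \<and>
      (\<forall>\<^sub>F q in nhds p. level D q > 0 \<longrightarrow> neg_div_grad (a_plus D) up q = fp q) \<and>
      (\<forall>\<^sub>F q in nhds p. level D q < 0 \<longrightarrow> neg_div_grad (a_minus D) um q = fm q) \<and>
      (\<forall>\<^sub>F t in nhds 0. up (\<gamma> t) - um (\<gamma> t) = gD (\<gamma> t)) \<and>
      (\<forall>\<^sub>F t in nhds 0. flux (a_plus D) up (\<gamma> t) (\<nu> t) - flux (a_minus D) um (\<gamma> t) (\<nu> t) = gN (\<gamma> t)))"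

definition Lam :: "nat \<Rightarrow> (nat \<times> nat) set" where
  "Lam N = {(m, n). m + n \<le> N}"

definition LamV1 :: "nat \<Rightarrow> (nat \<times> nat) set" where
  "LamV1 N = {(m, n) \<in> Lam N. m \<in> {0, 1}}"

definition LamV2 :: "nat \<Rightarrow> (nat \<times> nat) set" where
  "LamV2 N = Lam N - LamV1 N"

text \<open>Arguments of a coefficient family: \<open>m'\<close>, \<open>n'\<close>, \<open>m\<close>, \<open>n\<close>.\<close>

type_synonym coeff_family = "nat \<Rightarrow> nat \<Rightarrow> nat \<Rightarrow> nat \<Rightarrow> real"

definition reduces_derivatives ::
  "nat \<Rightarrow> (plane \<Rightarrow> real) \<Rightarrow> plane \<Rightarrow> coeff_family \<Rightarrow> coeff_family \<Rightarrow> bool" where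
  "reduces_derivatives M a p Au Af \<longleftrightarrow>
     (\<forall>u. smooth_near p u \<longrightarrow> (\<forall>(m', n') \<in> LamV2 (M + 1).
        pd m' n' u p =
          (\<Sum>(m, n) \<in> {(m, n) \<in> LamV1 (M + 1). m + n \<le> m' + n'}. Au m' n' m n * pd m n u p) +
          (\<Sum>(m, n) \<in> {(m, n) \<in> Lam (M - 1). m + n + 2 \<le> m' + n'}.
             Af m' n' m n * pd m n (neg_div_grad a u) p)))"

text \<open>The coefficients are uniquely determined on the index ranges occurring above, which are the only
  ones used below, so the choice is harmless; likewise for the transmission coefficients.\<close>

definition reduction_coeffs :: "nat \<Rightarrow> (plane \<Rightarrow> real) \<Rightarrow> plane \<Rightarrow> coeff_family \<times> coeff_family" where
  "reduction_coeffs M a p = (SOME (Au, Af). reduces_derivatives M a p Au Af)"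

definition A_u :: "nat \<Rightarrow> (plane \<Rightarrow> real) \<Rightarrow> plane \<Rightarrow> coeff_family" where
  "A_u M a p = fst (reduction_coeffs M a p)"

definition A_f :: "nat \<Rightarrow> (plane \<Rightarrow> real) \<Rightarrow> plane \<Rightarrow> coeff_family" where
  "A_f M a p = snd (reduction_coeffs M a p)"

definition GV :: "(plane \<Rightarrow> real) \<Rightarrow> plane \<Rightarrow> nat \<Rightarrow> nat \<Rightarrow> nat \<Rightarrow> real \<Rightarrow> real \<Rightarrow> real" where
  "GV a p M m n x y =
     (\<Sum>l = 0..n div 2. (-1) ^ l * x ^ (m + 2 * l) * y ^ (n - 2 * l) /
        (fact (m + 2 * l) * fact (n - 2 * l))) +
     (\<Sum>(m', n') \<in> {(m', n') \<in> LamV2 (M + 1). m' + n' > m + n}.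
        A_u M a p m' n' m n * (x ^ m' * y ^ n' / (fact m' * fact n')))"

definition QV :: "(plane \<Rightarrow> real) \<Rightarrow> plane \<Rightarrow> nat \<Rightarrow> nat \<Rightarrow> nat \<Rightarrow> real \<Rightarrow> real \<Rightarrow> real" where
  "QV a p M m n x y =
     1 / a p * (\<Sum>l = 1..1 + n div 2. (-1) ^ l * x ^ (m + 2 * l) * y ^ (n + 2 - 2 * l) /
        (fact (m + 2 * l) * fact (n + 2 - 2 * l))) +
     (\<Sum>(m', n') \<in> {(m', n') \<in> LamV2 (M + 1). m' + n' > m + n + 2}.
        A_f M a p m' n' m n * (x ^ m' * y ^ n' / (fact m' * fact n')))"

record transmission_family =
  T_u :: coeff_family
  T_plus :: coeff_family
  T_minus :: coeff_family
  T_gD :: coeff_family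
  T_gN :: coeff_family

definition is_transmission :: "nat \<Rightarrow> interface_data \<Rightarrow> transmission_family \<Rightarrow> bool" where
  "is_transmission M D T \<longleftrightarrow>
     (\<forall>up um fp fm gD gN. local_solution D up um fp fm gD gN \<longrightarrow>
       (let p = base_pt D in \<forall>(m', n') \<in> LamV1 (M + 1).
         pd m' n' um p =
           (\<Sum>(m, n) \<in> {(m, n) \<in> LamV1 (M + 1). m + n \<le> m' + n'}. T_u T m' n' m n * pd m n up p) +
           (\<Sum>(m, n) \<in> Lam (M - 1).
              T_plus T m' n' m n * pd m n fp p + T_minus T m' n' m n * pd m n fm p) +
           (\<Sum>(m, n) \<in> Lam (M + 1). T_gD T m' n' m n * pd m n gD p) +
           (\<Sum>(m, n) \<in> Lam M. T_gN T m' n' m n * pd m n gN p)))"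

definition transmission_coeffs :: "nat \<Rightarrow> interface_data \<Rightarrow> transmission_family" where
  "transmission_coeffs M D = (SOME T. is_transmission M D T)"

text \<open>A finite difference scheme on the 13-point stencil: polynomial coefficients in \<open>h\<close>, and a
  right-hand side given by \<open>h\<close>-dependent coefficients of finitely many derivatives of the data.  The
  coefficients cannot depend on the solution or on \<open>f\<close>, \<open>g\<^sub>D\<close>, \<open>g\<^sub>N\<close>, since \<open>has_accuracy_order\<close>
  quantifies over these for a given scheme.\<close>

record scheme =
  stencil_coeff :: "int \<times> int \<Rightarrow> real poly"
  idx_fp :: "(nat \<times> nat) set"
  idx_fm :: "(nat \<times> nat) set"
  idx_gD :: "(nat \<times> nat) set"
  idx_gN :: "(nat \<times> nat) set"
  rhs_fp :: "nat \<Rightarrow> nat \<Rightarrow> real \<Rightarrow> real"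
  rhs_fm :: "nat \<Rightarrow> nat \<Rightarrow> real \<Rightarrow> real"
  rhs_gD :: "nat \<Rightarrow> nat \<Rightarrow> real \<Rightarrow> real"
  rhs_gN :: "nat \<Rightarrow> nat \<Rightarrow> real \<Rightarrow> real"

definition nontrivial :: "(int \<times> int \<Rightarrow> real poly) \<Rightarrow> bool" where
  "nontrivial C \<longleftrightarrow> (\<exists>kl \<in> stencil. poly (C kl) 0 \<noteq> 0)"

definition is_13_point_scheme :: "scheme \<Rightarrow> bool" where
  "is_13_point_scheme \<S> \<longleftrightarrow> nontrivial (stencil_coeff \<S>) \<and>
     finite (idx_fp \<S>) \<and> finite (idx_fm \<S>) \<and> finite (idx_gD \<S>) \<and> finite (idx_gN \<S>)"

definition exact_value ::
  "interface_data \<Rightarrow> (plane \<Rightarrow> real) \<Rightarrow> (plane \<Rightarrow> real) \<Rightarrow> real \<Rightarrow> int \<times> int \<Rightarrow> real" where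
  "exact_value D up um h = (\<lambda>(k, l).
     (if (k, l) \<in> d_plus D \<union> e_plus D then up else um)
       (fst (base_pt D) + (v0 D + real_of_int k) * h, snd (base_pt D) + (w0 D + real_of_int l) * h))"

definition scheme_rhs ::
  "scheme \<Rightarrow> plane \<Rightarrow> (plane \<Rightarrow> real) \<Rightarrow> (plane \<Rightarrow> real) \<Rightarrow> (plane \<Rightarrow> real) \<Rightarrow> (plane \<Rightarrow> real) \<Rightarrow>
   real \<Rightarrow> real" where
  "scheme_rhs \<S> p fp fm gD gN h =
     (\<Sum>(m, n) \<in> idx_fp \<S>. pd m n fp p * rhs_fp \<S> m n h) +
     (\<Sum>(m, n) \<in> idx_fm \<S>. pd m n fm p * rhs_fm \<S> m n h) +
     (\<Sum>(m, n) \<in> idx_gD \<S>. pd m n gD p * rhs_gD \<S> m n h) +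
     (\<Sum>(m, n) \<in> idx_gN \<S>. pd m n gN p * rhs_gN \<S> m n h)"

definition has_accuracy_order :: "interface_data \<Rightarrow> scheme \<Rightarrow> nat \<Rightarrow> bool" where
  "has_accuracy_order D \<S> ord \<longleftrightarrow>
     (\<forall>up um fp fm gD gN. local_solution D up um fp fm gD gN \<longrightarrow>
        (\<lambda>h. (\<Sum>kl \<in> stencil. poly (stencil_coeff \<S> kl) h * exact_value D up um h kl) -
             scheme_rhs \<S> (base_pt D) fp fm gD gN h)
          \<in> O[at_right 0](\<lambda>h. h ^ (ord + 1)))"

definition G_plus :: "interface_data \<Rightarrow> nat \<Rightarrow> nat \<Rightarrow> real \<Rightarrow> int \<times> int \<Rightarrow> real" where
  "G_plus D m n h = (\<lambda>(k, l). GV (a_plus D) (base_pt D) 4 m n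
     ((v0 D + real_of_int k) * h) ((w0 D + real_of_int l) * h))"

definition G_minus :: "interface_data \<Rightarrow> nat \<Rightarrow> nat \<Rightarrow> real \<Rightarrow> int \<times> int \<Rightarrow> real" where
  "G_minus D m n h = (\<lambda>(k, l). GV (a_minus D) (base_pt D) 4 m n
     ((v0 D + real_of_int k) * h) ((w0 D + real_of_int l) * h))"

definition Q_plus :: "interface_data \<Rightarrow> nat \<Rightarrow> nat \<Rightarrow> real \<Rightarrow> int \<times> int \<Rightarrow> real" where
  "Q_plus D m n h = (\<lambda>(k, l). QV (a_plus D) (base_pt D) 4 m n
     ((v0 D + real_of_int k) * h) ((w0 D + real_of_int l) * h))"

definition Q_minus :: "interface_data \<Rightarrow> nat \<Rightarrow> nat \<Rightarrow> real \<Rightarrow> int \<times> int \<Rightarrow> real" where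
  "Q_minus D m n h = (\<lambda>(k, l). QV (a_minus D) (base_pt D) 4 m n
     ((v0 D + real_of_int k) * h) ((w0 D + real_of_int l) * h))"

definition coeff_polys :: "(int \<times> int \<Rightarrow> nat \<Rightarrow> real) \<Rightarrow> int \<times> int \<Rightarrow> real poly" where
  "coeff_polys c kl = (\<Sum>i\<le>5. monom (c kl i) i)"

definition solves_system :: "interface_data \<Rightarrow> (int \<times> int \<Rightarrow> real poly) \<Rightarrow> bool" where
  "solves_system D C \<longleftrightarrow> (\<forall>(m, n) \<in> LamV1 5.
     (\<lambda>h. (\<Sum>kl \<in> d_minus D \<union> e_minus D. poly (C kl) h *
              (\<Sum>(m', n') \<in> {(m', n') \<in> LamV1 5. m' + n' \<ge> m + n}.
                 G_minus D m' n' h kl * T_u (transmission_coeffs 4 D) m' n' m n)) +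
          (\<Sum>kl \<in> d_plus D \<union> e_plus D. poly (C kl) h * G_plus D m n h kl))
       \<in> O[at_right 0](\<lambda>h. h ^ 6))"

definition I_minus :: "interface_data \<Rightarrow> (int \<times> int \<Rightarrow> real poly) \<Rightarrow> nat \<Rightarrow> nat \<Rightarrow> real \<Rightarrow> real" where
  "I_minus D C m n h = (\<Sum>kl \<in> d_minus D \<union> e_minus D. poly (C kl) h * G_minus D m n h kl)"

definition I_sum ::
  "interface_data \<Rightarrow> (int \<times> int \<Rightarrow> real poly) \<Rightarrow> coeff_family \<Rightarrow> nat \<Rightarrow> nat \<Rightarrow> real \<Rightarrow> real" where
  "I_sum D C T m n h = (\<Sum>(m', n') \<in> LamV1 5. I_minus D C m' n' h * T m' n' m n)"

definition J_plus :: "interface_data \<Rightarrow> (int \<times> int \<Rightarrow> real poly) \<Rightarrow> nat \<Rightarrow> nat \<Rightarrow> real \<Rightarrow> real" where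
  "J_plus D C m n h =
     (\<Sum>kl \<in> d_plus D \<union> e_plus D. poly (C kl) h * Q_plus D m n h kl) +
     I_sum D C (T_plus (transmission_coeffs 4 D)) m n h"

definition J_minus :: "interface_data \<Rightarrow> (int \<times> int \<Rightarrow> real poly) \<Rightarrow> nat \<Rightarrow> nat \<Rightarrow> real \<Rightarrow> real" where
  "J_minus D C m n h =
     (\<Sum>kl \<in> d_minus D \<union> e_minus D. poly (C kl) h * Q_minus D m n h kl) +
     I_sum D C (T_minus (transmission_coeffs 4 D)) m n h"

definition interface_scheme :: "interface_data \<Rightarrow> (int \<times> int \<Rightarrow> real poly) \<Rightarrow> scheme" where
  "interface_scheme D C =
     \<lparr> stencil_coeff = C,
       idx_fp = Lam 3, idx_fm = Lam 3, idx_gD = Lam 5, idx_gN = Lam 4,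
       rhs_fp = J_plus D C, rhs_fm = J_minus D C,
       rhs_gD = I_sum D C (T_gD (transmission_coeffs 4 D)),
       rhs_gN = I_sum D C (T_gN (transmission_coeffs 4 D)) \<rparr>"

definition order_attainable :: "nat \<Rightarrow> bool" where
  "order_attainable ord \<longleftrightarrow>
     (\<forall>D. admissible D \<longrightarrow> (\<exists>\<S>. is_13_point_scheme \<S> \<and> has_accuracy_order D \<S> ord))"

end

theory Submission
  imports Defs
begin

text \<open>
  Three facts carry the proof.

  \<^bold>\<open>The scheme has order five.\<close> The equation \<open>- div (a grad u) = f\<close> expresses \<open>u\<^sub>x\<^sub>x\<close> through
  \<open>u\<^sub>y\<^sub>y\<close>, lower derivatives and \<open>f\<close>. Hence every derivative of \<open>u\<close> at the base point is a universal linear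
  combination of derivatives of \<open>f\<close> and of the derivatives of \<open>u\<close> with at most one \<open>x\<close>; substituting this
  into the Taylor polynomial of degree five produces the functions \<open>G\<close> and \<open>Q\<close> (\<open>reduced_expansion\<close>).
  The coefficients of this reduction are only specified by what they do, whereas the top-order part of
  \<open>G\<close> and \<open>Q\<close> is explicit; the two agree because homogeneous polynomials as test functions
  determine the top-order coefficients (\<open>A_u_leading\<close>, \<open>A_f_leading\<close>).

  The derivatives on the two sides are coupled by the jump conditions. Differentiating the jump of
  \<open>u\<close> along the interface \<open>N\<close> times, and the jump of the flux \<open>N - 1\<close> times, gives two linear equations for
  the two derivatives of order \<open>N\<close> of \<open>u\<^sub>-\<close> with at most one \<open>x\<close>. At top order \<open>u\<^sub>-\<close> behaves like
  a harmonic function, so that \<open>\<partial>\<^sub>x\<close> acts like \<open>\<i> \<partial>\<^sub>y\<close>; the two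
  equations then read off the real and the imaginary part of multiplication by \<open>(s' + \<i> r')\<^sup>N\<close>, and
  their determinant is a nonzero multiple of \<open>(r'\<^sup>2 + s'\<^sup>2)\<^sup>N\<close>. By induction on \<open>N\<close> the transmission coefficients
  exist (\<open>transmission_lin_comb\<close>). After both substitutions the error of the scheme is a
  combination of the left-hand sides of the linear system, up to \<open>O(h\<^sup>6)\<close>
  (\<open>interface_scheme_accuracy\<close>).

  \<^bold>\<open>A non-trivial scheme exists.\<close> The system consists of at most eleven equations for thirteen unknowns over the
  integral domain of polynomials in \<open>h\<close>, so it has a nonzero solution, and dividing by a
  power of \<open>h\<close> makes it nonzero at \<open>h = 0\<close> (\<open>nontrivial_polynomial_solution\<close>).

  \<^bold>\<open>Order six is impossible in general.\<close> For a straight interface with the coefficients \<open>3\<close> and \<open>1\<close>, a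
  harmonic \<open>U\<close> on the plus side continues to \<open>2 U - U \<circ> R\<close> on the minus side, \<open>R\<close> being the reflection
  in the line, with vanishing data. A scheme of order six annihilates these pairs for every harmonic
  polynomial \<open>U\<close> of degree at most six. With exactly the nodes \<open>(1, 1)\<close> and \<open>(2, 0)\<close> on the minus
  side, these thirteen conditions force all thirteen values \<open>C(0)\<close> to vanish (\<open>stencil_moments\<close>).
\<close>

section \<open>Smooth functions of two variables\<close>

lemma smooth_on_open: "smooth_on U F \<Longrightarrow> open U"
  by (simp add: smooth_on_def)

lemma smooth_on_subset: "smooth_on U F \<Longrightarrow> open V \<Longrightarrow> V \<subseteq> U \<Longrightarrow> smooth_on V F"
  unfolding smooth_on_def using differentiable_on_subset by blast

lemma iterated_partials_trans:
  assumes "H \<in> iterated_partials G" "G \<in> iterated_partials F"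
  shows "H \<in> iterated_partials F"
  using assms(1) by induction (auto intro: assms(2) iterated_partials.intros)

lemma smooth_on_dx: "smooth_on U F \<Longrightarrow> smooth_on U (dx F)"
  unfolding smooth_on_def
  by (meson iterated_partials.base iterated_partials.x iterated_partials_trans)

lemma smooth_on_dy: "smooth_on U F \<Longrightarrow> smooth_on U (dy F)"
  unfolding smooth_on_def
  by (meson iterated_partials.base iterated_partials.y iterated_partials_trans)

lemma partials_of_has_derivative:
  assumes "(F has_derivative D) (at q)"
  shows "((\<lambda>t. F (t, snd q)) has_real_derivative D (1, 0)) (at (fst q))"
    and "((\<lambda>t. F (fst q, t)) has_real_derivative D (0, 1)) (at (snd q))"
proof -
  interpret D: bounded_linear D using assms by (rule has_derivative_bounded_linear)
  have a: "((\<lambda>t. (t, snd q)) has_derivative (\<lambda>v. (v, 0))) (at (fst q))"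
    and b: "((\<lambda>t. (fst q, t)) has_derivative (\<lambda>v. (0, v))) (at (snd q))"
    by (auto intro!: derivative_eq_intros)
  have "((\<lambda>t. F (t, snd q)) has_derivative (\<lambda>v. D (v, 0))) (at (fst q))"
    using has_derivative_compose[OF a, of F D] assms by simp
  moreover have "(\<lambda>v. D (v, 0)) = (\<lambda>v. D (1, 0) * v)"
  proof
    fix v :: real
    have "D (v *\<^sub>R (1, 0)) = v *\<^sub>R D (1, 0)" by (rule D.scaleR)
    then show "D (v, 0) = D (1, 0) * v" by simp
  qed
  ultimately show "((\<lambda>t. F (t, snd q)) has_real_derivative D (1, 0)) (at (fst q))"
    by (simp add: has_field_derivative_def)
  have "((\<lambda>t. F (fst q, t)) has_derivative (\<lambda>v. D (0, v))) (at (snd q))"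
    using has_derivative_compose[OF b, of F D] assms by simp
  moreover have "(\<lambda>v. D (0, v)) = (\<lambda>v. D (0, 1) * v)"
  proof
    fix v :: real
    have "D (v *\<^sub>R (0, 1)) = v *\<^sub>R D (0, 1)" by (rule D.scaleR)
    then show "D (0, v) = D (0, 1) * v" by simp
  qed
  ultimately show "((\<lambda>t. F (fst q, t)) has_real_derivative D (0, 1)) (at (snd q))"
    by (simp add: has_field_derivative_def)
qed

lemma dx_dy_of_has_derivative:
  assumes "(F has_derivative (\<lambda>v. fst v * A + snd v * B)) (at q)"
  shows "dx F q = A" "dy F q = B"
  using partials_of_has_derivative[OF assms] by (auto simp: dx_def dy_def intro!: DERIV_imp_deriv)

lemma smooth_on_has_derivative:
  assumes "smooth_on U F" "q \<in> U"
  shows "(F has_derivative (\<lambda>v. fst v * dx F q + snd v * dy F q)) (at q)"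
proof -
  have "F differentiable (at q)"
    using assms unfolding smooth_on_def differentiable_on_def
    by (metis at_within_open iterated_partials.base)
  then obtain D where D: "(F has_derivative D) (at q)" by (auto simp: differentiable_def)
  interpret D: bounded_linear D using D by (rule has_derivative_bounded_linear)
  have "D v = fst v * D (1, 0) + snd v * D (0, 1)" for v
  proof -
    have "D v = D (fst v *\<^sub>R (1, 0) + snd v *\<^sub>R (0, 1))" by (cases v) simp
    then show ?thesis by (simp only: D.add D.scaleR real_scaleR_def)
  qed
  then have e: "D = (\<lambda>v. fst v * D (1, 0) + snd v * D (0, 1))" by blast
  from D have "(F has_derivative (\<lambda>v. fst v * D (1, 0) + snd v * D (0, 1))) (at q)"
    using e by metis
  with dx_dy_of_has_derivative[OF this] show ?thesis by simp
qed

lemma smooth_on_continuous_on: "smooth_on U F \<Longrightarrow> continuous_on U F"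
  unfolding smooth_on_def using differentiable_imp_continuous_on iterated_partials.base by blast

lemma open_horizontal: "open U \<Longrightarrow> q \<in> U \<Longrightarrow> \<forall>\<^sub>F t in nhds (fst q). (t, snd q) \<in> U"
  for U :: "plane set" and q :: plane
proof -
  assume "open U" "q \<in> U"
  have "isCont (\<lambda>t. (t, snd q)) (fst q)" by (intro continuous_intros)
  then have "((\<lambda>t. (t, snd q)) \<longlongrightarrow> q) (nhds (fst q))"
    unfolding isCont_def by (simp add: tendsto_nhds_iff)
  from topological_tendstoD[OF this \<open>open U\<close> \<open>q \<in> U\<close>] show ?thesis .
qed

lemma open_vertical: "open U \<Longrightarrow> q \<in> U \<Longrightarrow> \<forall>\<^sub>F t in nhds (snd q). (fst q, t) \<in> U"
  for U :: "plane set" and q :: plane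
proof -
  assume "open U" "q \<in> U"
  have "isCont (\<lambda>t. (fst q, t)) (snd q)" by (intro continuous_intros)
  then have "((\<lambda>t. (fst q, t)) \<longlongrightarrow> q) (nhds (snd q))"
    unfolding isCont_def by (simp add: tendsto_nhds_iff)
  from topological_tendstoD[OF this \<open>open U\<close> \<open>q \<in> U\<close>] show ?thesis .
qed

lemma dx_cong_open:
  assumes "open U" "q \<in> U" "\<And>q. q \<in> U \<Longrightarrow> F q = G q"
  shows "dx F q = dx G q"
  unfolding dx_def
  by (rule deriv_cong_ev) (use open_horizontal[OF assms(1,2)] in \<open>auto elim!: eventually_mono simp: assms(3)\<close>)

lemma dy_cong_open:
  assumes "open U" "q \<in> U" "\<And>q. q \<in> U \<Longrightarrow> F q = G q"
  shows "dy F q = dy G q"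
  unfolding dy_def
  by (rule deriv_cong_ev) (use open_vertical[OF assms(1,2)] in \<open>auto elim!: eventually_mono simp: assms(3)\<close>)

lemma pd_0_0 [simp]: "pd 0 0 F = F" by (simp add: pd_def)
lemma pd_Suc_left: "pd (Suc m) n F = dx (pd m n F)" by (simp add: pd_def)
lemma pd_0_Suc: "pd 0 (Suc n) F = dy (pd 0 n F)" by (simp add: pd_def)

lemma pd_cong_open:
  assumes "open U" "q \<in> U" "\<And>q. q \<in> U \<Longrightarrow> F q = G q"
  shows "pd m n F q = pd m n G q"
proof -
  have y: "\<forall>q\<in>U. pd 0 n F q = pd 0 n G q" for n
    by (induction n) (auto simp: pd_0_Suc assms(3) intro!: dy_cong_open[OF assms(1)])
  have "\<forall>q\<in>U. pd m n F q = pd m n G q"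
    by (induction m) (auto simp: pd_Suc_left y intro!: dx_cong_open[OF assms(1)])
  with assms(2) show ?thesis by blast
qed

text \<open>Iterated partial derivatives of a composite function are only equal on \<open>U\<close> to the expected
  expressions, so the definition of smoothness is awkward to check directly. It suffices to exhibit a class of
  functions that is closed under differentiation on \<open>U\<close>.\<close>

lemma smooth_on_coinduct:
  assumes "open U" "P F"
    and step: "\<And>G. P G \<Longrightarrow> \<exists>Gx Gy. P Gx \<and> P Gy \<and>
        (\<forall>q\<in>U. (G has_derivative (\<lambda>v. fst v * Gx q + snd v * Gy q)) (at q))"
  shows "smooth_on U F"
proof -
  have "\<exists>G. P G \<and> (\<forall>q\<in>U. H q = G q)" if "H \<in> iterated_partials F" for H
    using that
  proof induction
    case base
    then show ?case using assms(2) by blast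
  next
    case (x H)
    then obtain G where G: "P G" "\<forall>q\<in>U. H q = G q" by blast
    from step[OF G(1)] obtain Gx Gy where g: "P Gx"
      "\<forall>q\<in>U. (G has_derivative (\<lambda>v. fst v * Gx q + snd v * Gy q)) (at q)" by blast
    have "\<forall>q\<in>U. dx H q = Gx q"
      using dx_cong_open[OF assms(1), of _ H G] G(2) dx_dy_of_has_derivative(1)[OF bspec[OF g(2)]] by simp
    then show ?case using g(1) by blast
  next
    case (y H)
    then obtain G where G: "P G" "\<forall>q\<in>U. H q = G q" by blast
    from step[OF G(1)] obtain Gx Gy where g: "P Gy"
      "\<forall>q\<in>U. (G has_derivative (\<lambda>v. fst v * Gx q + snd v * Gy q)) (at q)" by blast
    have "\<forall>q\<in>U. dy H q = Gy q"
      using dy_cong_open[OF assms(1), of _ H G] G(2) dx_dy_of_has_derivative(2)[OF bspec[OF g(2)]] by simp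
    then show ?case using g(1) by blast
  qed
  note represent = this
  have "H differentiable_on U" if H: "H \<in> iterated_partials F" for H
    unfolding differentiable_on_def
  proof (intro ballI)
    fix q assume q: "q \<in> U"
    obtain G where G: "P G" "\<forall>q\<in>U. H q = G q" using represent[OF H] by blast
    from step[OF G(1)] q obtain Gx Gy where "(G has_derivative (\<lambda>v. fst v * Gx q + snd v * Gy q)) (at q)"
      by blast
    then have "(H has_derivative (\<lambda>v. fst v * Gx q + snd v * Gy q)) (at q)"
      by (rule has_derivative_transform_within_open[OF _ assms(1) q]) (use G in auto)
    then show "H differentiable at q within U"
      using differentiable_def has_derivative_at_withinI by blast
  qed
  with assms(1) show ?thesis by (simp add: smooth_on_def)
qed

text \<open>Closed under differentiation by the Leibniz rule, hence a class to which coinduction applies.\<close>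

inductive smooth_algebra :: "plane set \<Rightarrow> (plane \<Rightarrow> real) \<Rightarrow> bool" for U where
  "smooth_on U F \<Longrightarrow> smooth_algebra U F"
| "smooth_algebra U F \<Longrightarrow> smooth_algebra U G \<Longrightarrow> smooth_algebra U (\<lambda>q. F q + G q)"
| "smooth_algebra U F \<Longrightarrow> smooth_algebra U G \<Longrightarrow> smooth_algebra U (\<lambda>q. F q * G q)"

lemma smooth_algebra_smooth:
  assumes "open U" "smooth_algebra U F"
  shows "smooth_on U F"
proof (rule smooth_on_coinduct[where P = "smooth_algebra U"])
  fix G assume "smooth_algebra U G"
  then show "\<exists>Gx Gy. smooth_algebra U Gx \<and> smooth_algebra U Gy \<and>
        (\<forall>q\<in>U. (G has_derivative (\<lambda>v. fst v * Gx q + snd v * Gy q)) (at q))"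
  proof induction
    case (1 F)
    show ?case
      using smooth_on_has_derivative[OF 1] smooth_algebra.intros(1)[OF smooth_on_dx[OF 1]]
        smooth_algebra.intros(1)[OF smooth_on_dy[OF 1]] by blast
  next
    case (2 F G)
    then obtain Fx Fy Gx Gy where s:
      "smooth_algebra U Fx" "smooth_algebra U Fy" "smooth_algebra U Gx" "smooth_algebra U Gy"
      and d: "\<And>q. q \<in> U \<Longrightarrow> (F has_derivative (\<lambda>v. fst v * Fx q + snd v * Fy q)) (at q)"
      "\<And>q. q \<in> U \<Longrightarrow> (G has_derivative (\<lambda>v. fst v * Gx q + snd v * Gy q)) (at q)"
      by blast
    have "((\<lambda>q. F q + G q) has_derivative
        (\<lambda>v. fst v * (Fx q + Gx q) + snd v * (Fy q + Gy q))) (at q)" if "q \<in> U" for q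
      by (rule has_derivative_eq_rhs[OF has_derivative_add[OF d[OF that]]]) (simp add: algebra_simps)
    then show ?case
      by (intro exI[of _ "\<lambda>q. Fx q + Gx q"] exI[of _ "\<lambda>q. Fy q + Gy q"])
        (simp add: smooth_algebra.intros s)
  next
    case (3 F G)
    then obtain Fx Fy Gx Gy where s:
      "smooth_algebra U Fx" "smooth_algebra U Fy" "smooth_algebra U Gx" "smooth_algebra U Gy"
      and d: "\<And>q. q \<in> U \<Longrightarrow> (F has_derivative (\<lambda>v. fst v * Fx q + snd v * Fy q)) (at q)"
      "\<And>q. q \<in> U \<Longrightarrow> (G has_derivative (\<lambda>v. fst v * Gx q + snd v * Gy q)) (at q)"
      by blast
    have "((\<lambda>q. F q * G q) has_derivative
        (\<lambda>v. fst v * (F q * Gx q + Fx q * G q) + snd v * (F q * Gy q + Fy q * G q))) (at q)"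
      if "q \<in> U" for q
      by (rule has_derivative_eq_rhs[OF has_derivative_mult[OF d[OF that]]]) (simp add: algebra_simps)
    then show ?case
      by (intro exI[of _ "\<lambda>q. F q * Gx q + Fx q * G q"] exI[of _ "\<lambda>q. F q * Gy q + Fy q * G q"])
        (simp add: smooth_algebra.intros s 3)
  qed
qed (use assms in auto)

lemma smooth_on_add: "smooth_on U F \<Longrightarrow> smooth_on U G \<Longrightarrow> smooth_on U (\<lambda>q. F q + G q)"
  by (rule smooth_algebra_smooth[OF smooth_on_open]) (auto intro: smooth_algebra.intros)

lemma smooth_on_mult: "smooth_on U F \<Longrightarrow> smooth_on U G \<Longrightarrow> smooth_on U (\<lambda>q. F q * G q)"
  by (rule smooth_algebra_smooth[OF smooth_on_open]) (auto intro: smooth_algebra.intros)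

lemma smooth_on_const: "open U \<Longrightarrow> smooth_on U (\<lambda>q. c)"
proof (rule smooth_on_coinduct[where P = "\<lambda>G. \<exists>c. G = (\<lambda>q. c)"])
  fix G :: "plane \<Rightarrow> real" assume "\<exists>c. G = (\<lambda>q. c)"
  then show "\<exists>Gx Gy. (\<exists>c. Gx = (\<lambda>q. c)) \<and> (\<exists>c. Gy = (\<lambda>q. c)) \<and>
      (\<forall>q\<in>U. (G has_derivative (\<lambda>v. fst v * Gx q + snd v * Gy q)) (at q))"
    by (intro exI[of _ "\<lambda>q. 0"]) auto
qed auto

lemma smooth_on_cmult: "smooth_on U F \<Longrightarrow> smooth_on U (\<lambda>q. c * F q)"
  by (intro smooth_on_mult smooth_on_const smooth_on_open)

lemma smooth_on_uminus: "smooth_on U F \<Longrightarrow> smooth_on U (\<lambda>q. - F q)"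
  using smooth_on_cmult[of U F "-1"] by simp

lemma smooth_on_cong:
  assumes "smooth_on U F" "\<And>q. q \<in> U \<Longrightarrow> F q = G q"
  shows "smooth_on U G"
proof (rule smooth_on_coinduct[where P = "\<lambda>G. \<exists>F. smooth_on U F \<and> (\<forall>q\<in>U. F q = G q)"])
  show "open U" using assms(1) by (rule smooth_on_open)
  fix G assume "\<exists>F. smooth_on U F \<and> (\<forall>q\<in>U. F q = G q)"
  then obtain F where F: "smooth_on U F" "\<forall>q\<in>U. F q = G q" by blast
  have "(G has_derivative (\<lambda>v. fst v * dx F q + snd v * dy F q)) (at q)" if "q \<in> U" for q
    by (rule has_derivative_transform_within_open[OF smooth_on_has_derivative[OF F(1) that]])
      (use F that smooth_on_open in auto)
  then show "\<exists>Gx Gy. (\<exists>F. smooth_on U F \<and> (\<forall>q\<in>U. F q = Gx q)) \<and> (\<exists>F. smooth_on U F \<and> (\<forall>q\<in>U. F q = Gy q)) \<and>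
            (\<forall>q\<in>U. (G has_derivative (\<lambda>v. fst v * Gx q + snd v * Gy q)) (at q))"
    using smooth_on_dx[OF F(1)] smooth_on_dy[OF F(1)] by blast
qed (use assms in blast)

lemma
  assumes "smooth_on U F" "smooth_on U G" "q \<in> U"
  shows dx_add: "dx (\<lambda>q. F q + G q) q = dx F q + dx G q"
    and dy_add: "dy (\<lambda>q. F q + G q) q = dy F q + dy G q"
    and dx_mult: "dx (\<lambda>q. F q * G q) q = dx F q * G q + F q * dx G q"
    and dy_mult: "dy (\<lambda>q. F q * G q) q = dy F q * G q + F q * dy G q"
proof -
  note d = smooth_on_has_derivative[OF assms(1,3)] smooth_on_has_derivative[OF assms(2,3)]
  have "((\<lambda>q. F q + G q) has_derivative (\<lambda>v. fst v * (dx F q + dx G q) + snd v * (dy F q + dy G q))) (at q)"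
    by (rule has_derivative_eq_rhs[OF has_derivative_add[OF d]]) (auto simp: algebra_simps)
  from dx_dy_of_has_derivative[OF this]
  show "dx (\<lambda>q. F q + G q) q = dx F q + dx G q" "dy (\<lambda>q. F q + G q) q = dy F q + dy G q" .
  have "((\<lambda>q. F q * G q) has_derivative (\<lambda>v. fst v * (dx F q * G q + F q * dx G q) + snd v * (dy F q * G q + F q * dy G q))) (at q)"
    by (rule has_derivative_eq_rhs[OF has_derivative_mult[OF d]]) (auto simp: algebra_simps)
  from dx_dy_of_has_derivative[OF this]
  show "dx (\<lambda>q. F q * G q) q = dx F q * G q + F q * dx G q" "dy (\<lambda>q. F q * G q) q = dy F q * G q + F q * dy G q" .
qed

lemma dx_cmult: "smooth_on U F \<Longrightarrow> q \<in> U \<Longrightarrow> dx (\<lambda>q. c * F q) q = c * dx F q"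
  and dy_cmult: "smooth_on U F \<Longrightarrow> q \<in> U \<Longrightarrow> dy (\<lambda>q. c * F q) q = c * dy F q"
  using dx_mult[OF smooth_on_const, of U F q c] dy_mult[OF smooth_on_const, of U F q c]
  by (auto simp: smooth_on_open dx_def dy_def)

lemma dx_uminus: "smooth_on U F \<Longrightarrow> q \<in> U \<Longrightarrow> dx (\<lambda>q. - F q) q = - dx F q"
  and dy_uminus: "smooth_on U F \<Longrightarrow> q \<in> U \<Longrightarrow> dy (\<lambda>q. - F q) q = - dy F q"
  using dx_cmult[of U F q "-1"] dy_cmult[of U F q "-1"] by auto

lemma smooth_on_deriv_x:
  assumes "smooth_on U F" "(t, y) \<in> U"
  shows "((\<lambda>t. F (t, y)) has_real_derivative dx F (t, y)) (at t)"
  using partials_of_has_derivative(1)[OF smooth_on_has_derivative[OF assms]] by simp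

lemma smooth_on_deriv_y:
  assumes "smooth_on U F" "(x, t) \<in> U"
  shows "((\<lambda>t. F (x, t)) has_real_derivative dy F (x, t)) (at t)"
  using partials_of_has_derivative(2)[OF smooth_on_has_derivative[OF assms]] by simp

text \<open>The second difference of \<open>F\<close> over a square of side \<open>h\<close> is, by the mean value theorem in both
  variables, \<open>h\<^sup>2\<close> times a value of either mixed derivative, depending on the order of the variables.\<close>

lemma second_difference_mean_value:
  assumes F: "smooth_on U F" and h: "h > 0" and box: "{x..x+h} \<times> {y..y+h} \<subseteq> U"
  obtains q r where "q \<in> {x..x+h} \<times> {y..y+h}" "r \<in> {x..x+h} \<times> {y..y+h}" "dy (dx F) q = dx (dy F) r"
proof -
  have inU: "(u, v) \<in> U" if "x \<le> u" "u \<le> x + h" "y \<le> v" "v \<le> y + h" for u v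
    using that box by auto
  have xx: "x < x + h" "y < y + h" using h by auto
  have "\<exists>u>x. u < x + h \<and>
      (F (x+h, y+h) - F (x+h, y)) - (F (x, y+h) - F (x, y)) = (x + h - x) * (dx F (u, y+h) - dx F (u, y))"
    by (rule MVT2[OF xx(1)], rule DERIV_diff; rule smooth_on_deriv_x[OF F]; rule inU) (use h in auto)
  then obtain u where u: "x < u" "u < x + h"
      "(F (x+h, y+h) - F (x+h, y)) - (F (x, y+h) - F (x, y)) = (x + h - x) * (dx F (u, y+h) - dx F (u, y))"
    by blast
  have "\<exists>v>y. v < y + h \<and> dx F (u, y+h) - dx F (u, y) = (y + h - y) * dy (dx F) (u, v)"
    by (rule MVT2[OF xx(2)], rule smooth_on_deriv_y[OF smooth_on_dx[OF F]], rule inU) (use u in auto)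
  then obtain v where v: "y < v" "v < y + h" "dx F (u, y+h) - dx F (u, y) = (y + h - y) * dy (dx F) (u, v)"
    by blast
  have "\<exists>w>y. w < y + h \<and>
      (F (x+h, y+h) - F (x, y+h)) - (F (x+h, y) - F (x, y)) = (y + h - y) * (dy F (x+h, w) - dy F (x, w))"
    by (rule MVT2[OF xx(2)], rule DERIV_diff; rule smooth_on_deriv_y[OF F]; rule inU) (use h in auto)
  then obtain w where w: "y < w" "w < y + h"
      "(F (x+h, y+h) - F (x, y+h)) - (F (x+h, y) - F (x, y)) = (y + h - y) * (dy F (x+h, w) - dy F (x, w))"
    by blast
  have "\<exists>z>x. z < x + h \<and> dy F (x+h, w) - dy F (x, w) = (x + h - x) * dx (dy F) (z, w)"
    by (rule MVT2[OF xx(1)], rule smooth_on_deriv_x[OF smooth_on_dy[OF F]], rule inU) (use w in auto)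
  then obtain z where z: "x < z" "z < x + h" "dy F (x+h, w) - dy F (x, w) = (x + h - x) * dx (dy F) (z, w)"
    by blast
  have "h * (h * dy (dx F) (u, v)) = h * (h * dx (dy F) (z, w))"
    using u(3) v(3) w(3) z(3) by (simp add: algebra_simps)
  then have "dy (dx F) (u, v) = dx (dy F) (z, w)" using h by simp
  then show thesis using that[of "(u, v)" "(z, w)"] u v w z by auto
qed

text \<open>Both points of the mean value lemma tend to \<open>q\<close> when the square shrinks to \<open>q\<close>.\<close>

lemma mixed_partials_commute:
  assumes F: "smooth_on U F" and q: "q \<in> U"
  shows "dy (dx F) q = dx (dy F) q"
proof -
  have U: "open U" using F by (rule smooth_on_open)
  have close: "\<bar>dy (dx F) q - dx (dy F) q\<bar> \<le> e" if e: "e > 0" for e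
  proof -
    have c: "isCont (dy (dx F)) q" "isCont (dx (dy F)) q"
      using smooth_on_continuous_on[OF smooth_on_dy[OF smooth_on_dx[OF F]]]
        smooth_on_continuous_on[OF smooth_on_dx[OF smooth_on_dy[OF F]]] U q
      by (auto simp: continuous_on_eq_continuous_at)
    have "\<forall>\<^sub>F r in nhds q. dist (dy (dx F) r) (dy (dx F) q) < e / 2 \<and>
        dist (dx (dy F) r) (dx (dy F) q) < e / 2 \<and> r \<in> U"
      using c e U q unfolding isCont_def tendsto_at_iff_tendsto_nhds
      by (intro eventually_conj tendstoD) (auto intro: eventually_nhds_in_open)
    then obtain d where d: "d > 0" and dd: "\<And>r. dist r q < d \<Longrightarrow> dist (dy (dx F) r) (dy (dx F) q) < e / 2 \<and>
        dist (dx (dy F) r) (dx (dy F) q) < e / 2 \<and> r \<in> U"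
      by (auto simp: eventually_nhds_metric)
    \<comment> \<open>A square with corner \<open>q\<close> that fits into the ball of radius \<open>d\<close>.\<close>
    let ?B = "{fst q..fst q + d/3} \<times> {snd q..snd q + d/3}"
    have near: "dist r q < d" if "r \<in> ?B" for r
    proof -
      have "dist r q \<le> dist (fst r) (fst q) + dist (snd r) (snd q)"
        by (cases r; cases q) (simp add: dist_Pair_Pair sqrt_sum_squares_le_sum)
      also have "\<dots> \<le> d/3 + d/3" using that by (auto simp: dist_real_def)
      also have "\<dots> < d" using d by simp
      finally show ?thesis .
    qed
    have "?B \<subseteq> U" using near dd by blast
    moreover have "d / 3 > 0" using d by simp
    ultimately obtain r r' where r: "r \<in> ?B" "r' \<in> ?B" and eq: "dy (dx F) r = dx (dy F) r'"
      using second_difference_mean_value[OF F] by metis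
    then have "dist (dy (dx F) r) (dy (dx F) q) < e / 2" "dist (dx (dy F) r') (dx (dy F) q) < e / 2"
      using dd[OF near[OF r(1)]] dd[OF near[OF r(2)]] by blast+
    then show ?thesis using eq unfolding dist_real_def by linarith
  qed
  then have "\<bar>dy (dx F) q - dx (dy F) q\<bar> \<le> 0" by (rule field_le_epsilon) (use close in auto)
  then show ?thesis by simp
qed

lemma smooth_on_pd: "smooth_on U F \<Longrightarrow> smooth_on U (pd m n F)"
proof -
  assume F: "smooth_on U F"
  have "smooth_on U (pd 0 n F)" for n by (induction n) (auto simp: F pd_0_Suc intro: smooth_on_dy)
  then show ?thesis by (induction m) (auto simp: pd_Suc_left intro: smooth_on_dx)
qed

lemma dy_pd:
  assumes "smooth_on U F" "q \<in> U"
  shows "dy (pd m n F) q = pd m (Suc n) F q"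
proof -
  have U: "open U" using assms(1) by (rule smooth_on_open)
  have "\<forall>q\<in>U. dy (pd m n F) q = pd m (Suc n) F q"
  proof (induction m)
    case 0
    then show ?case by (simp add: pd_0_Suc)
  next
    case (Suc m)
    show ?case
    proof
      fix q assume q: "q \<in> U"
      have "dy (pd (Suc m) n F) q = dx (dy (pd m n F)) q"
        using mixed_partials_commute[OF smooth_on_pd[OF assms(1)] q] by (simp add: pd_Suc_left)
      also have "\<dots> = dx (pd m (Suc n) F) q"
        by (rule dx_cong_open[OF U q]) (use Suc in auto)
      finally show "dy (pd (Suc m) n F) q = pd (Suc m) (Suc n) F q" by (simp add: pd_Suc_left)
    qed
  qed
  then show ?thesis using assms(2) by blast
qed

section \<open>Reduction of partial derivatives by the equation\<close>

text \<open>The functional \<open>\<phi>\<close> on \<open>X\<close> is a linear combination of the functionals \<open>b k\<close>, with coefficients that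
  do not depend on the element of \<open>X\<close>. Reduction and transmission are statements of this form about a set
  \<open>X\<close> of solutions; keeping the coefficients hidden avoids computing them.\<close>

definition lin_comb :: "'s set \<Rightarrow> ('k \<Rightarrow> 's \<Rightarrow> real) \<Rightarrow> 'k set \<Rightarrow> ('s \<Rightarrow> real) \<Rightarrow> bool" where
  "lin_comb X b K \<phi> \<longleftrightarrow> (\<exists>c. \<forall>s\<in>X. \<phi> s = (\<Sum>k\<in>K. c k * b k s))"

lemma lin_combI: "(\<And>s. s \<in> X \<Longrightarrow> \<phi> s = (\<Sum>k\<in>K. c k * b k s)) \<Longrightarrow> lin_comb X b K \<phi>"
  unfolding lin_comb_def by blast

lemma lin_comb_zero: "lin_comb X b K (\<lambda>s. 0)"
  by (rule lin_combI[where c = "\<lambda>k. 0"]) simp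

lemma lin_comb_basis:
  assumes "finite K" "k \<in> K"
  shows "lin_comb X b K (b k)"
proof (rule lin_combI[where c = "\<lambda>j. if j = k then 1 else 0"])
  fix s
  have "(\<Sum>j\<in>K. (if j = k then 1 else 0) * b j s) = (\<Sum>j\<in>K. if j = k then b j s else 0)"
    by (rule sum.cong) auto
  then show "b k s = (\<Sum>j\<in>K. (if j = k then 1 else 0) * b j s)" using assms by simp
qed

lemma lin_comb_add:
  assumes "lin_comb X b K \<phi>" "lin_comb X b K \<psi>"
  shows "lin_comb X b K (\<lambda>s. \<phi> s + \<psi> s)"
proof -
  obtain c d where "\<forall>s\<in>X. \<phi> s = (\<Sum>k\<in>K. c k * b k s)" "\<forall>s\<in>X. \<psi> s = (\<Sum>k\<in>K. d k * b k s)"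
    using assms unfolding lin_comb_def by blast
  then show ?thesis
    by (intro lin_combI[where c = "\<lambda>k. c k + d k"]) (simp add: algebra_simps sum.distrib)
qed

lemma lin_comb_cmult:
  assumes "lin_comb X b K \<phi>"
  shows "lin_comb X b K (\<lambda>s. r * \<phi> s)"
proof -
  obtain c where "\<forall>s\<in>X. \<phi> s = (\<Sum>k\<in>K. c k * b k s)"
    using assms unfolding lin_comb_def by blast
  then show ?thesis
    by (intro lin_combI[where c = "\<lambda>k. r * c k"]) (simp add: algebra_simps sum_distrib_left)
qed

lemma lin_comb_diff:
  assumes "lin_comb X b K \<phi>" "lin_comb X b K \<psi>"
  shows "lin_comb X b K (\<lambda>s. \<phi> s - \<psi> s)"
  using lin_comb_add[OF assms(1) lin_comb_cmult[OF assms(2), of "-1"]] by simp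

lemma lin_comb_cong:
  assumes "lin_comb X b K \<phi>" "\<And>s. s \<in> X \<Longrightarrow> \<psi> s = \<phi> s"
  shows "lin_comb X b K \<psi>"
  using assms unfolding lin_comb_def by metis

lemma lin_comb_member:
  assumes "finite K" "k \<in> K" "\<And>s. s \<in> X \<Longrightarrow> \<phi> s = b k s"
  shows "lin_comb X b K \<phi>"
  using lin_comb_cong[OF lin_comb_basis[OF assms(1,2)]] assms(3) by blast

lemma lin_comb_sum:
  assumes "\<And>i. i \<in> I \<Longrightarrow> lin_comb X b K (\<phi> i)"
  shows "lin_comb X b K (\<lambda>s. \<Sum>i\<in>I. \<phi> i s)"
  using assms
proof (induction I rule: infinite_finite_induct)
  case (insert i I)
  then have "lin_comb X b K (\<lambda>s. \<phi> i s + (\<Sum>i\<in>I. \<phi> i s))"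
    by (intro lin_comb_add) auto
  with insert show ?case by simp
qed (simp_all add: lin_comb_zero)

lemma lin_comb_trans:
  assumes "lin_comb X b K \<phi>" "\<And>k. k \<in> K \<Longrightarrow> lin_comb X b' K' (b k)"
  shows "lin_comb X b' K' \<phi>"
proof -
  obtain c where c: "\<forall>s\<in>X. \<phi> s = (\<Sum>k\<in>K. c k * b k s)"
    using assms(1) unfolding lin_comb_def by blast
  have "lin_comb X b' K' (\<lambda>s. \<Sum>k\<in>K. c k * b k s)"
    by (rule lin_comb_sum, rule lin_comb_cmult, rule assms(2))
  then show ?thesis using lin_comb_cong c by blast
qed

lemma lin_comb_mono:
  assumes "lin_comb X b K \<phi>" "K \<subseteq> K'" "finite K'"
  shows "lin_comb X b K' \<phi>"
proof (rule lin_comb_trans[OF assms(1)])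
  fix k assume "k \<in> K"
  then have "k \<in> K'" using assms(2) by blast
  then show "lin_comb X b K' (b k)" by (rule lin_comb_basis[OF assms(3)])
qed

lemma lin_comb_pullback:
  assumes "lin_comb X b K \<phi>" "\<And>s. s \<in> Y \<Longrightarrow> g s \<in> X"
  shows "lin_comb Y (\<lambda>k s. b k (g s)) K (\<lambda>s. \<phi> (g s))"
  using assms unfolding lin_comb_def by fast

text \<open>Linear differential operators of order at most \<open>J\<close> with coefficients that are smooth on \<open>U\<close>. They
  collect remainders of lower order, of which only the order matters.\<close>

inductive diff_op :: "plane set \<Rightarrow> nat \<Rightarrow> ((plane \<Rightarrow> real) \<Rightarrow> plane \<Rightarrow> real) \<Rightarrow> bool" for U where
  monomial: "smooth_on U c \<Longrightarrow> i + j \<le> J \<Longrightarrow> diff_op U J (\<lambda>u q. c q * pd i j u q)"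
| add: "diff_op U J \<Theta> \<Longrightarrow> diff_op U J \<Theta>' \<Longrightarrow> diff_op U J (\<lambda>u q. \<Theta> u q + \<Theta>' u q)"

lemma diff_op_smooth:
  assumes "diff_op U J \<Theta>" "smooth_on V u" "open U"
  shows "smooth_on (U \<inter> V) (\<Theta> u)"
proof -
  have "open V" using assms(2) by (rule smooth_on_open)
  then have o: "open (U \<inter> V)" using assms(3) by blast
  show ?thesis using assms(1)
    by induction (auto intro!: smooth_on_add smooth_on_mult smooth_on_pd
        intro: smooth_on_subset[OF _ o] assms(2))
qed

lemma diff_op_derivatives:
  assumes "diff_op U J \<Theta>" "open U"
  shows "\<exists>\<Theta>x. diff_op U (Suc J) \<Theta>x \<and>
           (\<forall>V u q. smooth_on V u \<longrightarrow> q \<in> U \<inter> V \<longrightarrow> dx (\<Theta> u) q = \<Theta>x u q)"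
    and "\<exists>\<Theta>y. diff_op U (Suc J) \<Theta>y \<and>
           (\<forall>V u q. smooth_on V u \<longrightarrow> q \<in> U \<inter> V \<longrightarrow> dy (\<Theta> u) q = \<Theta>y u q)"
proof -
  have mono: "smooth_on (U \<inter> V) c \<and> smooth_on (U \<inter> V) (pd i j u)"
    if "smooth_on U c" "smooth_on V u" for V c u i j
    using that smooth_on_subset[of _ _ "U \<inter> V"] smooth_on_pd smooth_on_open by (metis Int_lower1 Int_lower2 open_Int)
  show "\<exists>\<Theta>x. diff_op U (Suc J) \<Theta>x \<and>
           (\<forall>V u q. smooth_on V u \<longrightarrow> q \<in> U \<inter> V \<longrightarrow> dx (\<Theta> u) q = \<Theta>x u q)"
    using assms(1)
  proof induction
    case (monomial c i j J)
    have "diff_op U (Suc J) (\<lambda>u q. dx c q * pd i j u q + c q * pd (Suc i) j u q)"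
      using monomial by (intro diff_op.intros smooth_on_dx) auto
    moreover have "dx (\<lambda>q. c q * pd i j u q) q = dx c q * pd i j u q + c q * pd (Suc i) j u q"
      if "smooth_on V u" "q \<in> U \<inter> V" for V u q
      using dx_mult[of "U \<inter> V" c "pd i j u" q] mono[OF monomial(1) that(1)] that by (simp add: pd_Suc_left)
    ultimately show ?case by blast
  next
    case (add J \<Theta> \<Theta>')
    then obtain A B where ab: "diff_op U (Suc J) A" "diff_op U (Suc J) B"
      "\<And>V u q. smooth_on V u \<Longrightarrow> q \<in> U \<inter> V \<Longrightarrow> dx (\<Theta> u) q = A u q"
      "\<And>V u q. smooth_on V u \<Longrightarrow> q \<in> U \<inter> V \<Longrightarrow> dx (\<Theta>' u) q = B u q"
      by blast
    have "dx (\<lambda>q. \<Theta> u q + \<Theta>' u q) q = A u q + B u q" if "smooth_on V u" "q \<in> U \<inter> V" for V u q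
      using dx_add[OF diff_op_smooth[OF add(1) that(1) assms(2)] diff_op_smooth[OF add(2) that(1) assms(2)] that(2)]
        ab(3,4)[OF that] by simp
    then show ?case using diff_op.add[OF ab(1,2)] by blast
  qed
  show "\<exists>\<Theta>y. diff_op U (Suc J) \<Theta>y \<and>
           (\<forall>V u q. smooth_on V u \<longrightarrow> q \<in> U \<inter> V \<longrightarrow> dy (\<Theta> u) q = \<Theta>y u q)"
    using assms(1)
  proof induction
    case (monomial c i j J)
    have "diff_op U (Suc J) (\<lambda>u q. dy c q * pd i j u q + c q * pd i (Suc j) u q)"
      using monomial by (intro diff_op.intros smooth_on_dy) auto
    moreover have "dy (\<lambda>q. c q * pd i j u q) q = dy c q * pd i j u q + c q * pd i (Suc j) u q"
      if "smooth_on V u" "q \<in> U \<inter> V" for V u q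
      using dy_mult[of "U \<inter> V" c "pd i j u" q] mono[OF monomial(1) that(1)] that dy_pd[of V u q i j] by simp
    ultimately show ?case by blast
  next
    case (add J \<Theta> \<Theta>')
    then obtain A B where ab: "diff_op U (Suc J) A" "diff_op U (Suc J) B"
      "\<And>V u q. smooth_on V u \<Longrightarrow> q \<in> U \<inter> V \<Longrightarrow> dy (\<Theta> u) q = A u q"
      "\<And>V u q. smooth_on V u \<Longrightarrow> q \<in> U \<inter> V \<Longrightarrow> dy (\<Theta>' u) q = B u q"
      by blast
    have "dy (\<lambda>q. \<Theta> u q + \<Theta>' u q) q = A u q + B u q" if "smooth_on V u" "q \<in> U \<inter> V" for V u q
      using dy_add[OF diff_op_smooth[OF add(1) that(1) assms(2)] diff_op_smooth[OF add(2) that(1) assms(2)] that(2)]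
        ab(3,4)[OF that] by simp
    then show ?case using diff_op.add[OF ab(1,2)] by blast
  qed
qed

lemma diff_op_vanish:
  assumes "diff_op U J \<Theta>" "\<And>i j. i + j \<le> J \<Longrightarrow> pd i j u p = 0"
  shows "\<Theta> u p = 0"
  using assms by induction auto

lemma diff_op_lin_comb:
  assumes "diff_op U J \<Theta>" "\<And>i j. i + j \<le> J \<Longrightarrow> lin_comb X b K (\<lambda>u. pd i j u p)"
  shows "lin_comb X b K (\<lambda>u. \<Theta> u p)"
  using assms by induction (auto intro: lin_comb_add lin_comb_cmult)

lemma smooth_on_neg_div_grad:
  assumes a: "smooth_on U a" and u: "smooth_on V u"
  shows "smooth_on (U \<inter> V) (neg_div_grad a u)"
proof -
  have "open (U \<inter> V)" using a u smooth_on_open by blast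
  then have s: "smooth_on (U \<inter> V) a" "smooth_on (U \<inter> V) u" using a u smooth_on_subset by blast+
  then have "smooth_on (U \<inter> V) (\<lambda>q. - (dx (\<lambda>p. a p * dx u p) q + dy (\<lambda>p. a p * dy u p) q))"
    by (intro smooth_on_uminus smooth_on_add smooth_on_dx smooth_on_dy smooth_on_mult)
  then show ?thesis by (simp add: neg_div_grad_def[abs_def])
qed

text \<open>A derivative of \<open>div (a grad u)\<close> that falls on \<open>a\<close> no longer falls on \<open>u\<close>, so that only
  \<open>a\<close> times the derivative of the Laplacian has full order.\<close>

lemma pd_neg_div_grad:
  assumes a: "smooth_on U a"
  shows "\<exists>\<Theta>. diff_op U (m + n + 1) \<Theta> \<and> (\<forall>V u q. smooth_on V u \<longrightarrow> q \<in> U \<inter> V \<longrightarrow>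
     pd m n (neg_div_grad a u) q = - a q * (pd (m + 2) n u q + pd m (n + 2) u q) + \<Theta> u q)"
proof -
  have U: "open U" using a by (rule smooth_on_open)
  have s: "open (U \<inter> V)" "smooth_on (U \<inter> V) a" "\<And>i j. smooth_on (U \<inter> V) (pd i j u)"
     "smooth_on (U \<inter> V) u"
    if "smooth_on V u" for u V
    using that smooth_on_subset[of _ _ "U \<inter> V"] smooth_on_pd smooth_on_open U a
    by (metis Int_lower1 Int_lower2 open_Int)+
  have principal: "dx (\<lambda>q. - a q * (pd i j u q + pd k l u q) + \<Theta> u q) q =
        - dx a q * (pd i j u q + pd k l u q) - a q * (pd (Suc i) j u q + pd (Suc k) l u q) + dx (\<Theta> u) q"
      "dy (\<lambda>q. - a q * (pd i j u q + pd k l u q) + \<Theta> u q) q =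
        - dy a q * (pd i j u q + pd k l u q) - a q * (pd i (Suc j) u q + pd k (Suc l) u q) + dy (\<Theta> u) q"
    if u: "smooth_on V u" and q: "q \<in> U \<inter> V" and \<Theta>: "diff_op U J \<Theta>" for u V q \<Theta> i j k l J
  proof -
    note s = s[OF u] diff_op_smooth[OF \<Theta> u U]
    note r = smooth_on_uminus[OF s(2)] smooth_on_add[OF s(3)[of i j] s(3)[of k l]]
    note r' = r smooth_on_mult[OF r]
    show "dx (\<lambda>q. - a q * (pd i j u q + pd k l u q) + \<Theta> u q) q =
        - dx a q * (pd i j u q + pd k l u q) - a q * (pd (Suc i) j u q + pd (Suc k) l u q) + dx (\<Theta> u) q"
      using dx_add[OF r'(3) s(5) q] dx_mult[OF r q] dx_uminus[OF s(2) q] dx_add[OF s(3)[of i j] s(3)[of k l] q]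
      by (simp add: pd_Suc_left)
    show "dy (\<lambda>q. - a q * (pd i j u q + pd k l u q) + \<Theta> u q) q =
        - dy a q * (pd i j u q + pd k l u q) - a q * (pd i (Suc j) u q + pd k (Suc l) u q) + dy (\<Theta> u) q"
      using dy_add[OF r'(3) s(5) q] dy_mult[OF r q] dy_uminus[OF s(2) q] dy_add[OF s(3)[of i j] s(3)[of k l] q]
         dy_pd[OF s(4) q] by simp
  qed
  have y: "\<exists>\<Theta>. diff_op U (n + 1) \<Theta> \<and> (\<forall>V u q. smooth_on V u \<longrightarrow> q \<in> U \<inter> V \<longrightarrow>
     pd 0 n (neg_div_grad a u) q = - a q * (pd 2 n u q + pd 0 (n + 2) u q) + \<Theta> u q)" for n
  proof (induction n)
    case 0
    have "diff_op U 1 (\<lambda>u q. (- dx a q) * pd 1 0 u q + (- dy a q) * pd 0 1 u q)"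
      by (intro diff_op.intros smooth_on_uminus smooth_on_dx smooth_on_dy a) auto
    moreover have "neg_div_grad a u q = - a q * (pd 2 0 u q + pd 0 2 u q) +
        (- dx a q * pd 1 0 u q + - dy a q * pd 0 1 u q)" if "smooth_on V u" "q \<in> U \<inter> V" for V u q
      using dx_mult[OF s(2)[OF that(1)] smooth_on_dx[OF s(4)[OF that(1)]] that(2)]
        dy_mult[OF s(2)[OF that(1)] smooth_on_dy[OF s(4)[OF that(1)]] that(2)]
      by (simp add: neg_div_grad_def pd_Suc_left pd_0_Suc numeral_2_eq_2 algebra_simps)
    ultimately show ?case by (intro exI conjI) (auto simp: numeral_2_eq_2)
  next
    case (Suc n)
    then obtain \<Theta> where t: "diff_op U (n + 1) \<Theta>" and e: "\<And>V u q. smooth_on V u \<Longrightarrow> q \<in> U \<inter> V \<Longrightarrow>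
       pd 0 n (neg_div_grad a u) q = - a q * (pd 2 n u q + pd 0 (n + 2) u q) + \<Theta> u q"
      by blast
    obtain \<Theta>' where t': "diff_op U (Suc n + 1) \<Theta>'"
      and e': "\<And>V u q. smooth_on V u \<Longrightarrow> q \<in> U \<inter> V \<Longrightarrow> dy (\<Theta> u) q = \<Theta>' u q"
      using diff_op_derivatives(2)[OF t U] by auto
    let ?T = "(\<lambda>u q. ((- dy a q) * pd 2 n u q + (- dy a q) * pd 0 (n + 2) u q) + \<Theta>' u q)"
    have "diff_op U (Suc n + 1) ?T"
      by (intro diff_op.intros smooth_on_uminus smooth_on_dy a t') auto
    moreover have "pd 0 (Suc n) (neg_div_grad a u) q = - a q * (pd 2 (Suc n) u q + pd 0 (Suc n + 2) u q) +
       ?T u q"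
      if "smooth_on V u" "q \<in> U \<inter> V" for V u q
      unfolding pd_0_Suc[of n "neg_div_grad a u"]
      using dy_cong_open[OF s(1)[OF that(1)] that(2) e[OF that(1)]] principal(2)[OF that t, of 2 n 0 "n + 2"] e'[OF that]
      by (simp add: algebra_simps)
    ultimately show ?case by blast
  qed
  show ?thesis
  proof (induction m)
    case 0
    then show ?case using y[of n] by (simp add: numeral_2_eq_2)
  next
    case (Suc m)
    then obtain \<Theta> where t: "diff_op U (m + n + 1) \<Theta>" and e: "\<And>V u q. smooth_on V u \<Longrightarrow> q \<in> U \<inter> V \<Longrightarrow>
       pd m n (neg_div_grad a u) q = - a q * (pd (m + 2) n u q + pd m (n + 2) u q) + \<Theta> u q"
      by blast
    obtain \<Theta>' where t': "diff_op U (Suc m + n + 1) \<Theta>'"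
      and e': "\<And>V u q. smooth_on V u \<Longrightarrow> q \<in> U \<inter> V \<Longrightarrow> dx (\<Theta> u) q = \<Theta>' u q"
      using diff_op_derivatives(1)[OF t U] by auto
    let ?T = "(\<lambda>u q. ((- dx a q) * pd (m + 2) n u q + (- dx a q) * pd m (n + 2) u q) + \<Theta>' u q)"
    have "diff_op U (Suc m + n + 1) ?T"
      by (intro diff_op.intros smooth_on_uminus smooth_on_dx a t') auto
    moreover have "pd (Suc m) n (neg_div_grad a u) q = - a q * (pd (Suc m + 2) n u q + pd (Suc m) (n + 2) u q) +
       ?T u q"
      if "smooth_on V u" "q \<in> U \<inter> V" for V u q
      unfolding pd_Suc_left[of m n "neg_div_grad a u"]
      using dx_cong_open[OF s(1)[OF that(1)] that(2) e[OF that(1)]] principal(1)[OF that t, of "m + 2" n m "n + 2"] e'[OF that]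
      by (simp add: algebra_simps)
    ultimately show ?case by blast
  qed
qed

text \<open>The values \<open>\<partial>\<^sub>x\<^sup>m \<partial>\<^sub>y\<^sup>N\<^sup>-\<^sup>m u\<close> of a harmonic \<open>u\<close>, in terms of those for \<open>m = 0\<close> and \<open>m = 1\<close>: replacing
  two \<open>x\<close> by two \<open>y\<close> changes the sign.\<close>

definition harmonic_derivative :: "nat \<Rightarrow> real \<Rightarrow> real \<Rightarrow> real" where
  "harmonic_derivative m x y = (-1) ^ (m div 2) * (if even m then x else y)"

lemma harmonic_derivative_Suc_Suc: "harmonic_derivative (Suc (Suc m)) x y = - harmonic_derivative m x y"
  by (simp add: harmonic_derivative_def)

fun reduction_datum :: "(plane \<Rightarrow> real) \<Rightarrow> plane \<Rightarrow> (nat \<times> nat) + (nat \<times> nat) \<Rightarrow> (plane \<Rightarrow> real) \<Rightarrow> real" where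
  "reduction_datum a p (Inl (m, n)) u = pd m n u p"
| "reduction_datum a p (Inr (m, n)) u = pd m n (neg_div_grad a u) p"

text \<open>The bound \<open>K\<close> on the order of the derivatives of \<open>u\<close> is strict and separate from \<open>N\<close>:
  with \<open>K = N\<close> the keys contain no derivative of \<open>u\<close> of order \<open>N\<close>, with \<open>K = Suc N\<close> they do.\<close>

definition reduction_keys :: "nat \<Rightarrow> nat \<Rightarrow> ((nat \<times> nat) + (nat \<times> nat)) set" where
  "reduction_keys K N = Inl ` {(m, n). m \<le> 1 \<and> m + n < K} \<union> Inr ` {(m, n). m + n + 2 \<le> N}"

lemma finite_sum_less [simp]: "finite {(m, n). m + n < (K::nat)}"
  by (rule finite_subset[of _ "{..K} \<times> {..K}"]) auto

lemma finite_reduction_keys [simp]: "finite (reduction_keys K N)"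
  unfolding reduction_keys_def
  by (intro finite_UnI finite_imageI; rule finite_subset[OF _ finite_sum_less[of "K + N + 1"]]) auto

lemma reduction_keys_mono: "K \<le> K' \<Longrightarrow> N \<le> N' \<Longrightarrow> reduction_keys K N \<subseteq> reduction_keys K' N'"
  by (auto simp: reduction_keys_def)

text \<open>Derivatives of order \<open>N\<close> agree with those of a harmonic function up to reducible terms: solving the
  principal part for \<open>\<partial>\<^sub>x\<^sup>m\<close> moves two derivatives from \<open>x\<close> to \<open>y\<close>, at the price of a
  derivative of \<open>f\<close> and terms of order below \<open>N\<close>. The first statement exposes the harmonic part, which the transmission argument
  needs; the second is the resulting full reduction.\<close>

lemma reduction_step:
  assumes a: "smooth_on U a" "p \<in> U" "a p > 0"
  shows "\<forall>m n. m + n = N \<longrightarrow>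
      lin_comb (Collect (smooth_near p)) (reduction_datum a p) (reduction_keys N N)
           (\<lambda>u. pd m n u p - harmonic_derivative m (pd 0 N u p) (pd 1 (N - 1) u p)) \<and>
      lin_comb (Collect (smooth_near p)) (reduction_datum a p) (reduction_keys (Suc N) N)
           (\<lambda>u. pd m n u p)"
proof (induction N rule: less_induct)
  case (less N)
  let ?X = "Collect (smooth_near p)" and ?b = "reduction_datum a p"
  have lower: "lin_comb ?X ?b (reduction_keys N N) (\<lambda>u. pd i j u p)" if "i + j < N" for i j
    by (rule lin_comb_mono[OF _ reduction_keys_mono[of "Suc (i + j)" _ "i + j"]])
      (use that less.IH in auto)
  have one: "lin_comb ?X ?b (reduction_keys N N) (\<lambda>u. pd m n u p - harmonic_derivative m (pd 0 N u p) (pd 1 (N - 1) u p))"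
    if "m + n = N" for m n
    using that
  proof (induction m arbitrary: n rule: less_induct)
    case (less m)
    consider "m = 0" | "m = 1" | k where "m = Suc (Suc k)" by (metis One_nat_def not0_implies_Suc)
    then show ?case
    proof cases
      case 3
      obtain \<Theta> where t: "diff_op U (k + n + 1) \<Theta>"
        and e: "\<And>V u. smooth_on V u \<Longrightarrow> p \<in> U \<inter> V \<Longrightarrow>
          pd k n (neg_div_grad a u) p = - a p * (pd (k + 2) n u p + pd k (n + 2) u p) + \<Theta> u p"
        using pd_neg_div_grad[OF a(1), of k n] by blast
      have comb: "lin_comb ?X ?b (reduction_keys N N) (\<lambda>u. (1 / a p) * (\<Theta> u p - ?b (Inr (k, n)) u) -
           (pd k (n + 2) u p - harmonic_derivative k (pd 0 N u p) (pd 1 (N - 1) u p)))"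
      proof (rule lin_comb_diff[OF lin_comb_cmult[OF lin_comb_diff]])
        show "lin_comb ?X ?b (reduction_keys N N) (\<lambda>u. \<Theta> u p)"
          by (rule diff_op_lin_comb[OF t lower]) (use less.prems 3 in auto)
        show "lin_comb ?X ?b (reduction_keys N N) (\<lambda>u. pd k (n + 2) u p - harmonic_derivative k (pd 0 N u p) (pd 1 (N - 1) u p))"
          by (rule less.IH) (use less.prems 3 in auto)
        show "lin_comb ?X ?b (reduction_keys N N) (?b (Inr (k, n)))"
          by (rule lin_comb_basis[OF finite_reduction_keys]) (use less.prems 3 in \<open>auto simp: reduction_keys_def\<close>)
      qed
      show ?thesis
      proof (rule lin_comb_cong[OF comb])
        fix u assume "u \<in> ?X"
        then obtain V where "smooth_on V u" "p \<in> V" by (auto simp: smooth_near_def)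
        then have "pd k n (neg_div_grad a u) p = - a p * (pd (k + 2) n u p + pd k (n + 2) u p) + \<Theta> u p"
          using e a(2) by blast
        then have "pd m n u p = (1 / a p) * (\<Theta> u p - ?b (Inr (k, n)) u) - pd k (n + 2) u p"
          using a(3) 3 by (simp add: field_simps)
        then show "pd m n u p - harmonic_derivative m (pd 0 N u p) (pd 1 (N - 1) u p) =
          (1 / a p) * (\<Theta> u p - ?b (Inr (k, n)) u) -
             (pd k (n + 2) u p - harmonic_derivative k (pd 0 N u p) (pd 1 (N - 1) u p))"
          by (simp add: 3 harmonic_derivative_Suc_Suc)
      qed
    qed (use less.prems in \<open>auto simp: harmonic_derivative_def lin_comb_zero\<close>)
  qed
  have "lin_comb ?X ?b (reduction_keys (Suc N) N) (\<lambda>u. pd m n u p)" if 2: "m + n = N" for m n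
  proof -
    have "lin_comb ?X ?b (reduction_keys (Suc N) N) (\<lambda>u. (pd m n u p - harmonic_derivative m (pd 0 N u p) (pd 1 (N - 1) u p))
        + harmonic_derivative m (pd 0 N u p) (pd 1 (N - 1) u p))"
    proof (rule lin_comb_add)
      show "lin_comb ?X ?b (reduction_keys (Suc N) N) (\<lambda>u. pd m n u p - harmonic_derivative m (pd 0 N u p) (pd 1 (N - 1) u p))"
        by (rule lin_comb_mono[OF one[OF 2] reduction_keys_mono]) auto
      have z: "lin_comb ?X ?b (reduction_keys (Suc N) N) (\<lambda>u. pd 0 N u p)"
        by (rule lin_comb_member[OF finite_reduction_keys, of "Inl (0, N)"]) (simp_all add: reduction_keys_def)
      have o: "lin_comb ?X ?b (reduction_keys (Suc N) N) (\<lambda>u. pd 1 (N - 1) u p)" if "N \<ge> 1"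
        by (rule lin_comb_member[OF finite_reduction_keys, of "Inl (1, N - 1)"])
          (use that in \<open>simp_all add: reduction_keys_def\<close>)
      show "lin_comb ?X ?b (reduction_keys (Suc N) N) (\<lambda>u. harmonic_derivative m (pd 0 N u p) (pd 1 (N - 1) u p))"
      proof (cases "even m")
        case True
        then show ?thesis using lin_comb_cmult[OF z] by (simp add: harmonic_derivative_def)
      next
        case False
        then have "N \<ge> 1" using 2 by (cases m) auto
        with False show ?thesis using lin_comb_cmult[OF o] by (simp add: harmonic_derivative_def)
      qed
    qed
    then show ?thesis by simp
  qed
  with one show ?case by blast
qed

section \<open>Leading coefficients of the reduction\<close>

lemma reduces_derivatives_exists:
  assumes a: "smooth_on U a" "p \<in> U" "a p > 0" and M: "M \<ge> 1"
  shows "\<exists>Au Af. reduces_derivatives M a p Au Af"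
proof -
  have "\<forall>m n. \<exists>c. \<forall>u\<in>Collect (smooth_near p).
      pd m n u p = (\<Sum>k\<in>reduction_keys (Suc (m + n)) (m + n). c k * reduction_datum a p k u)"
    using reduction_step[OF a] unfolding lin_comb_def by blast
  then obtain c where c: "\<And>m n u. smooth_near p u \<Longrightarrow>
      pd m n u p = (\<Sum>k\<in>reduction_keys (Suc (m + n)) (m + n). c m n k * reduction_datum a p k u)"
    by (metis mem_Collect_eq)
  have "reduces_derivatives M a p (\<lambda>m' n' m n. c m' n' (Inl (m, n))) (\<lambda>m' n' m n. c m' n' (Inr (m, n)))"
    unfolding reduces_derivatives_def
  proof (intro allI impI ballI, clarify)
    fix u m' n' assume u: "smooth_near p u" and mn: "(m', n') \<in> LamV2 (M + 1)"
    let ?A = "{(m, n). m \<le> 1 \<and> m + n < Suc (m' + n')}" and ?B = "{(m, n). m + n + 2 \<le> m' + n'}"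
    have fin: "finite ?A" "finite ?B"
      by (rule finite_subset[OF _ finite_sum_less[of "m' + n' + 1"]]; auto)+
    have "pd m' n' u p = (\<Sum>k\<in>Inl ` ?A \<union> Inr ` ?B. c m' n' k * reduction_datum a p k u)"
      using c[OF u, of m' n'] by (simp only: reduction_keys_def)
    also have "\<dots> = (\<Sum>k\<in>Inl ` ?A. c m' n' k * reduction_datum a p k u) + (\<Sum>k\<in>Inr ` ?B. c m' n' k * reduction_datum a p k u)"
      using fin by (intro sum.union_disjoint) auto
    also have "\<dots> = (\<Sum>(m, n)\<in>?A. c m' n' (Inl (m, n)) * pd m n u p) +
        (\<Sum>(m, n)\<in>?B. c m' n' (Inr (m, n)) * pd m n (neg_div_grad a u) p)"
      by (simp add: sum.reindex) (intro arg_cong2[where f = "(+)"] sum.cong; auto)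
    also have "?A = {(m, n) \<in> LamV1 (M + 1). m + n \<le> m' + n'}"
      using mn by (auto simp: LamV1_def LamV2_def Lam_def)
    also have "?B = {(m, n) \<in> Lam (M - 1). m + n + 2 \<le> m' + n'}"
      using mn M by (auto simp: LamV2_def Lam_def)
    finally show "pd m' n' u p =
       (\<Sum>(m, n)\<in>{(m, n) \<in> LamV1 (M + 1). m + n \<le> m' + n'}. c m' n' (Inl (m, n)) * pd m n u p) +
       (\<Sum>(m, n)\<in>{(m, n) \<in> Lam (M - 1). m + n + 2 \<le> m' + n'}.
          c m' n' (Inr (m, n)) * pd m n (neg_div_grad a u) p)" .
  qed
  then show ?thesis by blast
qed

lemma reduces_derivatives_A:
  assumes "smooth_on U a" "p \<in> U" "a p > 0" "M \<ge> 1"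
  shows "reduces_derivatives M a p (A_u M a p) (A_f M a p)"
  using reduces_derivatives_exists[OF assms]
  unfolding A_u_def A_f_def reduction_coeffs_def
  by (metis (mono_tags, lifting) case_prod_unfold fst_conv snd_conv someI_ex)

definition taylor_poly :: "plane \<Rightarrow> nat \<Rightarrow> (nat \<Rightarrow> nat \<Rightarrow> real) \<Rightarrow> plane \<Rightarrow> real" where
  "taylor_poly p d c q =
     (\<Sum>i\<le>d. \<Sum>j\<le>d. c i j * ((fst q - fst p) ^ i / fact i) * ((snd q - snd p) ^ j / fact j))"

lemma divided_power_sum_deriv:
  fixes b :: "nat \<Rightarrow> real"
  assumes "b (Suc d) = 0"
  shows "((\<lambda>t. \<Sum>i\<le>d. b i * ((t - s) ^ i / fact i)) has_real_derivative
          (\<Sum>i\<le>d. b (Suc i) * ((t - s) ^ i / fact i))) (at t)"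
proof -
  have "(\<Sum>i\<le>d. b (Suc i) * ((t - s) ^ i / fact i)) = (\<Sum>i<d. b (Suc i) * ((t - s) ^ i / fact i))"
    using assms by (simp add: lessThan_Suc_atMost[symmetric])
  also have "\<dots> = (\<Sum>i\<le>d. b i * (real i * (t - s) ^ (i - 1) / fact i))"
    by (simp add: sum.atMost_shift fact_Suc field_simps del: of_nat_Suc)
  finally show ?thesis
    by (auto intro!: derivative_eq_intros sum.cong)
qed


lemma smooth_on_sum:
  assumes "open U" "\<And>i. i \<in> I \<Longrightarrow> smooth_on U (F i)"
  shows "smooth_on U (\<lambda>q. \<Sum>i\<in>I. F i q)"
  using assms(2)
proof (induction I rule: infinite_finite_induct)
  case (insert i I)
  then have "smooth_on U (\<lambda>q. F i q + (\<Sum>i\<in>I. F i q))" by (intro smooth_on_add) auto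
  with insert show ?case by simp
qed (simp_all add: assms(1) smooth_on_const)

lemma smooth_on_power:
  assumes "smooth_on U F"
  shows "smooth_on U (\<lambda>q. F q ^ k)"
proof (induction k)
  case 0
  then show ?case using smooth_on_const[OF smooth_on_open[OF assms], of 1] by simp
next
  case (Suc k)
  then show ?case using smooth_on_mult[OF assms] by simp
qed

lemma smooth_on_linear:
  assumes "open U"
  shows "smooth_on U (\<lambda>q. A * fst q + B * snd q)"
proof (rule smooth_on_coinduct[where P = "\<lambda>G. \<exists>A B C. G = (\<lambda>q. A * fst q + B * snd q + C)"])
  show "\<exists>A' B' C'. (\<lambda>q :: plane. A * fst q + B * snd q) = (\<lambda>q. A' * fst q + B' * snd q + C')"
    by (intro exI[of _ A] exI[of _ B] exI[of _ 0]) simp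
  fix G :: "plane \<Rightarrow> real" assume "\<exists>A B C. G = (\<lambda>q. A * fst q + B * snd q + C)"
  then obtain A B C where G: "G = (\<lambda>q. A * fst q + B * snd q + C)" by blast
  have c: "\<exists>A B C. (\<lambda>q :: plane. D) = (\<lambda>q. A * fst q + B * snd q + C)" for D :: real
    by (intro exI[of _ 0] exI[of _ D]) simp
  have d: "\<forall>q\<in>U. (G has_derivative (\<lambda>v. fst v * A + snd v * B)) (at q)"
    unfolding G by (auto intro!: derivative_eq_intros simp: algebra_simps)
  show "\<exists>Gx Gy. (\<exists>A B C. Gx = (\<lambda>q. A * fst q + B * snd q + C)) \<and> (\<exists>A B C. Gy = (\<lambda>q. A * fst q + B * snd q + C)) \<and>
      (\<forall>q\<in>U. (G has_derivative (\<lambda>v. fst v * Gx q + snd v * Gy q)) (at q))"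
    by (rule exI[of _ "\<lambda>q. A"], rule exI[of _ "\<lambda>q. B"]) (intro conjI c d)
qed (use assms in auto)

lemma smooth_on_taylor_poly: "smooth_on UNIV (taylor_poly p d c)"
proof -
  have "smooth_on UNIV (\<lambda>q. (\<Sum>i\<le>d. \<Sum>j\<le>d. c i j * ((1 / fact i) * ((1 * fst q + 0 * snd q) + - fst p) ^ i)
       * ((1 / fact j) * ((0 * fst q + 1 * snd q) + - snd p) ^ j)))"
    by (intro smooth_on_sum smooth_on_mult smooth_on_const smooth_on_power smooth_on_add smooth_on_linear open_UNIV)
  then show ?thesis by (simp add: taylor_poly_def[abs_def])
qed

lemma
  assumes "\<And>i j. i > d \<or> j > d \<Longrightarrow> c i j = 0"
  shows dx_taylor_poly: "dx (taylor_poly p d c) = taylor_poly p d (\<lambda>i j. c (Suc i) j)"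
    and dy_taylor_poly: "dy (taylor_poly p d c) = taylor_poly p d (\<lambda>i j. c i (Suc j))"
proof -
  show "dx (taylor_poly p d c) = taylor_poly p d (\<lambda>i j. c (Suc i) j)"
  proof
    fix q :: plane
    let ?b = "\<lambda>i. \<Sum>j\<le>d. c i j * ((snd q - snd p) ^ j / fact j)"
    have eq: "taylor_poly p d c r = (\<Sum>i\<le>d. (\<Sum>j\<le>d. c i j * ((snd r - snd p) ^ j / fact j)) * ((fst r - fst p) ^ i / fact i))" for c r
      unfolding taylor_poly_def sum_distrib_right by (intro sum.cong refl) (simp add: mult_ac)
    have "((\<lambda>t. taylor_poly p d c (t, snd q)) has_real_derivative
        (\<Sum>i\<le>d. ?b (Suc i) * ((fst q - fst p) ^ i / fact i))) (at (fst q))"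
      using divided_power_sum_deriv[of ?b d "fst p" "fst q"] assms by (simp add: eq)
    then show "dx (taylor_poly p d c) q = taylor_poly p d (\<lambda>i j. c (Suc i) j) q"
      unfolding dx_def by (simp add: DERIV_imp_deriv eq)
  qed
  show "dy (taylor_poly p d c) = taylor_poly p d (\<lambda>i j. c i (Suc j))"
  proof
    fix q :: plane
    let ?b = "\<lambda>j. \<Sum>i\<le>d. c i j * ((fst q - fst p) ^ i / fact i)"
    have eq: "taylor_poly p d c r = (\<Sum>j\<le>d. (\<Sum>i\<le>d. c i j * ((fst r - fst p) ^ i / fact i)) * ((snd r - snd p) ^ j / fact j))" for c r
      unfolding taylor_poly_def sum_distrib_right by (rule sum.swap)
    have "((\<lambda>t. taylor_poly p d c (fst q, t)) has_real_derivative
        (\<Sum>j\<le>d. ?b (Suc j) * ((snd q - snd p) ^ j / fact j))) (at (snd q))"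
      using divided_power_sum_deriv[of ?b d "snd p" "snd q"] assms by (simp add: eq)
    then show "dy (taylor_poly p d c) q = taylor_poly p d (\<lambda>i j. c i (Suc j)) q"
      unfolding dy_def by (simp add: DERIV_imp_deriv eq)
  qed
qed

lemma pd_taylor_poly:
  assumes "\<And>i j. i > d \<or> j > d \<Longrightarrow> c i j = 0"
  shows "pd m n (taylor_poly p d c) p = c m n"
proof -
  have "pd 0 n (taylor_poly p d c) = taylor_poly p d (\<lambda>i j. c i (j + n))" for n
  proof (induction n)
    case (Suc n)
    have "c i (j + n) = 0" if "i > d \<or> j > d" for i j using that assms by (meson trans_less_add1)
    with Suc show ?case using dy_taylor_poly[of d "\<lambda>i j. c i (j + n)" p] by (simp add: pd_0_Suc)
  qed simp
  then have "pd m n (taylor_poly p d c) = taylor_poly p d (\<lambda>i j. c (i + m) (j + n))"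
  proof (induction m)
    case (Suc m)
    have "c (i + m) (j + n) = 0" if "i > d \<or> j > d" for i j using that assms by (meson trans_less_add1)
    with Suc show ?case
      using dx_taylor_poly[of d "\<lambda>i j. c (i + m) (j + n)" p] by (simp add: pd_Suc_left)
  qed simp
  moreover have "taylor_poly p d e p = e 0 0" for e
  proof -
    have "taylor_poly p d e p = (\<Sum>i\<le>d. \<Sum>j\<le>d. if j = 0 then (if i = 0 then e i j else 0) else 0)"
      unfolding taylor_poly_def by (intro sum.cong) (auto simp: power_0_left)
    then show ?thesis by simp
  qed
  ultimately show ?thesis by simp
qed

text \<open>These test functions isolate the top-order coefficients of the reduction, because all their derivatives
  at \<open>p\<close> of any other order vanish.\<close>

lemma homogeneous_test_function:
  fixes W :: "nat \<Rightarrow> real" and p :: plane and d :: nat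
  obtains u where "smooth_on UNIV u" "\<And>m n. pd m n u p = (if m + n = d then W m else 0)"
proof -
  let ?c = "\<lambda>i j. if i + j = d then W i else 0"
  have "pd m n (taylor_poly p d ?c) p = (if m + n = d then W m else 0)" for m n
    by (rule pd_taylor_poly) auto
  then show thesis using that[OF smooth_on_taylor_poly] by blast
qed

text \<open>The remainder of lower order only sees derivatives of order below \<open>d\<close>, which vanish.\<close>

lemma homogeneous_neg_div_grad:
  assumes a: "smooth_on U a" "p \<in> U" and u: "smooth_on UNIV u"
    and W: "\<And>m n. pd m n u p = (if m + n = d then W m else 0)" and "m + n + 2 \<le> d"
  shows "pd m n (neg_div_grad a u) p = (if m + n + 2 = d then - a p * (W (m + 2) + W m) else 0)"
proof -
  obtain \<Theta> where t: "diff_op U (m + n + 1) \<Theta>"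
     and e: "pd m n (neg_div_grad a u) p = - a p * (pd (m + 2) n u p + pd m (n + 2) u p) + \<Theta> u p"
    using pd_neg_div_grad[OF a(1), of m n] u a(2) by blast
  have "\<Theta> u p = 0" by (rule diff_op_vanish[OF t]) (use W assms(5) in auto)
  then show ?thesis using e by (simp add: W)
qed

text \<open>What the reduction of a derivative of order \<open>d\<close> says about an arbitrary vector \<open>W\<close> of
  derivatives of order \<open>d\<close>.\<close>

lemma reduction_leading_identity:
  assumes a: "smooth_on U a" "p \<in> U" "a p > 0" and M: "M \<ge> 1"
    and mn: "(m', n') \<in> LamV2 (M + 1)" "m' + n' = d"
  shows "W m' = A_u M a p m' n' 0 d * W 0 + A_u M a p m' n' 1 (d - 1) * W 1 +
     (\<Sum>k\<le>d-2. A_f M a p m' n' k (d - 2 - k) * (- a p * (W (k + 2) + W k)))"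
proof -
  obtain u where u: "smooth_on UNIV u" "\<And>m n. pd m n u p = (if m + n = d then W m else 0)"
    using homogeneous_test_function by blast
  then have "smooth_near p u" unfolding smooth_near_def by blast
  with reduces_derivatives_A[OF a M] mn(1) have reduced:
    "pd m' n' u p = (\<Sum>(m, n)\<in>{(m, n) \<in> LamV1 (M + 1). m + n \<le> m' + n'}. A_u M a p m' n' m n * pd m n u p) +
       (\<Sum>(m, n)\<in>{(m, n) \<in> Lam (M - 1). m + n + 2 \<le> m' + n'}.
          A_f M a p m' n' m n * pd m n (neg_div_grad a u) p)" (is "_ = ?S + ?T")
    unfolding reduces_derivatives_def by blast
  have d: "d \<ge> 2" "d \<le> M + 1" using mn by (auto simp: LamV2_def LamV1_def Lam_def)
  have fin: "finite (LamV1 (M + 1))" "finite (Lam (M - 1))"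
    by (rule finite_subset[OF _ finite_sum_less[of "M + 2"]]; auto simp: LamV1_def Lam_def)+
  have "?S = (\<Sum>(m, n)\<in>{(0, d), (1, d - 1)}. A_u M a p m' n' m n * pd m n u p)"
    using d mn fin by (intro sum.mono_neutral_right finite_subset[OF _ fin(1)]) (auto simp: u(2) LamV1_def Lam_def split: if_splits)
  then have S: "?S = A_u M a p m' n' 0 d * W 0 + A_u M a p m' n' 1 (d - 1) * W 1"
    using d by (simp add: u(2))
  have "?T = (\<Sum>(m, n)\<in>(\<lambda>k. (k, d - 2 - k)) ` {..d-2}. A_f M a p m' n' m n * pd m n (neg_div_grad a u) p)"
  proof (rule sum.mono_neutral_right)
    show "finite {(m, n) \<in> Lam (M - 1). m + n + 2 \<le> m' + n'}"
      by (rule finite_subset[OF _ fin(2)]) auto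
    show "(\<lambda>k. (k, d - 2 - k)) ` {..d - 2} \<subseteq> {(m, n) \<in> Lam (M - 1). m + n + 2 \<le> m' + n'}"
      using d mn by (auto simp: Lam_def)
    show "\<forall>i\<in>{(m, n) \<in> Lam (M - 1). m + n + 2 \<le> m' + n'} - (\<lambda>k. (k, d - 2 - k)) ` {..d - 2}.
       (case i of (m, n) \<Rightarrow> A_f M a p m' n' m n * pd m n (neg_div_grad a u) p) = 0"
    proof (clarify)
      fix m n assume 1: "m + n + 2 \<le> m' + n'" and 2: "(m, n) \<notin> (\<lambda>k. (k, d - 2 - k)) ` {..d - 2}"
      have "m + n + 2 \<noteq> d" using 2 by (force simp: image_iff)
      then show "A_f M a p m' n' m n * pd m n (neg_div_grad a u) p = 0"
        using homogeneous_neg_div_grad[OF a(1,2) u, of m n] 1 mn by simp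
    qed
  qed
  then have "?T = (\<Sum>k\<le>d-2. A_f M a p m' n' k (d - 2 - k) * pd k (d - 2 - k) (neg_div_grad a u) p)"
    by (simp add: sum.reindex inj_on_def)
  also have "\<dots> = (\<Sum>k\<le>d-2. A_f M a p m' n' k (d - 2 - k) * (- a p * (W (k + 2) + W k)))"
    by (intro sum.cong refl) (use d in \<open>simp add: homogeneous_neg_div_grad[OF a(1,2) u]\<close>)
  finally have T: "?T = (\<Sum>k\<le>d-2. A_f M a p m' n' k (d - 2 - k) * (- a p * (W (k + 2) + W k)))" .
  have "pd m' n' u p = W m'" using u(2) mn by simp
  with reduced S T show ?thesis by simp
qed

text \<open>For a harmonic test polynomial the derivatives of \<open>f\<close> drop out.\<close>

lemma A_u_leading:
  assumes a: "smooth_on U a" "p \<in> U" "a p > 0" "M \<ge> 1"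
    and mn: "(m', n') \<in> LamV2 (M + 1)" "m \<le> 1" "m + n = m' + n'"
  shows "A_u M a p m' n' m n = (if even m' \<longleftrightarrow> m = 0 then (-1) ^ (m' div 2) else 0)"
proof -
  have *: "harmonic_derivative m' x y = A_u M a p m' n' 0 (m' + n') * x + A_u M a p m' n' 1 (m' + n' - 1) * y" for x y
    using reduction_leading_identity[OF a mn(1) refl, of "\<lambda>k. harmonic_derivative k x y"]
    by (simp add: harmonic_derivative_Suc_Suc) (simp add: harmonic_derivative_def)
  consider "m = 0" "n = m' + n'" | "m = 1" "n = m' + n' - 1" using mn by linarith
  then show ?thesis
  proof cases
    case 1 then show ?thesis using *[of 1 0] by (simp add: harmonic_derivative_def split: if_splits)
  next
    case 2 then show ?thesis using *[of 0 1] by (simp add: harmonic_derivative_def split: if_splits)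
  qed
qed

text \<open>The test polynomial has a single nonvanishing derivative of \<open>f\<close> of order \<open>d - 2\<close>, and none of
  its own derivatives of order \<open>d\<close> with at most one \<open>x\<close> survives.\<close>

lemma A_f_leading:
  assumes a: "smooth_on U a" "p \<in> U" "a p > 0" "M \<ge> 1"
    and mn: "(m', n') \<in> LamV2 (M + 1)" "m + n + 2 = m' + n'"
  shows "A_f M a p m' n' m n = (if m + 2 \<le> m' \<and> even (m' - m) then (-1) ^ ((m' - m) div 2) / a p else 0)"
proof -
  \<comment> \<open>The solution of \<open>- a p * (W (k + 2) + W k) = (if k = m then 1 else 0)\<close> with \<open>W 0 = W 1 = 0\<close>.\<close>
  define W where "W k = (if m + 2 \<le> k \<and> even (k - m) then (-1) ^ ((k - m) div 2) / a p else 0)" for k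
  have W: "- a p * (W (k + 2) + W k) = (if k = m then 1 else 0)" for k
  proof -
    have "k = m \<or> k < m \<or> k = m + 1 \<or> (\<exists>j. k = m + 2 + j)" by presburger
    then consider "k = m" | "k < m" | "k = m + 1" | j where "k = m + 2 + j" by blast
    then show ?thesis
    proof cases
      case 4
      then show ?thesis by (simp add: W_def)
    qed (use a(3) in \<open>auto simp: W_def\<close>)
  qed
  have "W m' = (\<Sum>k\<le>m'+n'-2. A_f M a p m' n' k (m' + n' - 2 - k) * (- a p * (W (k + 2) + W k)))"
    using reduction_leading_identity[OF a mn(1) refl, of W] by (simp add: W_def)
  also have "\<dots> = (\<Sum>k\<le>m'+n'-2. if k = m then A_f M a p m' n' k (m' + n' - 2 - k) else 0)"
    unfolding W by (intro sum.cong) auto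
  also have "\<dots> = A_f M a p m' n' m n" by (simp add: mn(2)[symmetric])
  finally show ?thesis by (simp add: W_def)
qed

section \<open>The reduced Taylor expansion\<close>

abbreviation taylor_monomial :: "nat \<Rightarrow> nat \<Rightarrow> real \<Rightarrow> real \<Rightarrow> real" where
  "taylor_monomial m n x y \<equiv> x ^ m * y ^ n / (fact m * fact n)"

lemma finite_Lam [simp]: "finite (Lam N)"
  by (rule finite_subset[OF _ finite_sum_less[of "N + 1"]]) (auto simp: Lam_def)

lemma finite_LamV1 [simp]: "finite (LamV1 N)"
  by (rule finite_subset[OF _ finite_Lam[of N]]) (auto simp: LamV1_def)

lemma finite_LamV2 [simp]: "finite (LamV2 N)"
  by (simp add: LamV2_def)

text \<open>The explicit alternating sum in \<open>G\<close> is the Taylor monomial together with the contributions of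
  the top-order coefficients.\<close>

lemma GV_eq:
  assumes a: "smooth_on U a" "p \<in> U" "a p > 0" "M \<ge> 1" and mn: "(m, n) \<in> LamV1 (M + 1)"
  shows "GV a p M m n x y = taylor_monomial m n x y +
     (\<Sum>(m', n')\<in>{(m', n') \<in> LamV2 (M + 1). m + n \<le> m' + n'}. A_u M a p m' n' m n * taylor_monomial m' n' x y)"
proof -
  let ?X = "\<lambda>(m', n'). A_u M a p m' n' m n * taylor_monomial m' n' x y"
  let ?E = "{(m', n') \<in> LamV2 (M + 1). m' + n' = m + n}" and ?g = "\<lambda>l. (m + 2 * l, n - 2 * l)"
  have m: "m \<le> 1" using mn by (auto simp: LamV1_def)
  have "sum ?X {(m', n') \<in> LamV2 (M + 1). m + n \<le> m' + n'} =
      sum ?X ({(m', n') \<in> LamV2 (M + 1). m' + n' > m + n} \<union> ?E)"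
    by (rule sum.cong) auto
  also have "\<dots> = sum ?X {(m', n') \<in> LamV2 (M + 1). m' + n' > m + n} + sum ?X ?E"
    by (rule sum.union_disjoint) (auto intro: finite_subset[OF _ finite_LamV2[of "M + 1"]])
  also have "sum ?X ?E = sum ?X (?g ` {1..n div 2})"
  proof (rule sum.mono_neutral_right)
    show "finite ?E" by (auto intro: finite_subset[OF _ finite_LamV2[of "M + 1"]])
    show "?g ` {1..n div 2} \<subseteq> ?E" using mn by (auto simp: LamV1_def LamV2_def Lam_def)
    show "\<forall>i\<in>?E - ?g ` {1..n div 2}. ?X i = 0"
    proof
      fix i assume i: "i \<in> ?E - ?g ` {1..n div 2}"
      obtain m' n' where [simp]: "i = (m', n')" by (cases i)
      have 1: "(m', n') \<in> LamV2 (M + 1)" "m' + n' = m + n" "(m', n') \<notin> ?g ` {1..n div 2}"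
        using i by simp_all
      have "\<not> (even m' \<longleftrightarrow> m = 0)"
      proof
        assume "even m' \<longleftrightarrow> m = 0"
        then have "m' = m + 2 * (m' div 2)" using m by presburger
        moreover have "m' \<ge> 2" using 1(1) by (auto simp: LamV1_def LamV2_def Lam_def)
        ultimately have "(m', n') = ?g (m' div 2)" "m' div 2 \<in> {1..n div 2}" using 1(2) by auto
        with 1(3) show False by blast
      qed
      then have "A_u M a p m' n' m n = 0"
        using A_u_leading[OF a 1(1) m] 1(2) by simp
      then show "?X i = 0" by simp
    qed
  qed
  also have "\<dots> = (\<Sum>l=1..n div 2. ?X (?g l))"
    by (subst sum.reindex) (auto simp: inj_on_def)
  also have "\<dots> = (\<Sum>l=1..n div 2. (-1) ^ l * taylor_monomial (m + 2 * l) (n - 2 * l) x y)"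
  proof (intro sum.cong refl)
    fix l assume l: "l \<in> {1..n div 2}"
    have "(m + 2 * l, n - 2 * l) \<in> LamV2 (M + 1)" using l mn by (auto simp: LamV1_def LamV2_def Lam_def)
    from A_u_leading[OF a this m] l m
    have "A_u M a p (m + 2 * l) (n - 2 * l) m n = (-1) ^ l" by (cases m) auto
    then show "?X (?g l) = (-1) ^ l * taylor_monomial (m + 2 * l) (n - 2 * l) x y" by simp
  qed
  finally show ?thesis
    unfolding GV_def by (simp add: sum.atLeast_Suc_atMost[of 0] case_prod_unfold mult.assoc)
qed

text \<open>Likewise, the alternating sum in \<open>Q\<close> consists of the contributions of the top-order coefficients.\<close>

lemma QV_eq:
  assumes a: "smooth_on U a" "p \<in> U" "a p > 0" "M \<ge> 1" and mn: "(m, n) \<in> Lam (M - 1)"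
  shows "QV a p M m n x y =
     (\<Sum>(m', n')\<in>{(m', n') \<in> LamV2 (M + 1). m + n + 2 \<le> m' + n'}. A_f M a p m' n' m n * taylor_monomial m' n' x y)"
proof -
  let ?X = "\<lambda>(m', n'). A_f M a p m' n' m n * taylor_monomial m' n' x y"
  let ?E = "{(m', n') \<in> LamV2 (M + 1). m' + n' = m + n + 2}" and ?g = "\<lambda>l. (m + 2 * l, n + 2 - 2 * l)"
  let ?L = "{1..1 + n div 2}"
  have "sum ?X {(m', n') \<in> LamV2 (M + 1). m + n + 2 \<le> m' + n'} =
      sum ?X ({(m', n') \<in> LamV2 (M + 1). m' + n' > m + n + 2} \<union> ?E)"
    by (rule sum.cong) auto
  also have "\<dots> = sum ?X {(m', n') \<in> LamV2 (M + 1). m' + n' > m + n + 2} + sum ?X ?E"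
    by (rule sum.union_disjoint) (auto intro: finite_subset[OF _ finite_LamV2[of "M + 1"]])
  also have "sum ?X ?E = sum ?X (?g ` ?L)"
  proof (rule sum.mono_neutral_right)
    show "finite ?E" by (auto intro: finite_subset[OF _ finite_LamV2[of "M + 1"]])
    show "?g ` ?L \<subseteq> ?E" using mn a(4) by (auto simp: LamV1_def LamV2_def Lam_def)
    show "\<forall>i\<in>?E - ?g ` ?L. ?X i = 0"
    proof
      fix i assume i: "i \<in> ?E - ?g ` ?L"
      obtain m' n' where [simp]: "i = (m', n')" by (cases i)
      have 1: "(m', n') \<in> LamV2 (M + 1)" "m' + n' = m + n + 2" "(m', n') \<notin> ?g ` ?L"
        using i by simp_all
      have "\<not> (m + 2 \<le> m' \<and> even (m' - m))"
      proof
        assume "m + 2 \<le> m' \<and> even (m' - m)"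
        then obtain l where "m' - m = 2 * l" "m + 2 \<le> m'" by blast
        then have "(m', n') = ?g l" "l \<in> ?L" using 1(2) by auto
        with 1(3) show False by blast
      qed
      then have "A_f M a p m' n' m n = 0"
        using A_f_leading[OF a 1(1)] 1(2) by auto
      then show "?X i = 0" by simp
    qed
  qed
  also have "\<dots> = (\<Sum>l\<in>?L. ?X (?g l))"
    by (subst sum.reindex) (auto simp: inj_on_def)
  also have "\<dots> = (\<Sum>l\<in>?L. 1 / a p * ((-1) ^ l * x ^ (m + 2 * l) * y ^ (n + 2 - 2 * l) / (fact (m + 2 * l) * fact (n + 2 - 2 * l))))"
  proof (intro sum.cong refl)
    fix l assume l: "l \<in> ?L"
    have "(m + 2 * l, n + 2 - 2 * l) \<in> LamV2 (M + 1)" using l mn a(4) by (auto simp: LamV1_def LamV2_def Lam_def)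
    from A_f_leading[OF a this, of m n] l
    have "A_f M a p (m + 2 * l) (n + 2 - 2 * l) m n = (-1) ^ l / a p" by auto
    then show "?X (?g l) = 1 / a p * ((-1) ^ l * x ^ (m + 2 * l) * y ^ (n + 2 - 2 * l) / (fact (m + 2 * l) * fact (n + 2 - 2 * l)))" by simp
  qed
  also have "\<dots> = 1 / a p * (\<Sum>l\<in>?L. (-1) ^ l * x ^ (m + 2 * l) * y ^ (n + 2 - 2 * l) / (fact (m + 2 * l) * fact (n + 2 - 2 * l)))"
    by (rule sum_distrib_left[symmetric])
  finally show ?thesis
    unfolding QV_def by (simp only: add.commute)
qed

text \<open>Reduce each derivative with two or more \<open>x\<close> and collect the coefficients of the remaining
  derivatives of \<open>u\<close> and of \<open>f\<close>.\<close>

lemma taylor_sum_reduced: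
  assumes a: "smooth_on U a" "p \<in> U" "a p > 0" "M \<ge> 1" and u: "smooth_near p u"
  shows "(\<Sum>(m, n)\<in>Lam (M + 1). pd m n u p * taylor_monomial m n x y) =
     (\<Sum>(m, n)\<in>LamV1 (M + 1). pd m n u p * GV a p M m n x y) +
     (\<Sum>(m, n)\<in>Lam (M - 1). pd m n (neg_div_grad a u) p * QV a p M m n x y)"
proof -
  let ?V1 = "LamV1 (M + 1)" and ?V2 = "LamV2 (M + 1)" and ?L = "Lam (M - 1)"
  let ?P = "\<lambda>k. pd (fst k) (snd k) u p" and ?F = "\<lambda>k. pd (fst k) (snd k) (neg_div_grad a u) p"
  let ?X = "\<lambda>k. taylor_monomial (fst k) (snd k) x y"
  let ?Au = "\<lambda>k j. A_u M a p (fst k) (snd k) (fst j) (snd j)" and ?Af = "\<lambda>k j. A_f M a p (fst k) (snd k) (fst j) (snd j)"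
  let ?R = "\<lambda>k j :: nat \<times> nat. fst j + snd j \<le> fst k + snd k" and ?R2 = "\<lambda>k j :: nat \<times> nat. fst j + snd j + 2 \<le> fst k + snd k"
  have "?V1 \<subseteq> Lam (M + 1)" by (auto simp: LamV1_def)
  from sum.subset_diff[OF this finite_Lam]
  have "(\<Sum>k\<in>Lam (M + 1). ?P k * ?X k) = (\<Sum>k\<in>?V1. ?P k * ?X k) + (\<Sum>k\<in>?V2. ?P k * ?X k)"
    unfolding LamV2_def by (simp only: add.commute)
  also have "(\<Sum>k\<in>?V2. ?P k * ?X k) =
      (\<Sum>k\<in>?V2. (\<Sum>j\<in>{j\<in>?V1. ?R k j}. ?P j * (?Au k j * ?X k)) + (\<Sum>j\<in>{j\<in>?L. ?R2 k j}. ?F j * (?Af k j * ?X k)))"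
  proof (intro sum.cong refl)
    fix k assume "k \<in> ?V2"
    with reduces_derivatives_A[OF a] u
    have "?P k = (\<Sum>j\<in>{j\<in>?V1. ?R k j}. ?Au k j * ?P j) + (\<Sum>j\<in>{j\<in>?L. ?R2 k j}. ?Af k j * ?F j)"
      unfolding reduces_derivatives_def case_prod_unfold by auto
    then show "?P k * ?X k =
       (\<Sum>j\<in>{j\<in>?V1. ?R k j}. ?P j * (?Au k j * ?X k)) + (\<Sum>j\<in>{j\<in>?L. ?R2 k j}. ?F j * (?Af k j * ?X k))"
      by (simp only: distrib_right sum_distrib_right) (simp only: mult_ac)
  qed
  also have "\<dots> = (\<Sum>j\<in>?V1. \<Sum>k\<in>{k\<in>?V2. ?R k j}. ?P j * (?Au k j * ?X k)) +
     (\<Sum>j\<in>?L. \<Sum>k\<in>{k\<in>?V2. ?R2 k j}. ?F j * (?Af k j * ?X k))"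
    by (simp only: sum.distrib sum.swap_restrict[OF finite_LamV2 finite_LamV1] sum.swap_restrict[OF finite_LamV2 finite_Lam])
  finally have eq: "(\<Sum>k\<in>Lam (M + 1). ?P k * ?X k) =
     (\<Sum>j\<in>?V1. ?P j * (?X j + (\<Sum>k\<in>{k\<in>?V2. ?R k j}. ?Au k j * ?X k))) +
     (\<Sum>j\<in>?L. ?F j * (\<Sum>k\<in>{k\<in>?V2. ?R2 k j}. ?Af k j * ?X k))"
    by (simp add: distrib_left sum.distrib sum_distrib_left)
  have "GV a p M (fst j) (snd j) x y = ?X j + (\<Sum>k\<in>{k\<in>?V2. ?R k j}. ?Au k j * ?X k)" if "j \<in> ?V1" for j
    using GV_eq[OF a, of "fst j" "snd j" x y] that by (simp add: case_prod_unfold)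
  moreover have "QV a p M (fst j) (snd j) x y = (\<Sum>k\<in>{k\<in>?V2. ?R2 k j}. ?Af k j * ?X k)" if "j \<in> ?L" for j
    using QV_eq[OF a, of "fst j" "snd j" x y] that by (simp add: case_prod_unfold)
  ultimately show ?thesis using eq by (simp add: case_prod_unfold)
qed

lemma chain_rule_curve:
  assumes F: "smooth_on U F" and "(r t, s t) \<in> U"
    and r: "(r has_real_derivative r') (at t)" and s: "(s has_real_derivative s') (at t)"
  shows "((\<lambda>t. F (r t, s t)) has_real_derivative (r' * dx F (r t, s t) + s' * dy F (r t, s t))) (at t)"
proof -
  have "((\<lambda>t. (r t, s t)) has_derivative (\<lambda>v. (r' * v, s' * v))) (at t)"
    using r s by (intro has_derivative_Pair) (simp_all add: has_field_derivative_def)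
  from has_derivative_compose[OF this smooth_on_has_derivative[OF F assms(2)]]
  show ?thesis
    unfolding has_field_derivative_def by (rule has_derivative_eq_rhs) (auto simp: algebra_simps)
qed

text \<open>The \<open>j\<close>-th derivative along a ray is the binomial expansion of \<open>(v \<partial>\<^sub>x + w \<partial>\<^sub>y)\<^sup>j u\<close>; the step is
  Pascal's rule.\<close>

lemma directional_derivative_step:
  assumes u: "smooth_on U u" and t: "(x + t * v, y + t * w) \<in> U"
  shows "((\<lambda>t. \<Sum>i\<le>j. real (j choose i) * v ^ i * w ^ (j - i) * pd i (j - i) u (x + t * v, y + t * w))
     has_real_derivative
      (\<Sum>i\<le>Suc j. real (Suc j choose i) * v ^ i * w ^ (Suc j - i) * pd i (Suc j - i) u (x + t * v, y + t * w))) (at t)"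
proof -
  let ?P = "\<lambda>i k. pd i k u (x + t * v, y + t * w)"
  let ?W = "\<lambda>i. v ^ i * w ^ (Suc j - i) * ?P i (Suc j - i)"
  have d: "((\<lambda>t. pd i k u (x + t * v, y + t * w)) has_real_derivative (v * ?P (Suc i) k + w * ?P i (Suc k))) (at t)" for i k
  proof -
    have "((\<lambda>t. x + t * v) has_real_derivative v) (at t)" "((\<lambda>t. y + t * w) has_real_derivative w) (at t)"
      by (auto intro!: derivative_eq_intros)
    from chain_rule_curve[of U "pd i k u" "\<lambda>t. x + t * v" t "\<lambda>t. y + t * w", OF smooth_on_pd[OF u] t this]
    show ?thesis using dy_pd[OF u t, of i k] by (simp add: pd_Suc_left)
  qed
  have "((\<lambda>t. \<Sum>i\<le>j. real (j choose i) * v ^ i * w ^ (j - i) * pd i (j - i) u (x + t * v, y + t * w))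
     has_real_derivative (\<Sum>i\<le>j. real (j choose i) * v ^ i * w ^ (j - i) * (v * ?P (Suc i) (j - i) + w * ?P i (Suc (j - i))))) (at t)"
    by (intro DERIV_sum DERIV_cmult d)
  also have "(\<Sum>i\<le>j. real (j choose i) * v ^ i * w ^ (j - i) * (v * ?P (Suc i) (j - i) + w * ?P i (Suc (j - i)))) =
     (\<Sum>i\<le>j. real (j choose i) * ?W (Suc i)) + (\<Sum>i\<le>j. real (j choose i) * ?W i)"
    unfolding sum.distrib[symmetric] by (intro sum.cong refl) (simp add: Suc_diff_le algebra_simps)
  also have "(\<Sum>i\<le>j. real (j choose i) * ?W i) = (\<Sum>i\<le>Suc j. real (j choose i) * ?W i)"
    by simp
  also have "\<dots> = ?W 0 + (\<Sum>i\<le>j. real (j choose Suc i) * ?W (Suc i))"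
    by (subst sum.atMost_Suc_shift) simp
  also have "(\<Sum>i\<le>j. real (j choose i) * ?W (Suc i)) + (?W 0 + (\<Sum>i\<le>j. real (j choose Suc i) * ?W (Suc i))) =
     (\<Sum>i\<le>Suc j. real (Suc j choose i) * ?W i)"
    by (subst sum.atMost_Suc_shift) (simp add: sum.distrib distrib_right)
  finally show ?thesis by (simp add: mult.assoc)
qed

lemma abs_divide_fact_le: "\<bar>x / fact k :: real\<bar> \<le> \<bar>x\<bar>"
  using mult_left_mono[OF fact_ge_1, of "\<bar>x\<bar>" k] by (simp add: pos_divide_le_eq)

text \<open>Taylor's formula in one variable along the ray through \<open>(v, w)\<close>, with the remainder bounded by continuity of
  the derivative of order \<open>N + 1\<close>.\<close>

lemma taylor_plane:
  assumes u: "smooth_near p u"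
  shows "(\<lambda>h. u (fst p + v * h, snd p + w * h) -
            (\<Sum>(m, n)\<in>Lam N. pd m n u p * taylor_monomial m n (v * h) (w * h)))
         \<in> O[at_right 0](\<lambda>h. h ^ (N + 1))"
proof -
  obtain U where U: "smooth_on U u" "p \<in> U" using u by (auto simp: smooth_near_def)
  let ?g = "\<lambda>t. (fst p + t * v, snd p + t * w)"
  let ?d = "\<lambda>j t. \<Sum>i\<le>j. real (j choose i) * v ^ i * w ^ (j - i) * pd i (j - i) u (?g t)"
  have lim: "(?g \<longlongrightarrow> p) (nhds 0)"
    by (rule tendsto_eq_rhs[OF tendsto_Pair[OF tendsto_add[OF tendsto_const tendsto_mult[OF filterlim_ident tendsto_const]]
          tendsto_add[OF tendsto_const tendsto_mult[OF filterlim_ident tendsto_const]]]]) simp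
  have c: "isCont (?d (N + 1)) 0"
    by (rule DERIV_isCont[OF directional_derivative_step[OF U(1)]]) (use U in auto)
  have "\<forall>\<^sub>F t in nhds 0. ?g t \<in> U \<and> dist (?d (N + 1) t) (?d (N + 1) 0) < 1"
    by (intro eventually_conj topological_tendstoD[OF lim smooth_on_open[OF U(1)] U(2)] tendstoD)
      (use c in \<open>auto simp: isCont_def tendsto_nhds_iff\<close>)
  then obtain e where e: "e > 0" "\<And>t. \<bar>t\<bar> < e \<Longrightarrow> ?g t \<in> U"
      "\<And>t. \<bar>t\<bar> < e \<Longrightarrow> dist (?d (N + 1) t) (?d (N + 1) 0) < 1"
    by (auto simp: eventually_nhds_metric dist_real_def)
  let ?K = "\<bar>?d (N + 1) 0\<bar> + 1"
  let ?T = "\<lambda>h. \<Sum>(m, n)\<in>Lam N. pd m n u p * taylor_monomial m n (v * h) (w * h)"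
  have taylor: "\<bar>u (fst p + v * h, snd p + w * h) -
            ?T h\<bar> \<le> ?K * \<bar>h ^ (N + 1)\<bar>"
    if h: "0 < h" "h < e" for h
  proof -
    have step: "\<forall>m t. m < N + 1 \<and> 0 \<le> t \<and> t \<le> h \<longrightarrow> (?d m has_real_derivative ?d (Suc m) t) (at t)"
    proof (intro allI impI)
      fix m t assume "m < N + 1 \<and> 0 \<le> t \<and> t \<le> h"
      then have "?g t \<in> U" using h by (intro e(2)) auto
      then show "(?d m has_real_derivative ?d (Suc m) t) (at t)" by (rule directional_derivative_step[OF U(1)])
    qed
    have "\<exists>t>0. t < h \<and> u (?g h) = (\<Sum>m<N+1. ?d m 0 / fact m * h ^ m) + ?d (N+1) t / fact (N+1) * h ^ (N+1)"
      by (rule Maclaurin[OF h(1) _ _ step]) simp_all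
    then obtain t where t: "0 < t" "t < h"
      "u (?g h) = (\<Sum>m<N+1. ?d m 0 / fact m * h ^ m) + ?d (N+1) t / fact (N+1) * h ^ (N+1)" by blast
    have "?T h =
        (\<Sum>j\<le>N. \<Sum>i\<le>j. pd i (j - i) u p * taylor_monomial i (j - i) (v * h) (w * h))"
      unfolding Lam_def by (rule sum.triangle_reindex_eq)
    also have "\<dots> = (\<Sum>j\<le>N. ?d j 0 / fact j * h ^ j)"
      unfolding sum_divide_distrib sum_distrib_right
    proof (intro sum.cong refl)
      fix j i :: nat assume "i \<in> {..j}"
      then have i: "i \<le> j" by simp
      have "h ^ j = h ^ i * h ^ (j - i)" using i by (simp add: power_add[symmetric])
      then show "pd i (j - i) u p * taylor_monomial i (j - i) (v * h) (w * h) =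
         real (j choose i) * v ^ i * w ^ (j - i) * pd i (j - i) u (?g 0) / fact j * h ^ j"
        using i by (simp add: binomial_fact power_mult_distrib)
    qed
    also have "\<dots> = (\<Sum>m<N+1. ?d m 0 / fact m * h ^ m)" by (simp add: lessThan_Suc_atMost)
    finally have "u (fst p + v * h, snd p + w * h) -
            ?T h = ?d (N+1) t / fact (N+1) * h ^ (N+1)"
      using t(3) by (simp add: mult.commute)
    moreover have "\<bar>?d (N+1) t / fact (N+1)\<bar> \<le> ?K"
    proof -
      have "\<bar>?d (N+1) t / fact (N+1)\<bar> \<le> \<bar>?d (N+1) t\<bar>"
        by (rule abs_divide_fact_le)
      also have "\<dots> \<le> ?K" using e(3)[of t] t h by (simp add: dist_real_def)
      finally show ?thesis .
    qed
    ultimately show ?thesis by (simp only: abs_mult mult_right_mono abs_ge_zero)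
  qed
  have "\<forall>\<^sub>F h in at_right 0. 0 < h \<and> h < e"
    using e(1) by (auto simp: eventually_at_right_field)
  then have "\<forall>\<^sub>F h in at_right 0. norm (u (fst p + v * h, snd p + w * h) -
            ?T h) \<le> ?K * norm (h ^ (N + 1))"
    by eventually_elim (use taylor in \<open>simp only: real_norm_def\<close>)
  then show ?thesis by (rule bigoI)
qed

lemma reduced_expansion:
  assumes a: "smooth_on U a" "p \<in> U" "a p > 0" "M \<ge> 1" and u: "smooth_near p u"
  shows "(\<lambda>h. u (fst p + v * h, snd p + w * h) -
     ((\<Sum>(m, n)\<in>LamV1 (M + 1). pd m n u p * GV a p M m n (v * h) (w * h)) +
     (\<Sum>(m, n)\<in>Lam (M - 1). pd m n (neg_div_grad a u) p * QV a p M m n (v * h) (w * h))))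
     \<in> O[at_right 0](\<lambda>h. h ^ (M + 2))"
  using taylor_plane[OF u, of v w "M + 1"]
  unfolding taylor_sum_reduced[OF a u] by (simp only: add.assoc one_add_one)

section \<open>Differentiation along the interface\<close>

text \<open>The equation holds only on one side of the interface. Derivatives of the two smooth functions
  coincide on the open set \<open>S\<close>, and by continuity also at the boundary point \<open>p\<close>.\<close>

lemma pd_eq_by_continuity:
  assumes F: "smooth_near p F" and G: "smooth_near p G" and S: "open S"
    and eq: "\<forall>\<^sub>F q in nhds p. q \<in> S \<longrightarrow> F q = G q"
    and c: "(c \<longlongrightarrow> p) (at_right (0::real))" "\<forall>\<^sub>F \<epsilon> in at_right 0. c \<epsilon> \<in> S"
  shows "pd m n F p = pd m n G p"
proof -
  obtain U V where U: "smooth_on U F" "p \<in> U" "smooth_on V G" "p \<in> V"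
    using F G by (auto simp: smooth_near_def)
  obtain W where W: "open W" "p \<in> W" "\<And>q. q \<in> W \<Longrightarrow> q \<in> S \<longrightarrow> F q = G q"
    using eq by (auto simp: eventually_nhds)
  have same: "pd m n F q = pd m n G q" if "q \<in> W \<inter> S" for q
    by (rule pd_cong_open[of "W \<inter> S"]) (use that W S in auto)
  have cont: "isCont (pd m n F) p" "isCont (pd m n G) p"
    using smooth_on_continuous_on[OF smooth_on_pd[OF U(1)]] smooth_on_continuous_on[OF smooth_on_pd[OF U(3)]]
      U smooth_on_open by (metis continuous_on_eq_continuous_at)+
  have lim: "((\<lambda>\<epsilon>. pd m n F (c \<epsilon>)) \<longlongrightarrow> pd m n F p) (at_right 0)"
    "((\<lambda>\<epsilon>. pd m n G (c \<epsilon>)) \<longlongrightarrow> pd m n G p) (at_right 0)"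
    using cont c(1) by (auto intro: isCont_tendsto_compose)
  have "\<forall>\<^sub>F \<epsilon> in at_right 0. pd m n G (c \<epsilon>) = pd m n F (c \<epsilon>)"
    using topological_tendstoD[OF c(1) W(1,2)] c(2) by eventually_elim (use same in auto)
  with lim(2) have "((\<lambda>\<epsilon>. pd m n F (c \<epsilon>)) \<longlongrightarrow> pd m n G p) (at_right 0)"
    by (rule Lim_transform_eventually)
  from tendsto_unique[OF _ lim(1) this] show ?thesis by simp
qed

text \<open>The coefficients that occur when functions on the plane are differentiated along the interface. The
  weight \<open>w\<close> stands for \<open>\<plusminus>1 / sqrt (r'\<^sup>2 + s'\<^sup>2)\<close>, the factor that normalises the normal vector; its derivative is a
  polynomial in \<open>w\<close> and derivatives of \<open>r\<close> and \<open>s\<close>, which makes the class closed under differentiation.\<close>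

inductive along_curve ::
  "(real \<Rightarrow> real) \<Rightarrow> (real \<Rightarrow> real) \<Rightarrow> plane \<Rightarrow> plane set \<Rightarrow> (real \<Rightarrow> real) \<Rightarrow> (real \<Rightarrow> real) \<Rightarrow> bool"
  for r s p U w where
  r: "along_curve r s p U w ((deriv ^^ Suc k) r)"
| s: "along_curve r s p U w ((deriv ^^ Suc k) s)"
| coefficient: "smooth_on U F \<Longrightarrow> along_curve r s p U w (\<lambda>t. F (curve r s p t))"
| weight: "along_curve r s p U w w"
| add: "along_curve r s p U w f \<Longrightarrow> along_curve r s p U w g \<Longrightarrow> along_curve r s p U w (\<lambda>t. f t + g t)"
| mult: "along_curve r s p U w f \<Longrightarrow> along_curve r s p U w g \<Longrightarrow> along_curve r s p U w (\<lambda>t. f t * g t)"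

locale regular_curve =
  fixes r s :: "real \<Rightarrow> real" and p :: plane and U :: "plane set" and w :: "real \<Rightarrow> real" and I :: "real set"
  assumes open_I: "open I" and zero_I: "0 \<in> I" and open_U: "open U"
    and start: "r 0 = 0" "s 0 = 0"
    and in_U: "\<And>t. t \<in> I \<Longrightarrow> curve r s p t \<in> U"
    and deriv_r: "\<And>k t. t \<in> I \<Longrightarrow> ((deriv ^^ k) r has_real_derivative (deriv ^^ Suc k) r t) (at t)"
    and deriv_s: "\<And>k t. t \<in> I \<Longrightarrow> ((deriv ^^ k) s has_real_derivative (deriv ^^ Suc k) s t) (at t)"
    and deriv_w: "\<And>t. t \<in> I \<Longrightarrow> (w has_real_derivative
        - (deriv r t * (deriv ^^ 2) r t + deriv s t * (deriv ^^ 2) s t) * w t ^ 3) (at t)"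
begin

abbreviation "\<gamma> \<equiv> curve r s p"
abbreviation "along \<equiv> along_curve r s p U w"

lemma chain:
  assumes "smooth_on V F" "t \<in> I" "\<gamma> t \<in> V"
  shows "((\<lambda>t. F (\<gamma> t)) has_real_derivative (deriv r t * dx F (\<gamma> t) + deriv s t * dy F (\<gamma> t))) (at t)"
proof -
  have "((\<lambda>t. r t + fst p) has_real_derivative deriv r t) (at t)"
    "((\<lambda>t. s t + snd p) has_real_derivative deriv s t) (at t)"
    using deriv_r[OF assms(2), of 0] deriv_s[OF assms(2), of 0] by (auto intro!: derivative_eq_intros)
  from chain_rule_curve[of V F "\<lambda>t. r t + fst p" t "\<lambda>t. s t + snd p", OF assms(1) _ this] assms(3)
  show ?thesis by (simp add: curve_def)
qed

lemma along_const: "along (\<lambda>t. c)"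
  using along_curve.coefficient[OF smooth_on_const[OF open_U, of c], of r s p w] by simp

lemma along_deriv:
  assumes "along f"
  shows "\<exists>f'. along f' \<and> (\<forall>t\<in>I. (f has_real_derivative f' t) (at t))"
  using assms
proof induction
  case (r k)
  show ?case using along_curve.r[of r s p U w "Suc k"] deriv_r[of _ "Suc k"] by blast
next
  case (s k)
  show ?case using along_curve.s[of r s p U w "Suc k"] deriv_s[of _ "Suc k"] by blast
next
  case (coefficient F)
  have "along (\<lambda>t. (deriv ^^ Suc 0) r t * dx F (\<gamma> t) + (deriv ^^ Suc 0) s t * dy F (\<gamma> t))"
    by (intro along_curve.add along_curve.mult along_curve.coefficient along_curve.r along_curve.s
        smooth_on_dx smooth_on_dy coefficient)
  then show ?case using chain[OF coefficient _ in_U] by (auto simp del: funpow.simps simp: funpow.simps(2)[of 0])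
next
  case weight
  have "along (\<lambda>t. (-1) * (((deriv ^^ Suc 0) r t * (deriv ^^ Suc 1) r t + (deriv ^^ Suc 0) s t * (deriv ^^ Suc 1) s t) * (w t * (w t * w t))))"
    by (intro along_curve.add along_curve.mult along_curve.r along_curve.s along_curve.weight along_const)
  moreover have "(-1) * (((deriv ^^ Suc 0) r t * (deriv ^^ Suc 1) r t + (deriv ^^ Suc 0) s t * (deriv ^^ Suc 1) s t) * (w t * (w t * w t)))
      = - (deriv r t * (deriv ^^ 2) r t + deriv s t * (deriv ^^ 2) s t) * w t ^ 3" for t
    by (simp add: power3_eq_cube numeral_2_eq_2 algebra_simps)
  ultimately have "along (\<lambda>t. - (deriv r t * (deriv ^^ 2) r t + deriv s t * (deriv ^^ 2) s t) * w t ^ 3)"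
    by simp
  then show ?case using deriv_w by blast
next
  case (add f g)
  then obtain f' g' where "along f'" "along g'" "\<forall>t\<in>I. (f has_real_derivative f' t) (at t)"
    "\<forall>t\<in>I. (g has_real_derivative g' t) (at t)" by blast
  then show ?case
    by (intro exI[of _ "\<lambda>t. f' t + g' t"] conjI along_curve.add ballI DERIV_add) auto
next
  case (mult f g)
  then obtain f' g' where "along f'" "along g'" "\<forall>t\<in>I. (f has_real_derivative f' t) (at t)"
    "\<forall>t\<in>I. (g has_real_derivative g' t) (at t)" by blast
  with mult show ?case
    by (intro exI[of _ "\<lambda>t. f' t * g t + g' t * f t"] conjI along_curve.add along_curve.mult ballI DERIV_mult) auto
qed

text \<open>Linear differential operators of order \<open>J\<close>, evaluated along the curve, with their principal symbol:
  \<open>\<partial>\<^sub>x\<close> contributes \<open>\<i>\<close> and \<open>\<partial>\<^sub>y\<close> contributes \<open>1\<close>, because \<open>\<partial>\<^sub>x\<close> acts like \<open>\<i> \<partial>\<^sub>y\<close> on harmonic functions. An operator of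
  lower order counts as one of order \<open>Suc J\<close> with symbol \<open>0\<close>.\<close>

inductive curve_op :: "nat \<Rightarrow> ((plane \<Rightarrow> real) \<Rightarrow> real \<Rightarrow> real) \<Rightarrow> (real \<Rightarrow> complex) \<Rightarrow> bool" where
  monomial: "along c \<Longrightarrow> m + n = J \<Longrightarrow>
    curve_op J (\<lambda>u t. c t * pd m n u (\<gamma> t)) (\<lambda>t. of_real (c t) * \<i> ^ m)"
| lower: "curve_op J \<Theta> S \<Longrightarrow> curve_op (Suc J) \<Theta> (\<lambda>t. 0)"
| add: "curve_op J \<Theta> S \<Longrightarrow> curve_op J \<Theta>' S' \<Longrightarrow>
    curve_op J (\<lambda>u t. \<Theta> u t + \<Theta>' u t) (\<lambda>t. S t + S' t)"

abbreviation "tangent t \<equiv> Complex (deriv s t) (deriv r t)"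

definition op_derivative ::
  "((plane \<Rightarrow> real) \<Rightarrow> real \<Rightarrow> real) \<Rightarrow> ((plane \<Rightarrow> real) \<Rightarrow> real \<Rightarrow> real) \<Rightarrow> bool" where
  "op_derivative \<Theta> \<Theta>' \<longleftrightarrow> (\<forall>V u t. smooth_on V u \<longrightarrow> t \<in> I \<longrightarrow> \<gamma> t \<in> V \<longrightarrow>
     (\<Theta> u has_real_derivative \<Theta>' u t) (at t))"

text \<open>By the chain rule the parameter derivative has the principal part \<open>r' \<partial>\<^sub>x + s' \<partial>\<^sub>y\<close>, so
  the symbol is multiplied by \<open>s' + \<i> r'\<close>. The operator obtained does not depend on the function to which it is applied.\<close>

lemma curve_op_derivative:
  assumes "curve_op J \<Theta> S"
  shows "\<exists>\<Theta>'. curve_op (Suc J) \<Theta>' (\<lambda>t. tangent t * S t) \<and> op_derivative \<Theta> \<Theta>'"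
  using assms
proof induction
  case (monomial c m n J)
  obtain c' where c': "along c'" "\<forall>t\<in>I. (c has_real_derivative c' t) (at t)"
    using along_deriv[OF monomial(1)] by blast
  have rs: "along (deriv r)" "along (deriv s)"
    using along_curve.r[of r s p U w 0] along_curve.s[of r s p U w 0] by simp_all
  let ?T = "\<lambda>u t. (c t * deriv r t) * pd (Suc m) n u (\<gamma> t) + (c t * deriv s t) * pd m (Suc n) u (\<gamma> t)
      + c' t * pd m n u (\<gamma> t)"
  have T: "curve_op (Suc J) ?T (\<lambda>t. of_real (c t * deriv r t) * \<i> ^ Suc m + of_real (c t * deriv s t) * \<i> ^ m + 0)"
    by (intro curve_op.add curve_op.monomial curve_op.lower[OF curve_op.monomial[OF c'(1) monomial(2)]]
        along_curve.mult monomial rs) (use monomial in auto)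
  have symbol: "(\<lambda>t. of_real (c t * deriv r t) * \<i> ^ Suc m + of_real (c t * deriv s t) * \<i> ^ m + 0) =
      (\<lambda>t. tangent t * (of_real (c t) * \<i> ^ m))"
    by (rule ext) (simp add: complex_eq_iff[of "tangent _"] Complex_eq algebra_simps)
  have "op_derivative (\<lambda>u t. c t * pd m n u (\<gamma> t)) ?T"
    unfolding op_derivative_def
  proof (intro allI impI)
    fix V u t assume u: "smooth_on V u" and t: "t \<in> I" "\<gamma> t \<in> V"
    from DERIV_mult[OF bspec[OF c'(2) t(1)] chain[OF smooth_on_pd[OF u, of m n] t]]
    show "((\<lambda>t. c t * pd m n u (\<gamma> t)) has_real_derivative ?T u t) (at t)"
      using dy_pd[OF u t(2), of m n] by (simp add: pd_Suc_left algebra_simps)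
  qed
  with T[unfolded symbol] show ?case by blast
next
  case (lower J \<Theta> S)
  then obtain \<Theta>' where "curve_op (Suc J) \<Theta>' (\<lambda>t. tangent t * S t)" and d: "op_derivative \<Theta> \<Theta>'" by blast
  from curve_op.lower[OF this(1)] have "curve_op (Suc (Suc J)) \<Theta>' (\<lambda>t. tangent t * 0)" by simp
  with d show ?case by blast
next
  case (add J \<Theta> S \<Theta>' S')
  then obtain A B where ab: "curve_op (Suc J) A (\<lambda>t. tangent t * S t)" "op_derivative \<Theta> A"
     "curve_op (Suc J) B (\<lambda>t. tangent t * S' t)" "op_derivative \<Theta>' B" by blast
  have "op_derivative (\<lambda>u t. \<Theta> u t + \<Theta>' u t) (\<lambda>u t. A u t + B u t)"
    using ab(2,4) unfolding op_derivative_def by (blast intro: DERIV_add)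
  moreover have "curve_op (Suc J) (\<lambda>u t. A u t + B u t) (\<lambda>t. tangent t * (S t + S' t))"
    using curve_op.add[OF ab(1,3)] by (simp only: distrib_left)
  ultimately show ?case by blast
qed

lemma curve_op_derivatives:
  assumes "curve_op J \<Theta> S"
  obtains \<Theta>s where "\<Theta>s 0 = \<Theta>" "\<And>k. curve_op (J + k) (\<Theta>s k) (\<lambda>t. tangent t ^ k * S t)"
    "\<And>k. op_derivative (\<Theta>s k) (\<Theta>s (Suc k))"
proof -
  have "\<exists>\<Theta>s. \<forall>k. (curve_op (J + k) (\<Theta>s k) (\<lambda>t. tangent t ^ k * S t) \<and> (k = 0 \<longrightarrow> \<Theta>s k = \<Theta>)) \<and>
      op_derivative (\<Theta>s k) (\<Theta>s (Suc k))"
  proof (rule dependent_nat_choice)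
    show "\<exists>\<Theta>'. curve_op (J + 0) \<Theta>' (\<lambda>t. tangent t ^ 0 * S t) \<and> (0 = (0::nat) \<longrightarrow> \<Theta>' = \<Theta>)"
      using assms by simp
    fix \<Theta>' k assume "curve_op (J + k) \<Theta>' (\<lambda>t. tangent t ^ k * S t) \<and> (k = 0 \<longrightarrow> \<Theta>' = \<Theta>)"
    then have "curve_op (J + k) \<Theta>' (\<lambda>t. tangent t ^ k * S t)" by simp
    from curve_op_derivative[OF this]
    show "\<exists>\<Theta>''. (curve_op (J + Suc k) \<Theta>'' (\<lambda>t. tangent t ^ Suc k * S t) \<and> (Suc k = 0 \<longrightarrow> \<Theta>'' = \<Theta>)) \<and>
        op_derivative \<Theta>' \<Theta>''"
      by (simp add: mult.assoc)
  qed
  then show thesis using that by metis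
qed

lemma curve_in_open: "open V \<Longrightarrow> p \<in> V \<Longrightarrow> \<forall>\<^sub>F t in nhds 0. \<gamma> t \<in> V \<and> t \<in> I"
proof -
  assume V: "open V" "p \<in> V"
  have "isCont r 0" "isCont s 0"
    using deriv_r[OF zero_I, of 0] deriv_s[OF zero_I, of 0] by (auto intro: DERIV_isCont)
  then have "isCont \<gamma> 0" unfolding curve_def by (intro continuous_intros)
  then have "(\<gamma> \<longlongrightarrow> p) (nhds 0)" by (simp add: isCont_def tendsto_nhds_iff curve_def start)
  from topological_tendstoD[OF this V] show ?thesis
    using eventually_nhds_in_open[OF open_I zero_I] by eventually_elim auto
qed

text \<open>An identity that holds near parameter \<open>0\<close> may be differentiated there as often as desired.\<close>

lemma jump_derivatives:
  assumes d: "\<And>k. op_derivative (A k) (A (Suc k))" "\<And>k. op_derivative (B k) (B (Suc k))"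
      "\<And>k. op_derivative (C k) (C (Suc k))"
    and smooth: "smooth_near p u" "smooth_near p v" "smooth_near p g"
    and jump: "\<forall>\<^sub>F t in nhds 0. A 0 u t - B 0 v t = C 0 g t"
  shows "\<forall>\<^sub>F t in nhds 0. A k u t - B k v t = C k g t"
proof (induction k)
  case 0
  then show ?case by (rule jump)
next
  case (Suc k)
  obtain V W Z where s: "smooth_on V u" "p \<in> V" "smooth_on W v" "p \<in> W" "smooth_on Z g" "p \<in> Z"
    using smooth by (auto simp: smooth_near_def)
  have "\<forall>\<^sub>F t in nhds 0. \<forall>\<^sub>F t in nhds t. A k u t - B k v t = C k g t"
    using Suc.IH by (simp add: eventually_eventually)
  then show ?case
    using curve_in_open[OF smooth_on_open[OF s(1)] s(2)] curve_in_open[OF smooth_on_open[OF s(3)] s(4)]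
      curve_in_open[OF smooth_on_open[OF s(5)] s(6)]
  proof eventually_elim
    case (elim t)
    have "(A k u has_real_derivative A (Suc k) u t) (at t)" "(B k v has_real_derivative B (Suc k) v t) (at t)"
      "(C k g has_real_derivative C (Suc k) g t) (at t)"
      using d s elim unfolding op_derivative_def by blast+
    then have "((\<lambda>t. A k u t - B k v t) has_real_derivative (A (Suc k) u t - B (Suc k) v t)) (at t)"
      "((\<lambda>t. A k u t - B k v t) has_real_derivative C (Suc k) g t) (at t)"
      using DERIV_cong_ev[OF refl elim(1) refl] by (auto intro: DERIV_diff)
    then show ?case by (rule DERIV_unique)
  qed
qed

lemma curve_at_0: "\<gamma> 0 = p" by (simp add: curve_def start)

lemma curve_op_lin_comb:
  assumes "curve_op J \<Theta> S" "\<And>m n. m + n \<le> J \<Longrightarrow> lin_comb X b K (\<lambda>x. pd m n (g x) p)"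
  shows "lin_comb X b K (\<lambda>x. \<Theta> (g x) 0)"
  using assms by induction (auto simp: curve_at_0 intro: lin_comb_add lin_comb_cmult)

lemma harmonic_derivative_complex: "harmonic_derivative m x y = Re (\<i> ^ m) * x + Im (\<i> ^ m) * y"
proof -
  have "\<i> ^ m = (-1) ^ (m div 2) * (if even m then 1 else \<i>)"
  proof (cases "even m")
    case True
    then show ?thesis by (auto elim!: evenE simp: power_mult)
  next
    case False
    then show ?thesis by (auto elim!: oddE simp: power_mult)
  qed
  moreover have "Re ((-1) ^ k) = (-1) ^ k" "Im ((-1) ^ k) = 0" for k
    by (induction k) auto
  ultimately show ?thesis by (simp add: harmonic_derivative_def)
qed

text \<open>Up to reducible terms an operator acts on the derivatives of order \<open>J\<close> through its symbol alone, since
  \<open>\<partial>\<^sub>x\<^sup>m\<close> acts as \<open>\<i>\<^sup>m\<close> on a harmonic function.\<close>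

lemma curve_op_leading:
  assumes "curve_op J \<Theta> S" "\<And>m n. m + n < J \<Longrightarrow> lin_comb X b K (\<lambda>x. pd m n (g x) p)"
    "\<And>m n. m + n = J \<Longrightarrow> lin_comb X b K (\<lambda>x. pd m n (g x) p - harmonic_derivative m (pd 0 J (g x) p) (pd 1 (J - 1) (g x) p))"
  shows "lin_comb X b K (\<lambda>x. \<Theta> (g x) 0 - (Re (S 0) * pd 0 J (g x) p + Im (S 0) * pd 1 (J - 1) (g x) p))"
  using assms
proof induction
  case (monomial c m n J)
  from lin_comb_cmult[OF monomial(4)[OF monomial(2)], of "c 0"]
  show ?case by (rule lin_comb_cong) (simp add: curve_at_0 harmonic_derivative_complex algebra_simps)
next
  case (lower J \<Theta> S)
  have "lin_comb X b K (\<lambda>x. \<Theta> (g x) 0)"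
    by (rule curve_op_lin_comb[OF lower(1)]) (use lower in auto)
  then show ?case by simp
next
  case (add J \<Theta> S \<Theta>' S')
  from lin_comb_add[OF add.IH]
  have "lin_comb X b K (\<lambda>x. (\<Theta> (g x) 0 - (Re (S 0) * pd 0 J (g x) p + Im (S 0) * pd 1 (J - 1) (g x) p)) +
     (\<Theta>' (g x) 0 - (Re (S' 0) * pd 0 J (g x) p + Im (S' 0) * pd 1 (J - 1) (g x) p)))"
    using add.prems by blast
  then show ?case by (rule lin_comb_cong) (simp add: algebra_simps)
qed

lemma identity_op: "curve_op 0 (\<lambda>u t. u (\<gamma> t)) (\<lambda>t. 1)"
  using curve_op.monomial[OF along_const[of 1], of 0 0 0] by simp

text \<open>The normal derivative has the symbol \<open>s' \<i> - r'\<close>, which is \<open>\<i>\<close> times that of the tangential derivative. This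
  quarter turn makes the two jump conditions independent.\<close>

lemma flux_op:
  assumes a: "smooth_on U a"
  shows "curve_op 1 (\<lambda>u t. a (\<gamma> t) * w t * (deriv s t * dx u (\<gamma> t) - deriv r t * dy u (\<gamma> t)))
     (\<lambda>t. of_real (a (\<gamma> t) * w t) * \<i> * tangent t)"
proof -
  have rs: "along (deriv r)" "along (deriv s)"
    using along_curve.r[of r s p U w 0] along_curve.s[of r s p U w 0] by simp_all
  have "curve_op 1 (\<lambda>u t. (a (\<gamma> t) * w t * deriv s t) * pd 1 0 u (\<gamma> t) + (a (\<gamma> t) * w t * (-1 * deriv r t)) * pd 0 1 u (\<gamma> t))
    (\<lambda>t. of_real (a (\<gamma> t) * w t * deriv s t) * \<i> ^ 1 + of_real (a (\<gamma> t) * w t * (-1 * deriv r t)) * \<i> ^ 0)"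
    by (intro curve_op.add curve_op.monomial along_curve.mult along_curve.coefficient[OF a] along_curve.weight rs along_const) auto
  moreover have "(\<lambda>u t. (a (\<gamma> t) * w t * deriv s t) * pd 1 0 u (\<gamma> t) + (a (\<gamma> t) * w t * (-1 * deriv r t)) * pd 0 1 u (\<gamma> t)) =
     (\<lambda>u t. a (\<gamma> t) * w t * (deriv s t * dx u (\<gamma> t) - deriv r t * dy u (\<gamma> t)))"
    by (intro ext) (simp add: pd_Suc_left pd_0_Suc algebra_simps)
  moreover have "(\<lambda>t. of_real (a (\<gamma> t) * w t * deriv s t) * \<i> ^ 1 + of_real (a (\<gamma> t) * w t * (-1 * deriv r t)) * \<i> ^ 0) =
     (\<lambda>t. of_real (a (\<gamma> t) * w t) * \<i> * tangent t)"
    by (intro ext) (simp add: complex_eq_iff)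
  ultimately show ?thesis by simp
qed

end

section \<open>The interface near the base point\<close>

lemma base_point_in_domain:
  assumes "admissible D"
  shows "base_pt D \<in> {L1 D..L2 D} \<times> {L3 D..L4 D}"
proof -
  let ?h = "mesh D" and ?i = "real (idx_i D)" and ?j = "real (idx_j D)"
  have h: "?h > 0" and v: "-1 < v0 D" "v0 D < 1" "-1 < w0 D" "w0 D < 1"
    and L: "L2 D - L1 D = real (num_x D) * ?h" "L4 D - L3 D = real (num_y D) * ?h"
    and i: "2 \<le> idx_i D" "idx_i D + 2 \<le> num_x D" "2 \<le> idx_j D" "idx_j D + 2 \<le> num_y D"
    using assms unfolding admissible_def by blast+
  have b: "fst (base_pt D) = L1 D + (?i - v0 D) * ?h" "snd (base_pt D) = L3 D + (?j - w0 D) * ?h"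
    using h by (simp_all add: v0_def w0_def node_def field_simps)
  have i': "2 \<le> ?i" "?i + 2 \<le> real (num_x D)" "2 \<le> ?j" "?j + 2 \<le> real (num_y D)" using i by simp_all
  have "0 \<le> (?i - v0 D) * ?h" "0 \<le> (?j - w0 D) * ?h"
    using h v i' by (intro mult_nonneg_nonneg; linarith)+
  moreover have "(?i - v0 D) * ?h \<le> real (num_x D) * ?h" "(?j - w0 D) * ?h \<le> real (num_y D) * ?h"
    using h v i' by (intro mult_right_mono; linarith)+
  ultimately have "L1 D \<le> fst (base_pt D)" "fst (base_pt D) \<le> L2 D" "L3 D \<le> snd (base_pt D)" "snd (base_pt D) \<le> L4 D"
    using b L by linarith+
  then show ?thesis by (simp add: mem_Times_iff)
qed

lemma admissible_coefficients:
  assumes "admissible D"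
  obtains U where "base_pt D \<in> U" "smooth_on U (a_plus D)" "smooth_on U (a_minus D)" "smooth_on U (level D)"
    "a_plus D (base_pt D) > 0" "a_minus D (base_pt D) > 0"
proof -
  let ?p = "base_pt D"
  obtain V where V: "{L1 D..L2 D} \<times> {L3 D..L4 D} \<subseteq> V" "smooth_on V (level D)"
    using assms unfolding admissible_def by blast
  have "smooth_near ?p (a_plus D)" "smooth_near ?p (a_minus D)"
    using assms unfolding admissible_def by blast+
  then obtain A B where AB: "?p \<in> A" "smooth_on A (a_plus D)" "?p \<in> B" "smooth_on B (a_minus D)"
    unfolding smooth_near_def by blast
  have positive: "\<forall>\<^sub>F q in nhds ?p. a_plus D q > 0 \<and> a_minus D q > 0"
    using assms unfolding admissible_def by blast
  have pos: "a_plus D ?p > 0" "a_minus D ?p > 0" using eventually_nhds_x_imp_x[OF positive] by simp_all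
  have o: "open (A \<inter> B \<inter> V)" by (intro open_Int smooth_on_open[OF AB(2)] smooth_on_open[OF AB(4)] smooth_on_open[OF V(2)])
  show thesis
  proof (rule that[of "A \<inter> B \<inter> V"])
    show "?p \<in> A \<inter> B \<inter> V" using AB(1,3) subsetD[OF V(1) base_point_in_domain[OF assms]] by simp
    show "smooth_on (A \<inter> B \<inter> V) (a_plus D)" by (rule smooth_on_subset[OF AB(2) o]) auto
    show "smooth_on (A \<inter> B \<inter> V) (a_minus D)" by (rule smooth_on_subset[OF AB(4) o]) auto
    show "smooth_on (A \<inter> B \<inter> V) (level D)" by (rule smooth_on_subset[OF V(2) o]) auto
  qed (rule pos)+
qed

text \<open>The data \<open>f\<^sub>\<plusminus>\<close> are tied to \<open>u\<^sub>\<plusminus>\<close> on one side only, which the normal approaches from the base point.\<close>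

lemma source_derivatives:
  assumes D: "admissible D" and sol: "local_solution D up um fp fm gD gN"
  shows "pd m n fp (base_pt D) = pd m n (neg_div_grad (a_plus D) up) (base_pt D)"
    and "pd m n fm (base_pt D) = pd m n (neg_div_grad (a_minus D) um) (base_pt D)"
proof -
  let ?p = "base_pt D"
  obtain U where U: "?p \<in> U" "smooth_on U (a_plus D)" "smooth_on U (a_minus D)" "smooth_on U (level D)"
    by (rule admissible_coefficients[OF D])
  have s: "smooth_near ?p up" "smooth_near ?p um" "smooth_near ?p fp" "smooth_near ?p fm"
    and e: "\<forall>\<^sub>F q in nhds ?p. level D q > 0 \<longrightarrow> neg_div_grad (a_plus D) up q = fp q"
       "\<forall>\<^sub>F q in nhds ?p. level D q < 0 \<longrightarrow> neg_div_grad (a_minus D) um q = fm q"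
    using sol unfolding local_solution_def Let_def by blast+
  have li: "local_interface (level D) ?p (curve_r D) (curve_s D) (orient D)"
    using D unfolding admissible_def by blast
  define \<nu> where "\<nu> = curve_normal (curve_r D) (curve_s D) (orient D) 0"
  have c0: "curve (curve_r D) (curve_s D) ?p 0 = ?p" using li by (simp add: local_interface_def curve_def)
  have "\<forall>\<^sub>F t in nhds 0. \<forall>\<^sub>F \<epsilon> in at_right 0.
        level D (curve (curve_r D) (curve_s D) ?p t + \<epsilon> *\<^sub>R curve_normal (curve_r D) (curve_s D) (orient D) t) > 0 \<and>
        level D (curve (curve_r D) (curve_s D) ?p t - \<epsilon> *\<^sub>R curve_normal (curve_r D) (curve_s D) (orient D) t) < 0"
    using li unfolding local_interface_def by blast
  from eventually_nhds_x_imp_x[OF this]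
  have side: "\<forall>\<^sub>F \<epsilon> in at_right 0. level D (?p + \<epsilon> *\<^sub>R \<nu>) > 0 \<and> level D (?p - \<epsilon> *\<^sub>R \<nu>) < 0"
    by (simp add: c0 \<nu>_def)
  have lim: "((\<lambda>\<epsilon>. ?p + \<epsilon> *\<^sub>R \<nu>) \<longlongrightarrow> ?p) (at_right 0)" "((\<lambda>\<epsilon>. ?p - \<epsilon> *\<^sub>R \<nu>) \<longlongrightarrow> ?p) (at_right 0)"
    by (auto intro!: tendsto_eq_intros)
  have oU: "open U" using U(2) by (rule smooth_on_open)
  have near: "smooth_near ?p (neg_div_grad a u)" if a: "smooth_on U a" and u: "smooth_near ?p u" for a u
  proof -
    obtain V where "smooth_on V u" "?p \<in> V" using u by (auto simp: smooth_near_def)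
    with smooth_on_neg_div_grad[OF a] U(1) show ?thesis unfolding smooth_near_def by blast
  qed
  have cont: "continuous_on U (level D)" using U(4) by (rule smooth_on_continuous_on)
  have S: "open {q \<in> U. level D q > 0}" "open {q \<in> U. level D q < 0}"
    using continuous_open_preimage[OF cont oU open_greaterThan[of 0]]
      continuous_open_preimage[OF cont oU open_lessThan[of 0]]
    by (simp_all add: vimage_def Int_def)
  have ev: "\<forall>\<^sub>F \<epsilon> in at_right 0. ?p + \<epsilon> *\<^sub>R \<nu> \<in> {q \<in> U. level D q > 0}"
    "\<forall>\<^sub>F \<epsilon> in at_right 0. ?p - \<epsilon> *\<^sub>R \<nu> \<in> {q \<in> U. level D q < 0}"
    using side topological_tendstoD[OF lim(1) oU U(1)] topological_tendstoD[OF lim(2) oU U(1)]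
    by (eventually_elim, simp)+
  have "pd m n (neg_div_grad (a_plus D) up) ?p = pd m n fp ?p"
    by (rule pd_eq_by_continuity[OF near[OF U(2) s(1)] s(3) S(1) _ lim(1) ev(1)])
      (use e(1) in eventually_elim, auto)
  then show "pd m n fp ?p = pd m n (neg_div_grad (a_plus D) up) ?p" by simp
  have "pd m n (neg_div_grad (a_minus D) um) ?p = pd m n fm ?p"
    by (rule pd_eq_by_continuity[OF near[OF U(3) s(2)] s(4) S(2) _ lim(2) ev(2)])
      (use e(2) in eventually_elim, auto)
  then show "pd m n fm ?p = pd m n (neg_div_grad (a_minus D) um) ?p" by simp
qed

lemma interface_is_regular_curve:
  fixes D
  defines "g \<equiv> \<lambda>t. (deriv (curve_r D) t)\<^sup>2 + (deriv (curve_s D) t)\<^sup>2"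
  defines "w \<equiv> \<lambda>t. orient D / sqrt (g t)"
  assumes D: "admissible D" and U: "open U" "base_pt D \<in> U"
  obtains I where "regular_curve (curve_r D) (curve_s D) (base_pt D) U w I" "\<And>t. t \<in> I \<Longrightarrow> g t > 0" "w 0 \<noteq> 0"
proof -
  let ?r = "curve_r D" and ?s = "curve_s D" and ?p = "base_pt D"
  have li: "local_interface (level D) ?p ?r ?s (orient D)"
    using D unfolding admissible_def by blast
  then have rs: "smooth_near_0 ?r" "smooth_near_0 ?s" "?r 0 = 0" "?s 0 = 0" "orient D \<in> {-1, 1}"
    and g: "\<forall>\<^sub>F t in nhds 0. g t > 0"
    unfolding local_interface_def g_def by blast+
  obtain d1 d2 where d: "d1 > 0" "\<And>k. (deriv ^^ k) ?r differentiable_on {-d1<..<d1}"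
    "d2 > 0" "\<And>k. (deriv ^^ k) ?s differentiable_on {-d2<..<d2}"
    using rs(1,2) unfolding smooth_near_0_def by blast
  have der: "((deriv ^^ k) f has_real_derivative (deriv ^^ Suc k) f t) (at t)"
    if "\<And>k. (deriv ^^ k) f differentiable_on {-d<..<d}" "t \<in> {-d<..<d}" for f :: "real \<Rightarrow> real" and d t k
  proof -
    have "(deriv ^^ k) f differentiable (at t)"
      using that(1)[of k] that(2) unfolding differentiable_on_def
      by (metis at_within_open open_greaterThanLessThan)
    then show ?thesis by (simp add: DERIV_deriv_iff_real_differentiable)
  qed
  have "isCont ?r 0" "isCont ?s 0"
    using der[OF d(2), of 0 0] der[OF d(4), of 0 0] d(1,3) by (auto intro: DERIV_isCont)
  then have "isCont (curve ?r ?s ?p) 0" unfolding curve_def by (intro continuous_intros)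
  then have "(curve ?r ?s ?p \<longlongrightarrow> ?p) (nhds 0)" by (simp add: isCont_def tendsto_nhds_iff curve_def rs)
  from topological_tendstoD[OF this U] g
  have "\<forall>\<^sub>F t in nhds 0. curve ?r ?s ?p t \<in> U \<and> g t > 0" by eventually_elim simp
  then obtain J where J: "open J" "0 \<in> J" "\<And>t. t \<in> J \<Longrightarrow> curve ?r ?s ?p t \<in> U \<and> g t > 0"
    by (auto simp: eventually_nhds)
  define I where "I = J \<inter> {-d1<..<d1} \<inter> {-d2<..<d2}"
  have pos: "g t > 0" if "t \<in> I" for t using that J by (auto simp: I_def)
  have "regular_curve ?r ?s ?p U w I"
  proof
    show "open I" unfolding I_def by (intro open_Int J(1) open_greaterThanLessThan)
    show "0 \<in> I" using J(2) d(1,3) by (simp add: I_def)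
    show "open U" by (rule U(1))
    show "?r 0 = 0" "?s 0 = 0" by (rule rs)+
    show "curve ?r ?s ?p t \<in> U" if "t \<in> I" for t using that J by (auto simp: I_def)
    show r: "((deriv ^^ k) ?r has_real_derivative (deriv ^^ Suc k) ?r t) (at t)" if "t \<in> I" for k t
      by (rule der[OF d(2)]) (use that in \<open>auto simp: I_def\<close>)
    show s: "((deriv ^^ k) ?s has_real_derivative (deriv ^^ Suc k) ?s t) (at t)" if "t \<in> I" for k t
      by (rule der[OF d(4)]) (use that in \<open>auto simp: I_def\<close>)
    fix t assume t: "t \<in> I"
    let ?g' = "2 * (deriv ?r t * (deriv ^^ 2) ?r t + deriv ?s t * (deriv ^^ 2) ?s t)"
    have "(g has_real_derivative ?g') (at t)"
      unfolding g_def using r[OF t, of 1] s[OF t, of 1]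
      by (auto intro!: derivative_eq_intros simp: numeral_2_eq_2)
    then have "(w has_real_derivative - (orient D * (?g' * (inverse (sqrt (g t)) / 2)) / (sqrt (g t))\<^sup>2)) (at t)"
      unfolding w_def using pos[OF t]
      by (auto intro!: derivative_eq_intros simp: power2_eq_square)
    moreover have "- (orient D * (?g' * (inverse (sqrt (g t)) / 2)) / (sqrt (g t))\<^sup>2) =
        - (deriv ?r t * (deriv ^^ 2) ?r t + deriv ?s t * (deriv ^^ 2) ?s t) * w t ^ 3"
    proof -
      \<comment> \<open>The orientation is a sign, so its cube may be inserted to write the derivative through \<open>w\<^sup>3\<close>.\<close>
      have "orient D ^ 3 = orient D" using rs(5) by auto
      then have w3: "w t ^ 3 = orient D / sqrt (g t) ^ 3" by (simp add: w_def power_divide)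
      have "- (o' * (2 * X * (inverse q / 2)) / q\<^sup>2) = - X * (o' / q ^ 3)" if "q > 0" for o' X q :: real
        using that by (simp add: field_simps power3_eq_cube power2_eq_square)
      then show ?thesis unfolding w3 using pos[OF t] by (simp only: real_sqrt_gt_zero)
    qed
    ultimately show "(w has_real_derivative
        - (deriv ?r t * (deriv ^^ 2) ?r t + deriv ?s t * (deriv ^^ 2) ?s t) * w t ^ 3) (at t)" by simp
  qed
  moreover have "0 \<in> I" using J d by (auto simp: I_def)
  then have "w 0 \<noteq> 0" using pos[of 0] rs(5) by (auto simp: w_def)
  ultimately show thesis using that pos by blast
qed

section \<open>Transmission of derivatives across the interface\<close>

type_synonym solution =
  "(plane \<Rightarrow> real) \<times> (plane \<Rightarrow> real) \<times> (plane \<Rightarrow> real) \<times> (plane \<Rightarrow> real) \<times> (plane \<Rightarrow> real) \<times> (plane \<Rightarrow> real)"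

definition solutions :: "interface_data \<Rightarrow> solution set" where
  "solutions D = {(up, um, fp, fm, gD, gN). local_solution D up um fp fm gD gN}"

text \<open>Labels for the derivatives on the right-hand side of the transmission formula.\<close>

datatype datum = Up nat nat | Fp nat nat | Fm nat nat | GD nat nat | GN nat nat

fun datum_value :: "plane \<Rightarrow> datum \<Rightarrow> solution \<Rightarrow> real" where
  "datum_value p (Up m n) (up, um, fp, fm, gD, gN) = pd m n up p"
| "datum_value p (Fp m n) (up, um, fp, fm, gD, gN) = pd m n fp p"
| "datum_value p (Fm m n) (up, um, fp, fm, gD, gN) = pd m n fm p"
| "datum_value p (GD m n) (up, um, fp, fm, gD, gN) = pd m n gD p"
| "datum_value p (GN m n) (up, um, fp, fm, gD, gN) = pd m n gN p"

definition data_keys :: "nat \<Rightarrow> nat \<Rightarrow> datum set" where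
  "data_keys M N = case_prod Up ` {(m, n). m \<le> 1 \<and> m + n \<le> N} \<union> case_prod Fp ` Lam (M - 1) \<union>
     case_prod Fm ` Lam (M - 1) \<union> case_prod GD ` Lam (M + 1) \<union> case_prod GN ` Lam M"

lemma finite_normal_indices [simp]: "finite {(m, n). m \<le> 1 \<and> m + n \<le> (N::nat)}"
  by (rule finite_subset[OF _ finite_Lam[of N]]) (auto simp: Lam_def)

lemma finite_data_keys [simp]: "finite (data_keys M N)"
  by (simp add: data_keys_def del: One_nat_def)

lemma data_keys_mono: "N \<le> N' \<Longrightarrow> data_keys M N \<subseteq> data_keys M N'"
  by (auto simp: data_keys_def)

text \<open>Induction on the order \<open>N\<close>. The two differentiated jump conditions determine the two derivatives of order
  \<open>N\<close> of the minus solution: with \<open>z = (s' + \<i> r')\<^sup>N\<close> they prescribe the real and imaginary parts of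
  the product of \<open>z\<close>'s conjugate with \<open>\<partial>\<^sub>y\<^sup>N u\<^sub>- + \<i> \<partial>\<^sub>x \<partial>\<^sub>y\<^sup>N\<^sup>-\<^sup>1 u\<^sub>-\<close>, up to data that are already admissible.\<close>

lemma transmission_lin_comb:
  assumes D: "admissible D" and M: "M \<ge> 1"
  defines "p \<equiv> base_pt D"
  shows "N \<le> M + 1 \<Longrightarrow> m \<le> 1 \<Longrightarrow> m + n = N \<Longrightarrow>
    lin_comb (solutions D) (datum_value p) (data_keys M N) (\<lambda>x. pd m n (fst (snd x)) p)"
proof (induction N arbitrary: m n rule: less_induct)
  case (less N)
  let ?X = "solutions D" and ?b = "datum_value p" and ?K = "data_keys M N"
  let ?um = "\<lambda>x :: solution. fst (snd x)"
  let ?gD = "\<lambda>x :: solution. fst (snd (snd (snd (snd x))))" and ?gN = "\<lambda>x :: solution. snd (snd (snd (snd (snd x))))"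
  obtain U where U: "p \<in> U" "smooth_on U (a_plus D)" "smooth_on U (a_minus D)"
     "a_plus D p > 0" "a_minus D p > 0"
    unfolding p_def by (rule admissible_coefficients[OF D])
  define w where "w = (\<lambda>t. orient D / sqrt ((deriv (curve_r D) t)\<^sup>2 + (deriv (curve_s D) t)\<^sup>2))"
  obtain I where reg: "regular_curve (curve_r D) (curve_s D) p U w I"
    and pos: "\<And>t. t \<in> I \<Longrightarrow> (deriv (curve_r D) t)\<^sup>2 + (deriv (curve_s D) t)\<^sup>2 > 0"
    and "orient D / sqrt ((deriv (curve_r D) 0)\<^sup>2 + (deriv (curve_s D) 0)\<^sup>2) \<noteq> 0"
    by (rule interface_is_regular_curve[OF D smooth_on_open[OF U(2)] U(1)[unfolded p_def], folded p_def w_def])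
      (rule that)
  then have w0: "w 0 \<noteq> 0" by (simp add: w_def)
  interpret regular_curve "curve_r D" "curve_s D" p U w I by (rule reg)
  have solD: "local_solution D (fst x) (?um x) (fst (snd (snd x))) (fst (snd (snd (snd x))))
      (?gD x) (?gN x)" if "x \<in> ?X" for x
    using that by (auto simp: solutions_def)
  have smooth: "smooth_near p (fst x)" "smooth_near p (?um x)" "smooth_near p (?gD x)"
     "smooth_near p (?gN x)" if "x \<in> ?X" for x
    using solD[OF that] unfolding local_solution_def Let_def p_def by blast+
  have key: "k \<in> ?K \<Longrightarrow> (\<And>x. x \<in> ?X \<Longrightarrow> \<phi> x = ?b k x) \<Longrightarrow> lin_comb ?X ?b ?K \<phi>" for k \<phi>
    by (rule lin_comb_member[OF finite_data_keys])
  \<comment> \<open>Derivatives of the plus solution reduce to admissible data of the same order.\<close>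
  have plus: "lin_comb ?X ?b ?K (\<lambda>x. pd m n (fst x) p)" if mn: "m + n \<le> N" for m n
  proof -
    have "lin_comb (Collect (smooth_near p)) (reduction_datum (a_plus D) p) (reduction_keys (Suc (m + n)) (m + n)) (\<lambda>u. pd m n u p)"
      using reduction_step[OF U(2,1,4), of "m + n"] by blast
    from lin_comb_pullback[OF this, of ?X fst]
    have "lin_comb ?X (\<lambda>k x. reduction_datum (a_plus D) p k (fst x)) (reduction_keys (Suc (m + n)) (m + n)) (\<lambda>x. pd m n (fst x) p)"
      using smooth(1) by simp
    then show ?thesis
    proof (rule lin_comb_trans)
      fix k assume "k \<in> reduction_keys (Suc (m + n)) (m + n)"
      then consider i j where "k = Inl (i, j)" "i \<le> 1" "i + j \<le> N" | i j where "k = Inr (i, j)" "i + j + 2 \<le> N"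
        using mn by (auto simp: reduction_keys_def)
      then show "lin_comb ?X ?b ?K (\<lambda>x. reduction_datum (a_plus D) p k (fst x))"
      proof cases
        case 1
        then have "Up i j \<in> ?K" by (force simp: data_keys_def)
        then show ?thesis by (rule key) (auto simp: 1)
      next
        case 2
        then have "Fp i j \<in> ?K" using less.prems by (force simp: data_keys_def Lam_def)
        then show ?thesis
          by (rule key) (use 2 source_derivatives(1)[OF D solD] in \<open>auto simp: p_def\<close>)
      qed
    qed
  qed
  \<comment> \<open>On the minus side only orders below \<open>N\<close> are known so far, which is what the lower-order remainders contain.\<close>
  have minus_key: "lin_comb ?X ?b ?K (\<lambda>x. reduction_datum (a_minus D) p k (?um x))" if k: "k \<in> reduction_keys N N" for k
  proof -
    consider i j where "k = Inl (i, j)" "i \<le> 1" "i + j < N" | i j where "k = Inr (i, j)" "i + j + 2 \<le> N"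
      using k by (auto simp: reduction_keys_def)
    then show ?thesis
    proof cases
      case 1
      have "lin_comb ?X ?b (data_keys M (i + j)) (\<lambda>x. pd i j (?um x) p)"
        by (rule less.IH) (use 1 less.prems in auto)
      from lin_comb_mono[OF this data_keys_mono] show ?thesis using 1 by simp
    next
      case 2
      then have "Fm i j \<in> ?K" using less.prems by (force simp: data_keys_def Lam_def)
      then show ?thesis
        by (rule key) (use 2 source_derivatives(2)[OF D solD] in \<open>auto simp: p_def\<close>)
    qed
  qed
  have minus_lower: "lin_comb ?X ?b ?K (\<lambda>x. pd m n (?um x) p)" if mn: "m + n < N" for m n
  proof -
    have "lin_comb (Collect (smooth_near p)) (reduction_datum (a_minus D) p) (reduction_keys (Suc (m + n)) (m + n)) (\<lambda>u. pd m n u p)"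
      using reduction_step[OF U(3,1,5), of "m + n"] by blast
    from lin_comb_pullback[OF lin_comb_mono[OF this reduction_keys_mono finite_reduction_keys], of N N ?X ?um]
    have "lin_comb ?X (\<lambda>k x. reduction_datum (a_minus D) p k (?um x)) (reduction_keys N N) (\<lambda>x. pd m n (?um x) p)"
      using smooth(2) mn by simp
    then show ?thesis by (rule lin_comb_trans) (rule minus_key)
  qed
  have minus_top: "lin_comb ?X ?b ?K (\<lambda>x. pd m n (?um x) p - harmonic_derivative m (pd 0 N (?um x) p) (pd 1 (N - 1) (?um x) p))"
    if mn: "m + n = N" for m n
  proof -
    have "lin_comb (Collect (smooth_near p)) (reduction_datum (a_minus D) p) (reduction_keys N N)
       (\<lambda>u. pd m n u p - harmonic_derivative m (pd 0 N u p) (pd 1 (N - 1) u p))"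
      using reduction_step[OF U(3,1,5), of N] mn by blast
    from lin_comb_pullback[OF this, of ?X ?um]
    have "lin_comb ?X (\<lambda>k x. reduction_datum (a_minus D) p k (?um x)) (reduction_keys N N)
       (\<lambda>x. pd m n (?um x) p - harmonic_derivative m (pd 0 N (?um x) p) (pd 1 (N - 1) (?um x) p))"
      using smooth(2) by simp
    then show ?thesis by (rule lin_comb_trans) (rule minus_key)
  qed
  have gD: "lin_comb ?X ?b ?K (\<lambda>x. pd m n (?gD x) p)" if "m + n \<le> N" for m n
    by (rule key[of "GD m n"]) (use that less.prems in \<open>force simp: data_keys_def Lam_def, auto\<close>)
  have gN: "lin_comb ?X ?b ?K (\<lambda>x. pd m n (?gN x) p)" if "m + n < N" for m n
    by (rule key[of "GN m n"]) (use that less.prems in \<open>force simp: data_keys_def Lam_def, auto\<close>)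

  define \<zeta> where "\<zeta> = Complex (deriv (curve_s D) 0) (deriv (curve_r D) 0)"
  define z where "z = \<zeta> ^ N"
  let ?U0 = "\<lambda>x. pd 0 N (?um x) p" and ?U1 = "\<lambda>x. pd 1 (N - 1) (?um x) p"
  have "\<zeta> \<noteq> 0" using pos[OF zero_I] by (auto simp: \<zeta>_def complex_eq_iff)
  then have "z \<noteq> 0" by (simp add: z_def)
  then have norm_z: "(Re z)\<^sup>2 + (Im z)\<^sup>2 \<noteq> 0" by (simp add: complex_eq_iff sum_power2_eq_zero_iff)
  obtain A where A: "A 0 = (\<lambda>u t. u (\<gamma> t))" "\<And>k. curve_op (0 + k) (A k) (\<lambda>t. tangent t ^ k * 1)"
    "\<And>k. op_derivative (A k) (A (Suc k))"
    by (rule curve_op_derivatives[OF identity_op]) (rule that)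
  have A': "curve_op k (A k) (\<lambda>t. tangent t ^ k)" for k using A(2)[of k] by simp
  \<comment> \<open>The jump of the solution, differentiated \<open>N\<close> times along the interface.\<close>
  have E1: "lin_comb ?X ?b ?K (\<lambda>x. Re z * ?U0 x + Im z * ?U1 x)"
  proof -
    have "lin_comb ?X ?b ?K (\<lambda>x. (A N (fst x) 0 - A N (?gD x) 0) -
        (A N (?um x) 0 - (Re (tangent 0 ^ N) * ?U0 x + Im (tangent 0 ^ N) * ?U1 x)))"
      by (intro lin_comb_diff[OF lin_comb_diff curve_op_leading[OF A' minus_lower minus_top]]
          curve_op_lin_comb[OF A' plus] curve_op_lin_comb[OF A' gD])
    then show ?thesis
    proof (rule lin_comb_cong)
      fix x assume x: "x \<in> ?X"
      have "\<forall>\<^sub>F t in nhds 0. A 0 (fst x) t - A 0 (?um x) t = A 0 (?gD x) t"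
        using solD[OF x] unfolding local_solution_def Let_def A(1) p_def by blast
      from jump_derivatives[OF A(3) A(3) A(3) smooth(1,2,3)[OF x] this, of N]
      have "A N (fst x) 0 - A N (?um x) 0 = A N (?gD x) 0"
        by (rule eventually_nhds_x_imp_x)
      then show "Re z * ?U0 x + Im z * ?U1 x = (A N (fst x) 0 - A N (?gD x) 0) -
        (A N (?um x) 0 - (Re (tangent 0 ^ N) * ?U0 x + Im (tangent 0 ^ N) * ?U1 x))"
        by (simp add: z_def \<zeta>_def)
    qed
  qed
  show ?case
  proof (cases "N = 0")
    case True
    then show ?thesis using E1 less.prems by (simp add: z_def)
  next
    case False
    define \<kappa> where "\<kappa> = a_minus D p * w 0"
    have \<kappa>: "\<kappa> \<noteq> 0" using U(5) w0 by (simp add: \<kappa>_def)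
    obtain Bp where Bp: "Bp 0 = (\<lambda>u t. a_plus D (\<gamma> t) * w t * (deriv (curve_s D) t * dx u (\<gamma> t) - deriv (curve_r D) t * dy u (\<gamma> t)))"
      "\<And>k. curve_op (1 + k) (Bp k) (\<lambda>t. tangent t ^ k * (of_real (a_plus D (\<gamma> t) * w t) * \<i> * tangent t))"
      "\<And>k. op_derivative (Bp k) (Bp (Suc k))"
      by (rule curve_op_derivatives[OF flux_op[OF U(2)]]) (rule that)
    obtain Bm where Bm: "Bm 0 = (\<lambda>u t. a_minus D (\<gamma> t) * w t * (deriv (curve_s D) t * dx u (\<gamma> t) - deriv (curve_r D) t * dy u (\<gamma> t)))"
      "\<And>k. curve_op (1 + k) (Bm k) (\<lambda>t. tangent t ^ k * (of_real (a_minus D (\<gamma> t) * w t) * \<i> * tangent t))"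
      "\<And>k. op_derivative (Bm k) (Bm (Suc k))"
      by (rule curve_op_derivatives[OF flux_op[OF U(3)]]) (rule that)
    define S where "S = (\<lambda>t. tangent t ^ (N - 1) * (of_real (a_minus D (\<gamma> t) * w t) * \<i> * tangent t))"
    have N: "1 + (N - 1) = N" using False by simp
    have BpN: "\<exists>S. curve_op N (Bp (N - 1)) S" and BmN: "curve_op N (Bm (N - 1)) S"
      using Bp(2)[of "N - 1"] Bm(2)[of "N - 1"] unfolding N S_def by blast+
    obtain S' where BpN': "curve_op N (Bp (N - 1)) S'" using BpN by blast
    have S0: "S 0 = of_real \<kappa> * \<i> * z"
      using False unfolding S_def z_def \<kappa>_def curve_at_0 \<zeta>_def by (cases N) (simp_all add: mult_ac)
    have flux_eq: "flux a u (\<gamma> t) (curve_normal (curve_r D) (curve_s D) (orient D) t) =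
        a (\<gamma> t) * w t * (deriv (curve_s D) t * dx u (\<gamma> t) - deriv (curve_r D) t * dy u (\<gamma> t))" for a u t
    proof -
      have "curve_normal (curve_r D) (curve_s D) (orient D) t = w t *\<^sub>R (deriv (curve_s D) t, - deriv (curve_r D) t)"
        by (simp add: curve_normal_def w_def)
      then show ?thesis by (simp add: flux_def algebra_simps)
    qed
    have flux_jump: "\<forall>\<^sub>F t in nhds 0. Bp 0 (fst x) t - Bm 0 (?um x) t = A 0 (?gN x) t"
      if x: "x \<in> ?X" for x
    proof -
      have "\<forall>\<^sub>F t in nhds 0. flux (a_plus D) (fst x) (\<gamma> t) (curve_normal (curve_r D) (curve_s D) (orient D) t) -
         flux (a_minus D) (?um x) (\<gamma> t) (curve_normal (curve_r D) (curve_s D) (orient D) t) = ?gN x (\<gamma> t)"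
        using solD[OF x] unfolding local_solution_def Let_def p_def by blast
      then show ?thesis
        by eventually_elim
          (simp only: A(1) Bp(1) Bm(1) flux_eq)
    qed
    \<comment> \<open>The jump of the flux, differentiated \<open>N - 1\<close> times: its symbol on the minus side is \<open>\<kappa> \<i> z\<close>.\<close>
    have "lin_comb ?X ?b ?K (\<lambda>x. (Bp (N - 1) (fst x) 0 - A (N - 1) (?gN x) 0) -
        (Bm (N - 1) (?um x) 0 - (Re (S 0) * ?U0 x + Im (S 0) * ?U1 x)))"
      by (intro lin_comb_diff[OF lin_comb_diff curve_op_leading[OF BmN minus_lower minus_top]]
          curve_op_lin_comb[OF BpN' plus] curve_op_lin_comb[OF A' gN]) (use False in auto)
    then have "lin_comb ?X ?b ?K (\<lambda>x. \<kappa> * (Re z * ?U1 x - Im z * ?U0 x))"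
    proof (rule lin_comb_cong)
      fix x assume x: "x \<in> ?X"
      from jump_derivatives[OF Bp(3) Bm(3) A(3) smooth(1,2,4)[OF x] flux_jump[OF x], of "N - 1"]
      have "Bp (N - 1) (fst x) 0 - Bm (N - 1) (?um x) 0 = A (N - 1) (?gN x) 0"
        by (rule eventually_nhds_x_imp_x)
      then show "\<kappa> * (Re z * ?U1 x - Im z * ?U0 x) = (Bp (N - 1) (fst x) 0 - A (N - 1) (?gN x) 0) -
        (Bm (N - 1) (?um x) 0 - (Re (S 0) * ?U0 x + Im (S 0) * ?U1 x))"
        by (simp add: S0 algebra_simps)
    qed
    from lin_comb_cmult[OF this, of "1 / \<kappa>"]
    have E2: "lin_comb ?X ?b ?K (\<lambda>x. Re z * ?U1 x - Im z * ?U0 x)" using \<kappa> by simp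
    let ?d = "(Re z)\<^sup>2 + (Im z)\<^sup>2"
    \<comment> \<open>Cramer's rule for the matrix of multiplication by \<open>z\<close>, whose determinant is \<open>?d\<close>.\<close>
    have "lin_comb ?X ?b ?K (\<lambda>x. 1 / ?d * (Re z * (Re z * ?U0 x + Im z * ?U1 x) - Im z * (Re z * ?U1 x - Im z * ?U0 x)))"
      by (intro lin_comb_cmult lin_comb_diff E1 E2)
    then have U0: "lin_comb ?X ?b ?K ?U0"
      by (rule lin_comb_cong) (use norm_z in \<open>simp add: field_simps power2_eq_square\<close>)
    have "lin_comb ?X ?b ?K (\<lambda>x. 1 / ?d * (Im z * (Re z * ?U0 x + Im z * ?U1 x) + Re z * (Re z * ?U1 x - Im z * ?U0 x)))"
      by (intro lin_comb_cmult lin_comb_add E1 E2)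
    then have U1: "lin_comb ?X ?b ?K ?U1"
      by (rule lin_comb_cong) (use norm_z in \<open>simp add: field_simps power2_eq_square\<close>)
    have "m = 0 \<and> n = N \<or> m = 1 \<and> n = N - 1" using less.prems by linarith
    then show ?thesis using U0 U1 by blast
  qed
qed

section \<open>Accuracy of the scheme\<close>

lemma sum_data_keys:
  fixes f :: "datum \<Rightarrow> real"
  shows "(\<Sum>k\<in>data_keys M N. f k) = (\<Sum>(m, n)\<in>{(m, n). m \<le> 1 \<and> m + n \<le> N}. f (Up m n)) +
     (\<Sum>(m, n)\<in>Lam (M - 1). f (Fp m n)) + (\<Sum>(m, n)\<in>Lam (M - 1). f (Fm m n)) +
     (\<Sum>(m, n)\<in>Lam (M + 1). f (GD m n)) + (\<Sum>(m, n)\<in>Lam M. f (GN m n))"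
proof -
  have image: "sum f (case_prod c ` A) = (\<Sum>(m, n)\<in>A. f (c m n))" if "inj_on (case_prod c) A" for c A
    using that by (simp add: sum.reindex case_prod_unfold)
  have inj: "inj_on (case_prod Up) A" "inj_on (case_prod Fp) A" "inj_on (case_prod Fm) A"
     "inj_on (case_prod GD) A" "inj_on (case_prod GN) A" for A
    by (auto simp: inj_on_def)
  show ?thesis unfolding data_keys_def
    by (subst sum.union_disjoint, simp del: One_nat_def, simp, force)+ (simp add: image inj del: One_nat_def)
qed

lemma transmission_exists:
  assumes D: "admissible D" and M: "M \<ge> 1"
  shows "\<exists>T. is_transmission M D T"
proof -
  let ?p = "base_pt D"
  have "\<forall>j\<in>LamV1 (M + 1). \<exists>c. \<forall>x\<in>solutions D. pd (fst j) (snd j) (fst (snd x)) ?p =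
     (\<Sum>k\<in>data_keys M (fst j + snd j). c k * datum_value ?p k x)"
  proof
    fix j assume "j \<in> LamV1 (M + 1)"
    then have "fst j + snd j \<le> M + 1" "fst j \<le> 1" by (auto simp: LamV1_def Lam_def)
    from transmission_lin_comb[OF D M this refl]
    show "\<exists>c. \<forall>x\<in>solutions D. pd (fst j) (snd j) (fst (snd x)) ?p =
     (\<Sum>k\<in>data_keys M (fst j + snd j). c k * datum_value ?p k x)"
      by (simp add: lin_comb_def)
  qed
  from bchoice[OF this] obtain c where c: "\<And>j x. j \<in> LamV1 (M + 1) \<Longrightarrow> x \<in> solutions D \<Longrightarrow>
     pd (fst j) (snd j) (fst (snd x)) ?p = (\<Sum>k\<in>data_keys M (fst j + snd j). c j k * datum_value ?p k x)"
    by blast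
  let ?T = "\<lparr> T_u = \<lambda>m' n' m n. c (m', n') (Up m n), T_plus = \<lambda>m' n' m n. c (m', n') (Fp m n),
     T_minus = \<lambda>m' n' m n. c (m', n') (Fm m n), T_gD = \<lambda>m' n' m n. c (m', n') (GD m n),
     T_gN = \<lambda>m' n' m n. c (m', n') (GN m n) \<rparr>"
  have "is_transmission M D ?T"
    unfolding is_transmission_def Let_def
  proof (intro allI impI ballI, clarify)
    fix up um fp fm gD gN m' n'
    assume sol: "local_solution D up um fp fm gD gN" and mn: "(m', n') \<in> LamV1 (M + 1)"
    have "{(m, n). m \<le> 1 \<and> m + n \<le> m' + n'} = {(m, n) \<in> LamV1 (M + 1). m + n \<le> m' + n'}"
      using mn by (auto simp: LamV1_def Lam_def)
    moreover have "(up, um, fp, fm, gD, gN) \<in> solutions D" using sol by (simp add: solutions_def)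
    ultimately show "pd m' n' um ?p =
           (\<Sum>(m, n) \<in> {(m, n) \<in> LamV1 (M + 1). m + n \<le> m' + n'}. T_u ?T m' n' m n * pd m n up ?p) +
           (\<Sum>(m, n) \<in> Lam (M - 1).
              T_plus ?T m' n' m n * pd m n fp ?p + T_minus ?T m' n' m n * pd m n fm ?p) +
           (\<Sum>(m, n) \<in> Lam (M + 1). T_gD ?T m' n' m n * pd m n gD ?p) +
           (\<Sum>(m, n) \<in> Lam M. T_gN ?T m' n' m n * pd m n gN ?p)"
      using c[OF mn, of "(up, um, fp, fm, gD, gN)"] unfolding sum_data_keys
      by (simp add: case_prod_unfold sum.distrib)
  qed
  then show ?thesis by blast
qed

lemma is_transmission_coeffs:
  assumes "admissible D"
  shows "is_transmission 4 D (transmission_coeffs 4 D)"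
  unfolding transmission_coeffs_def by (rule someI_ex, rule transmission_exists[OF assms]) simp

abbreviation "plus_nodes D \<equiv> d_plus D \<union> e_plus D"
abbreviation "minus_nodes D \<equiv> d_minus D \<union> e_minus D"

lemma stencil_partition:
  "finite (plus_nodes D)" "finite (minus_nodes D)" "plus_nodes D \<inter> minus_nodes D = {}"
  "stencil = plus_nodes D \<union> minus_nodes D"
proof -
  have "finite stencil" by (simp add: stencil_def inner_offsets_def outer_offsets_def)
  moreover show eq: "stencil = plus_nodes D \<union> minus_nodes D"
    by (auto simp: stencil_def d_plus_def d_minus_def e_plus_def e_minus_def)
  ultimately show "finite (plus_nodes D)" "finite (minus_nodes D)" by (metis finite_Un)+
  show "plus_nodes D \<inter> minus_nodes D = {}"
    by (auto simp: d_plus_def d_minus_def e_plus_def e_minus_def)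
qed

lemma poly_bounded_near_0: "(\<lambda>h. poly q h) \<in> O[at_right 0](\<lambda>_. 1 :: real)"
proof (rule bigoI_tendsto)
  show "((\<lambda>h. poly q h / 1) \<longlongrightarrow> poly q 0) (at_right 0)"
    by (auto intro!: tendsto_poly tendsto_eq_intros)
qed simp

text \<open>With the reduced expansions in place of the exact values, all terms in \<open>f\<^sub>\<plusminus>\<close>, \<open>g\<^sub>D\<close> and \<open>g\<^sub>N\<close> cancel
  against the right-hand side of the scheme, and the coefficients of the derivatives of \<open>u\<^sub>+\<close> are the left-hand sides of the
  linear system.\<close>

lemma scheme_identity:
  assumes D: "admissible D" and sol: "local_solution D up um fp fm gD gN"
  defines "p \<equiv> base_pt D"
  shows "(\<Sum>kl\<in>plus_nodes D. poly (C kl) h * ((\<Sum>(m, n)\<in>LamV1 5. pd m n up p * G_plus D m n h kl) +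
             (\<Sum>(m, n)\<in>Lam 3. pd m n fp p * Q_plus D m n h kl))) +
         (\<Sum>kl\<in>minus_nodes D. poly (C kl) h * ((\<Sum>(m, n)\<in>LamV1 5. pd m n um p * G_minus D m n h kl) +
             (\<Sum>(m, n)\<in>Lam 3. pd m n fm p * Q_minus D m n h kl))) -
         scheme_rhs (interface_scheme D C) p fp fm gD gN h =
         (\<Sum>(m, n)\<in>LamV1 5. pd m n up p * ((\<Sum>kl \<in> minus_nodes D. poly (C kl) h *
              (\<Sum>(m', n') \<in> {(m', n') \<in> LamV1 5. m' + n' \<ge> m + n}.
                 G_minus D m' n' h kl * T_u (transmission_coeffs 4 D) m' n' m n)) +
          (\<Sum>kl \<in> plus_nodes D. poly (C kl) h * G_plus D m n h kl)))"
proof -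
  let ?T = "transmission_coeffs 4 D"
  let ?P = "plus_nodes D" and ?N = "minus_nodes D" and ?V = "LamV1 5"
  define c where "c kl = poly (C kl) h" for kl
  define Gp where "Gp kl i = G_plus D (fst i) (snd i) h kl" for kl i
  define Gm where "Gm kl i = G_minus D (fst i) (snd i) h kl" for kl i
  define Qp where "Qp kl i = Q_plus D (fst i) (snd i) h kl" for kl i
  define Qm where "Qm kl i = Q_minus D (fst i) (snd i) h kl" for kl i
  define d where "d F i = pd (fst i) (snd i) F p" for F i
  define t where "t T j i = T ?T (fst j) (snd j) (fst i) (snd i)" for T :: "transmission_family \<Rightarrow> coeff_family" and j i
  define A where "A j = (\<Sum>kl\<in>?N. c kl * Gm kl j)" for j
  let ?R = "\<lambda>j i :: nat \<times> nat. fst i + snd i \<le> fst j + snd j"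
  have um: "d um j = (\<Sum>i\<in>{i\<in>?V. ?R j i}. t T_u j i * d up i) + (\<Sum>i\<in>Lam 3. t T_plus j i * d fp i) +
     (\<Sum>i\<in>Lam 3. t T_minus j i * d fm i) + (\<Sum>i\<in>Lam 5. t T_gD j i * d gD i) + (\<Sum>i\<in>Lam 4. t T_gN j i * d gN i)"
    if "j \<in> ?V" for j
    using is_transmission_coeffs[OF D] sol that
    unfolding is_transmission_def Let_def p_def[symmetric]
    by (auto simp: case_prod_unfold d_def t_def sum.distrib)
  have swap: "(\<Sum>j\<in>?V. A j * (\<Sum>i\<in>L. t T j i * x i)) = (\<Sum>i\<in>L. x i * (\<Sum>j\<in>?V. A j * t T j i))" for L T x
    unfolding sum_distrib_left by (subst sum.swap) (intro sum.cong refl, simp add: mult_ac)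
  have swap_u: "(\<Sum>j\<in>?V. A j * (\<Sum>i\<in>{i\<in>?V. ?R j i}. t T_u j i * d up i)) =
     (\<Sum>i\<in>?V. d up i * (\<Sum>kl\<in>?N. c kl * (\<Sum>j\<in>{j\<in>?V. ?R j i}. Gm kl j * t T_u j i)))"
  proof -
    have "(\<Sum>j\<in>?V. A j * (\<Sum>i\<in>{i\<in>?V. ?R j i}. t T_u j i * d up i)) =
        (\<Sum>j\<in>?V. \<Sum>i\<in>{i\<in>?V. ?R j i}. A j * (t T_u j i * d up i))"
      by (simp only: sum_distrib_left)
    also have "\<dots> = (\<Sum>i\<in>?V. \<Sum>j\<in>{j\<in>?V. ?R j i}. A j * (t T_u j i * d up i))"
      by (rule sum.swap_restrict) simp_all
    also have "\<dots> = (\<Sum>i\<in>?V. d up i * (\<Sum>kl\<in>?N. c kl * (\<Sum>j\<in>{j\<in>?V. ?R j i}. Gm kl j * t T_u j i)))"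
    proof (intro sum.cong refl)
      fix i
      have "(\<Sum>kl\<in>?N. c kl * (\<Sum>j\<in>{j\<in>?V. ?R j i}. Gm kl j * t T_u j i)) =
          (\<Sum>j\<in>{j\<in>?V. ?R j i}. \<Sum>kl\<in>?N. c kl * (Gm kl j * t T_u j i))"
        unfolding sum_distrib_left by (rule sum.swap)
      also have "\<dots> = (\<Sum>j\<in>{j\<in>?V. ?R j i}. A j * t T_u j i)"
        by (simp add: A_def sum_distrib_right mult.assoc)
      finally show "(\<Sum>j\<in>{j\<in>?V. ?R j i}. A j * (t T_u j i * d up i)) =
         d up i * (\<Sum>kl\<in>?N. c kl * (\<Sum>j\<in>{j\<in>?V. ?R j i}. Gm kl j * t T_u j i))"
        by (simp add: sum_distrib_left mult_ac)
    qed
    finally show ?thesis .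
  qed
  have pull: "(\<Sum>kl\<in>S. c kl * (\<Sum>i\<in>L. x i * g kl i)) = (\<Sum>i\<in>L. x i * (\<Sum>kl\<in>S. c kl * g kl i))"
    for S L x and g :: "int \<times> int \<Rightarrow> nat \<times> nat \<Rightarrow> real"
    unfolding sum_distrib_left by (subst sum.swap) (intro sum.cong refl, simp add: mult_ac)
  have "(\<Sum>j\<in>?V. d um j * A j) = (\<Sum>j\<in>?V. A j * (\<Sum>i\<in>{i\<in>?V. ?R j i}. t T_u j i * d up i)) +
      (\<Sum>j\<in>?V. A j * (\<Sum>i\<in>Lam 3. t T_plus j i * d fp i)) + (\<Sum>j\<in>?V. A j * (\<Sum>i\<in>Lam 3. t T_minus j i * d fm i)) +
      (\<Sum>j\<in>?V. A j * (\<Sum>i\<in>Lam 5. t T_gD j i * d gD i)) + (\<Sum>j\<in>?V. A j * (\<Sum>i\<in>Lam 4. t T_gN j i * d gN i))"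
    unfolding sum.distrib[symmetric] by (intro sum.cong refl) (simp add: um algebra_simps)
  note minus = this[unfolded swap swap_u]
  have rhs: "scheme_rhs (interface_scheme D C) p fp fm gD gN h =
     (\<Sum>i\<in>Lam 3. d fp i * ((\<Sum>kl\<in>?P. c kl * Qp kl i) + (\<Sum>j\<in>?V. A j * t T_plus j i))) +
     (\<Sum>i\<in>Lam 3. d fm i * ((\<Sum>kl\<in>?N. c kl * Qm kl i) + (\<Sum>j\<in>?V. A j * t T_minus j i))) +
     (\<Sum>i\<in>Lam 5. d gD i * (\<Sum>j\<in>?V. A j * t T_gD j i)) + (\<Sum>i\<in>Lam 4. d gN i * (\<Sum>j\<in>?V. A j * t T_gN j i))"
    by (simp add: scheme_rhs_def interface_scheme_def J_plus_def J_minus_def I_sum_def I_minus_def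
        case_prod_unfold A_def c_def Gm_def Qp_def Qm_def d_def t_def)
  have "(\<Sum>kl\<in>?P. c kl * ((\<Sum>i\<in>?V. d up i * Gp kl i) + (\<Sum>i\<in>Lam 3. d fp i * Qp kl i))) +
      (\<Sum>kl\<in>?N. c kl * ((\<Sum>i\<in>?V. d um i * Gm kl i) + (\<Sum>i\<in>Lam 3. d fm i * Qm kl i))) -
      scheme_rhs (interface_scheme D C) p fp fm gD gN h =
      (\<Sum>i\<in>?V. d up i * ((\<Sum>kl\<in>?N. c kl * (\<Sum>j\<in>{j\<in>?V. ?R j i}. Gm kl j * t T_u j i)) + (\<Sum>kl\<in>?P. c kl * Gp kl i)))"
    unfolding rhs distrib_left sum.distrib pull A_def[symmetric] minus by simp
  then show ?thesis
    by (simp add: case_prod_unfold c_def Gp_def Gm_def Qp_def Qm_def d_def t_def)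
qed

text \<open>The stencil coefficients are bounded as \<open>h\<close> tends to \<open>0\<close>, so the remainders of the
  expansions contribute \<open>O(h\<^sup>6)\<close>, like the system itself.\<close>

theorem interface_scheme_accuracy:
  assumes D: "admissible D" and C: "solves_system D C"
  shows "has_accuracy_order D (interface_scheme D C) 5"
  unfolding has_accuracy_order_def
proof (intro allI impI)
  fix up um fp fm gD gN assume sol: "local_solution D up um fp fm gD gN"
  let ?p = "base_pt D"
  obtain U where U: "?p \<in> U" "smooth_on U (a_plus D)" "smooth_on U (a_minus D)"
     "a_plus D ?p > 0" "a_minus D ?p > 0"
    by (rule admissible_coefficients[OF D])
  have s: "smooth_near ?p up" "smooth_near ?p um"
    using sol unfolding local_solution_def Let_def by blast+
  let ?plus = "\<lambda>h kl. (\<Sum>(m, n)\<in>LamV1 5. pd m n up ?p * G_plus D m n h kl) +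
             (\<Sum>(m, n)\<in>Lam 3. pd m n fp ?p * Q_plus D m n h kl)"
  let ?minus = "\<lambda>h kl. (\<Sum>(m, n)\<in>LamV1 5. pd m n um ?p * G_minus D m n h kl) +
             (\<Sum>(m, n)\<in>Lam 3. pd m n fm ?p * Q_minus D m n h kl)"
  have plus: "(\<lambda>h. exact_value D up um h kl - ?plus h kl) \<in> O[at_right 0](\<lambda>h. h ^ 6)" if "kl \<in> plus_nodes D" for kl
    using reduced_expansion[OF U(2,1,4) _ s(1), of 4 "v0 D + fst kl" "w0 D + snd kl"] that
    by (simp add: exact_value_def G_plus_def Q_plus_def case_prod_unfold source_derivatives(1)[OF D sol])
  have minus: "(\<lambda>h. exact_value D up um h kl - ?minus h kl) \<in> O[at_right 0](\<lambda>h. h ^ 6)" if "kl \<in> minus_nodes D" for kl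
  proof -
    have "kl \<notin> plus_nodes D" using that stencil_partition(3) by blast
    then show ?thesis
      using reduced_expansion[OF U(3,1,5) _ s(2), of 4 "v0 D + fst kl" "w0 D + snd kl"]
      by (simp add: exact_value_def G_minus_def Q_minus_def case_prod_unfold source_derivatives(2)[OF D sol])
  qed
  let ?sys = "\<lambda>h m n. (\<Sum>kl \<in> minus_nodes D. poly (C kl) h *
              (\<Sum>(m', n') \<in> {(m', n') \<in> LamV1 5. m' + n' \<ge> m + n}.
                 G_minus D m' n' h kl * T_u (transmission_coeffs 4 D) m' n' m n)) +
          (\<Sum>kl \<in> plus_nodes D. poly (C kl) h * G_plus D m n h kl)"
  have plus_sum: "(\<lambda>h. \<Sum>kl\<in>plus_nodes D. poly (C kl) h * (exact_value D up um h kl - ?plus h kl)) \<in> O[at_right 0](\<lambda>h. 1 * h ^ 6)"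
    by (rule big_sum_in_bigo) (rule landau_o.big.mult[OF poly_bounded_near_0 plus])
  have minus_sum: "(\<lambda>h. \<Sum>kl\<in>minus_nodes D. poly (C kl) h * (exact_value D up um h kl - ?minus h kl)) \<in> O[at_right 0](\<lambda>h. 1 * h ^ 6)"
    by (rule big_sum_in_bigo) (rule landau_o.big.mult[OF poly_bounded_near_0 minus])
  have system: "(\<lambda>h. \<Sum>i\<in>LamV1 5. pd (fst i) (snd i) up ?p * ?sys h (fst i) (snd i)) \<in> O[at_right 0](\<lambda>h. 1 * h ^ 6)"
  proof (rule big_sum_in_bigo)
    fix i assume "i \<in> LamV1 5"
    then have "(\<lambda>h. ?sys h (fst i) (snd i)) \<in> O[at_right 0](\<lambda>h. h ^ 6)"
      using C unfolding solves_system_def by (auto simp: case_prod_unfold)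
    then show "(\<lambda>h. pd (fst i) (snd i) up ?p * ?sys h (fst i) (snd i)) \<in> O[at_right 0](\<lambda>h. 1 * h ^ 6)"
      by (cases "pd (fst i) (snd i) up ?p = 0") simp_all
  qed
  note sum_in_bigo(1)[OF sum_in_bigo(1)[OF plus_sum minus_sum] system]
  moreover have "(\<Sum>kl\<in>stencil. poly (C kl) h * exact_value D up um h kl) - scheme_rhs (interface_scheme D C) ?p fp fm gD gN h =
     (\<Sum>kl\<in>plus_nodes D. poly (C kl) h * (exact_value D up um h kl - ?plus h kl)) +
      (\<Sum>kl\<in>minus_nodes D. poly (C kl) h * (exact_value D up um h kl - ?minus h kl)) +
      (\<Sum>i\<in>LamV1 5. pd (fst i) (snd i) up ?p * ?sys h (fst i) (snd i))" for h
  proof -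
    have "(\<Sum>i\<in>LamV1 5. pd (fst i) (snd i) up ?p * ?sys h (fst i) (snd i)) =
       (\<Sum>kl\<in>plus_nodes D. poly (C kl) h * ?plus h kl) + (\<Sum>kl\<in>minus_nodes D. poly (C kl) h * ?minus h kl) -
       scheme_rhs (interface_scheme D C) ?p fp fm gD gN h"
      using scheme_identity[OF D sol, of C h] by (simp add: case_prod_unfold)
    moreover have "(\<Sum>kl\<in>stencil. poly (C kl) h * exact_value D up um h kl) =
      (\<Sum>kl\<in>plus_nodes D. poly (C kl) h * exact_value D up um h kl) + (\<Sum>kl\<in>minus_nodes D. poly (C kl) h * exact_value D up um h kl)"
      unfolding stencil_partition(4)[of D] by (rule sum.union_disjoint) (fact stencil_partition)+
    ultimately show ?thesis by (simp add: right_diff_distrib sum_subtractf)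
  qed
  ultimately show "(\<lambda>h. (\<Sum>kl\<in>stencil. poly (stencil_coeff (interface_scheme D C) kl) h * exact_value D up um h kl) -
      scheme_rhs (interface_scheme D C) ?p fp fm gD gN h) \<in> O[at_right 0](\<lambda>h. h ^ (5 + 1))"
    by (simp add: interface_scheme_def)
qed

section \<open>Existence of schemes of order five\<close>

text \<open>Fraction-free Gaussian elimination.\<close>

lemma underdetermined_system_has_nonzero_solution:
  fixes A :: "'e \<Rightarrow> 'v \<Rightarrow> 'a :: idom"
  assumes "finite E" "finite V" "card E < card V"
  shows "\<exists>x. (\<exists>v\<in>V. x v \<noteq> 0) \<and> (\<forall>e\<in>E. (\<Sum>v\<in>V. A e v * x v) = 0)"
  using assms
proof (induction E arbitrary: V A rule: finite_induct)
  case empty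
  then have "V \<noteq> {}" by auto
  then show ?case by (intro exI[of _ "\<lambda>v. 1"]) auto
next
  case (insert e E)
  show ?case
  proof (cases "\<forall>v\<in>V. A e v = 0")
    case True
    have "card E < card V" using insert.prems insert.hyps by simp
    from insert.IH[OF insert.prems(1) this, of A] True show ?thesis by auto
  next
    case False
    then obtain v0 where v0: "v0 \<in> V" "A e v0 \<noteq> 0" by blast
    let ?V = "V - {v0}" and ?\<pi> = "A e v0"
    have "finite ?V" "card E < card ?V" using insert v0 by (auto simp: card_Diff_singleton)
    from insert.IH[OF this, of "\<lambda>f v. ?\<pi> * A f v - A f v0 * A e v"]
    obtain y v1 where y: "v1 \<in> ?V" "y v1 \<noteq> 0"
      "\<And>f. f \<in> E \<Longrightarrow> (\<Sum>v\<in>?V. (?\<pi> * A f v - A f v0 * A e v) * y v) = 0" by blast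
    define x where "x v = (if v = v0 then - (\<Sum>v\<in>?V. A e v * y v) else ?\<pi> * y v)" for v
    have split: "(\<Sum>v\<in>V. A f v * x v) = A f v0 * x v0 + (\<Sum>v\<in>?V. A f v * (?\<pi> * y v))" for f
    proof -
      have "(\<Sum>v\<in>?V. A f v * x v) = (\<Sum>v\<in>?V. A f v * (?\<pi> * y v))"
        by (rule sum.cong) (auto simp: x_def)
      then show ?thesis using sum.remove[OF insert.prems(1) v0(1), of "\<lambda>v. A f v * x v"] by simp
    qed
    have "(\<Sum>v\<in>V. A f v * x v) = 0" if "f \<in> insert e E" for f
    proof (cases "f = e")
      case True
      then show ?thesis unfolding split by (simp add: x_def sum_distrib_left mult_ac)
    next
      case False
      with that y(3) have "(\<Sum>v\<in>?V. (?\<pi> * A f v - A f v0 * A e v) * y v) = 0" by blast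
      then show ?thesis unfolding split
        by (simp add: x_def sum_distrib_left sum_subtractf algebra_simps)
    qed
    moreover have "x v1 \<noteq> 0" using y v0 by (simp add: x_def)
    ultimately show ?thesis using y(1) by blast
  qed
qed

text \<open>A nonzero polynomial solution that vanishes at \<open>0\<close> is divisible by the variable, and the quotient is again a
  solution, of smaller total degree.\<close>

lemma nontrivial_polynomial_solution:
  fixes A :: "'e \<Rightarrow> 'v \<Rightarrow> real poly"
  assumes "finite E" "finite V" "card E < card V"
  shows "\<exists>x. (\<exists>v\<in>V. poly (x v) 0 \<noteq> 0) \<and> (\<forall>e\<in>E. (\<Sum>v\<in>V. A e v * x v) = 0)"
proof -
  have "\<exists>x. (\<exists>v\<in>V. poly (x v) 0 \<noteq> 0) \<and> (\<forall>e\<in>E. (\<Sum>v\<in>V. A e v * x v) = 0)"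
    if "\<exists>v\<in>V. x v \<noteq> 0" "\<forall>e\<in>E. (\<Sum>v\<in>V. A e v * x v) = 0" for x
    using that
  proof (induction "\<Sum>v\<in>V. degree (x v)" arbitrary: x rule: less_induct)
    case less
    show ?case
    proof (cases "\<exists>v\<in>V. poly (x v) 0 \<noteq> 0")
      case True
      then show ?thesis using less.prems by blast
    next
      case False
      then have "\<forall>v\<in>V. \<exists>y. x v = [:0, 1:] * y" by (auto simp: poly_eq_0_iff_dvd dvd_def)
      then obtain y where y: "\<And>v. v \<in> V \<Longrightarrow> x v = [:0, 1:] * y v" by metis
      have "[:0, 1:] * (\<Sum>v\<in>V. A e v * y v) = (\<Sum>v\<in>V. A e v * x v)" for e
        unfolding sum_distrib_left by (intro sum.cong refl) (simp add: y)
      then have "[:0, 1:] * (\<Sum>v\<in>V. A e v * y v) = 0" if "e \<in> E" for e using less.prems(2) that by simp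
      then have sol: "\<forall>e\<in>E. (\<Sum>v\<in>V. A e v * y v) = 0" by fastforce
      obtain v1 where v1: "v1 \<in> V" "x v1 \<noteq> 0" using less.prems(1) by blast
      then have y1: "y v1 \<noteq> 0" using y by auto
      have le: "degree (y v) \<le> degree (x v)" if "v \<in> V" for v
        using y[OF that] by (cases "y v = 0") (auto simp: degree_mult_eq)
      have "degree (y v1) < degree (x v1)" using y[OF v1(1)] y1 by (simp add: degree_mult_eq)
      then have "(\<Sum>v\<in>V. degree (y v)) < (\<Sum>v\<in>V. degree (x v))"
        using sum_strict_mono_ex1[OF assms(2), of "\<lambda>v. degree (y v)" "\<lambda>v. degree (x v)"] le v1 by blast
      from less.hyps[OF this _ sol] y1 v1 show ?thesis by blast
    qed
  qed
  then show ?thesis using underdetermined_system_has_nonzero_solution[OF assms, of A] by blast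
qed

lemma real_polynomial_function_imp_poly:
  fixes f :: "real \<Rightarrow> real"
  assumes "real_polynomial_function f"
  shows "\<exists>q. \<forall>h. poly q h = f h"
proof -
  obtain a n where "f = (\<lambda>x. \<Sum>i\<le>n. a i * x ^ i)"
    using assms real_polynomial_function_iff_sum by blast
  then have "\<forall>h. poly (\<Sum>i\<le>n. monom (a i) i) h = f h" by (simp add: poly_sum poly_monom)
  then show ?thesis by blast
qed

lemma GV_polynomial: "real_polynomial_function (\<lambda>h. GV a p M m n (v * h) (w * h))"
proof -
  have linear: "real_polynomial_function (\<lambda>h :: real. c * h)" for c
    by (intro real_polynomial_function.intros(1)) (simp add: bounded_linear_mult_right)
  have "real_polynomial_function (\<lambda>h. (c :: real) * ((v * h) ^ i * (w * h) ^ j))" for c i j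
    by (rule real_polynomial_function.intros(4)[OF real_polynomial_function.intros(2)
          real_polynomial_function.intros(4)[OF real_polynomial_function_power[OF linear] real_polynomial_function_power[OF linear]]])
  note monomial = this
  have "real_polynomial_function (\<lambda>h.
     (\<Sum>l = 0..n div 2. ((-1) ^ l / (fact (m + 2 * l) * fact (n - 2 * l))) * ((v * h) ^ (m + 2 * l) * (w * h) ^ (n - 2 * l))) +
     (\<Sum>i \<in> {(m', n') \<in> LamV2 (M + 1). m' + n' > m + n}.
        (A_u M a p (fst i) (snd i) m n / (fact (fst i) * fact (snd i))) * ((v * h) ^ fst i * (w * h) ^ snd i)))"
    by (intro real_polynomial_function.intros(3) real_polynomial_function_sum monomial)
      (auto intro: finite_subset[OF _ finite_LamV2[of "M + 1"]])
  then show ?thesis by (simp add: GV_def case_prod_unfold mult.assoc)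
qed

lemma card_stencil: "card stencil = 13"
  by (simp add: stencil_def inner_offsets_def outer_offsets_def insert_Times_insert)

lemma card_LamV1_5: "card (LamV1 5) \<le> 11"
proof -
  have "LamV1 5 \<subseteq> Pair 0 ` {..5} \<union> Pair 1 ` {..4}" by (auto simp: LamV1_def Lam_def)
  then have "card (LamV1 5) \<le> card (Pair (0::nat) ` {..5::nat} \<union> Pair 1 ` {..4})" by (intro card_mono) auto
  also have "\<dots> \<le> card (Pair (0::nat) ` {..5::nat}) + card (Pair (1::nat) ` {..4::nat})" by (rule card_Un_le)
  also have "\<dots> = 11" by (simp add: card_image inj_on_def)
  finally show ?thesis .
qed

lemma solves_system_solvable: "\<exists>C. nontrivial C \<and> solves_system D C"
proof -
  let ?T = "T_u (transmission_coeffs 4 D)"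
  define f where "f i kl h = (if kl \<in> minus_nodes D then
      (\<Sum>(m', n') \<in> {(m', n') \<in> LamV1 5. m' + n' \<ge> fst i + snd i}. G_minus D m' n' h kl * ?T m' n' (fst i) (snd i))
    else G_plus D (fst i) (snd i) h kl)" for i kl h
  have "real_polynomial_function (f i kl)" for i kl
  proof (cases "kl \<in> minus_nodes D")
    case True
    have "real_polynomial_function (\<lambda>h. \<Sum>j \<in> {(m', n') \<in> LamV1 5. m' + n' \<ge> fst i + snd i}.
        GV (a_minus D) (base_pt D) 4 (fst j) (snd j) ((v0 D + real_of_int (fst kl)) * h) ((w0 D + real_of_int (snd kl)) * h) *
        ?T (fst j) (snd j) (fst i) (snd i))"
      by (intro real_polynomial_function_sum real_polynomial_function.intros(4) GV_polynomial real_polynomial_function.intros(2))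
        (auto intro: finite_subset[OF _ finite_LamV1[of 5]])
    then show ?thesis using True by (simp add: f_def[abs_def] G_minus_def case_prod_unfold)
  next
    case False
    then show ?thesis using GV_polynomial by (simp add: f_def[abs_def] G_plus_def case_prod_unfold)
  qed
  then have "\<forall>i kl. \<exists>q. \<forall>h. poly q h = f i kl h" using real_polynomial_function_imp_poly by blast
  then obtain A where A: "\<And>i kl h. poly (A i kl) h = f i kl h" by metis
  have "finite stencil" using card_stencil by (metis card.infinite zero_neq_numeral)
  moreover have "card (LamV1 5) < card stencil" using card_LamV1_5 card_stencil by linarith
  ultimately obtain C where C: "\<exists>kl\<in>stencil. poly (C kl) 0 \<noteq> 0"
    "\<forall>i\<in>LamV1 5. (\<Sum>kl\<in>stencil. A i kl * C kl) = 0"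
    using nontrivial_polynomial_solution[of "LamV1 5" stencil A] by auto
  have "solves_system D C"
    unfolding solves_system_def
  proof clarify
    fix m n assume "(m, n) \<in> LamV1 5"
    with C(2) have "(\<Sum>kl\<in>stencil. A (m, n) kl * C kl) = 0" by blast
    then have "poly (\<Sum>kl\<in>stencil. A (m, n) kl * C kl) h = 0" for h by simp
    then have zero: "(\<Sum>kl\<in>stencil. f (m, n) kl h * poly (C kl) h) = 0" for h by (simp add: poly_sum A)
    have "(\<Sum>kl\<in>stencil. f (m, n) kl h * poly (C kl) h) =
       (\<Sum>kl\<in>plus_nodes D. f (m, n) kl h * poly (C kl) h) + (\<Sum>kl\<in>minus_nodes D. f (m, n) kl h * poly (C kl) h)" for h
      unfolding stencil_partition(4)[of D] by (rule sum.union_disjoint) (fact stencil_partition)+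
    moreover have "(\<Sum>kl\<in>plus_nodes D. f (m, n) kl h * poly (C kl) h) = (\<Sum>kl \<in> plus_nodes D. poly (C kl) h * G_plus D m n h kl)" for h
      using stencil_partition(3)[of D] by (intro sum.cong refl) (auto simp: f_def)
    moreover have "(\<Sum>kl\<in>minus_nodes D. f (m, n) kl h * poly (C kl) h) = (\<Sum>kl \<in> minus_nodes D. poly (C kl) h *
              (\<Sum>(m', n') \<in> {(m', n') \<in> LamV1 5. m' + n' \<ge> m + n}. G_minus D m' n' h kl * ?T m' n' m n))" for h
      by (intro sum.cong refl) (auto simp: f_def mult.commute)
    ultimately have "(\<Sum>kl \<in> minus_nodes D. poly (C kl) h *
              (\<Sum>(m', n') \<in> {(m', n') \<in> LamV1 5. m' + n' \<ge> m + n}. G_minus D m' n' h kl * ?T m' n' m n)) +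
          (\<Sum>kl \<in> plus_nodes D. poly (C kl) h * G_plus D m n h kl) = 0" for h
      using zero[of h] by simp
    then show "(\<lambda>h. (\<Sum>kl \<in> minus_nodes D. poly (C kl) h *
              (\<Sum>(m', n') \<in> {(m', n') \<in> LamV1 5. m' + n' \<ge> m + n}. G_minus D m' n' h kl * ?T m' n' m n)) +
          (\<Sum>kl \<in> plus_nodes D. poly (C kl) h * G_plus D m n h kl)) \<in> O[at_right 0](\<lambda>h. h ^ 6)"
      by simp
  qed
  with C(1) show ?thesis by (auto simp: nontrivial_def)
qed

lemma interface_scheme_is_scheme: "nontrivial C \<Longrightarrow> is_13_point_scheme (interface_scheme D C)"
  by (simp add: is_13_point_scheme_def interface_scheme_def)

theorem order_5_attainable: "order_attainable 5"
  unfolding order_attainable_def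
  using solves_system_solvable interface_scheme_is_scheme interface_scheme_accuracy by blast

section \<open>An interface at which order six is impossible\<close>

text \<open>Real parts of complex monomials about \<open>b\<close>. They span the harmonic polynomials and form a class
  closed under partial derivatives.\<close>

definition harmonic_power :: "complex \<Rightarrow> nat \<Rightarrow> complex \<Rightarrow> plane \<Rightarrow> real" where
  "harmonic_power \<beta> k b q = Re (\<beta> * (Complex (fst q) (snd q) - b) ^ k)"

lemma harmonic_power_has_derivative:
  "(harmonic_power \<beta> k b has_derivative (\<lambda>v. fst v * harmonic_power (\<beta> * of_nat k) (k - 1) b q +
      snd v * harmonic_power (\<beta> * of_nat k * \<i>) (k - 1) b q)) (at q)"
proof -
  have "((\<lambda>q :: plane. Re (\<beta> * (of_real (fst q) + \<i> * of_real (snd q) - b) ^ k)) has_derivative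
      (\<lambda>v. Re (\<beta> * (of_nat k * (of_real (fst v) + \<i> * of_real (snd v)) * (of_real (fst q) + \<i> * of_real (snd q) - b) ^ (k - 1))))) (at q)"
    by (auto intro!: derivative_eq_intros)
  then show ?thesis
    unfolding harmonic_power_def[abs_def] Complex_eq
    by (rule has_derivative_eq_rhs) (auto simp: algebra_simps)
qed

lemma dx_harmonic_power: "dx (harmonic_power \<beta> k b) = harmonic_power (\<beta> * of_nat k) (k - 1) b"
  and dy_harmonic_power: "dy (harmonic_power \<beta> k b) = harmonic_power (\<beta> * of_nat k * \<i>) (k - 1) b"
  using dx_dy_of_has_derivative[OF harmonic_power_has_derivative] by blast+

lemma smooth_on_harmonic_power: "smooth_on UNIV (harmonic_power \<beta> k b)"
proof (rule smooth_on_coinduct[where P = "\<lambda>G. \<exists>\<beta> k. G = harmonic_power \<beta> k b"])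
  fix G assume "\<exists>\<beta> k. G = harmonic_power \<beta> k b"
  then obtain \<beta> k where G: "G = harmonic_power \<beta> k b" by blast
  show "\<exists>Gx Gy. (\<exists>\<beta> k. Gx = harmonic_power \<beta> k b) \<and> (\<exists>\<beta> k. Gy = harmonic_power \<beta> k b) \<and>
      (\<forall>q\<in>UNIV. (G has_derivative (\<lambda>v. fst v * Gx q + snd v * Gy q)) (at q))"
    using harmonic_power_has_derivative[of \<beta> k b] unfolding G by blast
qed auto

lemma harmonic_power_harmonic: "neg_div_grad (\<lambda>q. c) (harmonic_power \<beta> k b) = (\<lambda>q. 0)"
proof
  fix q
  have "dx (\<lambda>p. c * dx (harmonic_power \<beta> k b) p) q = c * harmonic_power (\<beta> * of_nat k * of_nat (k - 1)) (k - 1 - 1) b q"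
    "dy (\<lambda>p. c * dy (harmonic_power \<beta> k b) p) q = c * harmonic_power (\<beta> * of_nat k * \<i> * of_nat (k - 1) * \<i>) (k - 1 - 1) b q"
    unfolding dx_harmonic_power dy_harmonic_power
    by (simp_all add: dx_cmult[OF smooth_on_harmonic_power] dy_cmult[OF smooth_on_harmonic_power] dx_harmonic_power dy_harmonic_power)
  moreover have "harmonic_power (\<beta> * of_nat k * \<i> * of_nat (k - 1) * \<i>) (k - 1 - 1) b q = - harmonic_power (\<beta> * of_nat k * of_nat (k - 1)) (k - 1 - 1) b q"
  proof -
    have "\<beta> * of_nat k * \<i> * of_nat (k - 1) * \<i> = - (\<beta> * of_nat k * of_nat (k - 1))" by (simp add: algebra_simps)
    then show ?thesis unfolding harmonic_power_def by simp
  qed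
  ultimately show "neg_div_grad (\<lambda>q. c) (harmonic_power \<beta> k b) q = 0" by (simp add: neg_div_grad_def)
qed

definition line_level :: "plane \<Rightarrow> real" where
  "line_level q = 2 - 2 * fst q - snd q"

text \<open>A straight interface of slope \<open>-2\<close>. Of the thirteen nodes, exactly \<open>(1, 1)\<close> and \<open>(2, 0)\<close> lie on the
  minus side; \<open>(1, 0)\<close> and \<open>(0, 2)\<close> lie on the line itself and count as plus nodes. A horizontal, vertical or diagonal
  line shares a mirror symmetry with the stencil; counting the symmetric weights shows that the thirteen conditions
  for order six are then dependent.\<close>

definition line_data :: interface_data where
  "line_data = \<lparr> L1 = -2, L2 = 2, L3 = -2, L4 = 2, mesh = 1, num_x = 4, num_y = 4, idx_i = 2, idx_j = 2,
     level = line_level, a_plus = (\<lambda>q. 3), a_minus = (\<lambda>q. 1), base_pt = (3/4, 1/2),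
     curve_r = (\<lambda>t. t), curve_s = (\<lambda>t. -2 * t), orient = 1 \<rparr>"

lemma smooth_near_0_linear: "smooth_near_0 (\<lambda>t. c * t)"
proof -
  have "\<exists>A B. (deriv ^^ k) (\<lambda>t. c * t) = (\<lambda>t. A * t + B :: real)" for k
  proof (induction k)
    case 0
    show ?case by (intro exI[of _ c] exI[of _ 0]) simp
  next
    case (Suc k)
    then obtain A B where IH: "(deriv ^^ k) (\<lambda>t. c * t) = (\<lambda>t. A * t + B)" by blast
    have D: "deriv (\<lambda>t. A * t + B) = (\<lambda>t :: real. 0 * t + A)"
      by (rule ext, rule DERIV_imp_deriv) (auto intro!: derivative_eq_intros)
    have "(deriv ^^ Suc k) (\<lambda>t. c * t) = (\<lambda>t. 0 * t + A)"
      by (simp only: funpow.simps comp_apply IH D)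
    then show ?case by blast
  qed
  moreover have "(\<lambda>t. A * t + B :: real) differentiable_on {-1<..<1}" for A B
    by (intro derivative_intros)
  ultimately show ?thesis unfolding smooth_near_0_def by (metis zero_less_one)
qed

lemma deriv_line: "deriv (\<lambda>t. t) t = (1 :: real)" "deriv (\<lambda>t. -2 * t) t = (-2 :: real)"
  by (auto intro!: DERIV_imp_deriv derivative_eq_intros)

lemma curve_normal_line: "curve_normal (\<lambda>t. t) (\<lambda>t. -2 * t) 1 t = (1 / sqrt 5) *\<^sub>R (-2, -1)"
  using deriv_line[of t] unfolding curve_normal_def by simp

lemma line_interface:
  assumes q: "line_level q = 0"
  shows "local_interface line_level q (\<lambda>t. t) (\<lambda>t. -2 * t) 1"
  unfolding local_interface_def
proof (intro conjI)
  let ?\<gamma> = "curve (\<lambda>t. t) (\<lambda>t. -2 * t) q" and ?\<nu> = "curve_normal (\<lambda>t. t) (\<lambda>t. -2 * t) 1"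
  show "smooth_near_0 (\<lambda>t. t)" using smooth_near_0_linear[of 1] by simp
  show "smooth_near_0 (\<lambda>t. -2 * t)" by (rule smooth_near_0_linear)
  show "\<forall>\<^sub>F t in nhds 0. (deriv (\<lambda>t. t) t)\<^sup>2 + (deriv (\<lambda>t. -2 * t) t)\<^sup>2 > (0::real)"
    using deriv_line by simp
  show "\<forall>\<^sub>F t in nhds 0. line_level (?\<gamma> t) = 0"
    using q by (simp add: line_level_def curve_def)
  show "\<forall>\<delta>>0. \<forall>\<^sub>F x in nhds q. line_level x = 0 \<longrightarrow> x \<in> ?\<gamma> ` {-\<delta><..<\<delta>}"
  proof (intro allI impI)
    fix \<delta> :: real assume \<delta>: "\<delta> > 0"
    have "x \<in> ?\<gamma> ` {-\<delta><..<\<delta>}" if "dist x q < \<delta>" "line_level x = 0" for x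
    proof (rule image_eqI)
      have "\<bar>fst x - fst q\<bar> < \<delta>" using dist_fst_le[of x q] that(1) by (simp add: dist_real_def)
      then show "fst x - fst q \<in> {-\<delta><..<\<delta>}" by auto
      show "x = ?\<gamma> (fst x - fst q)"
        using that(2) q by (cases x) (simp add: curve_def line_level_def)
    qed
    with \<delta> show "\<forall>\<^sub>F x in nhds q. line_level x = 0 \<longrightarrow> x \<in> ?\<gamma> ` {-\<delta><..<\<delta>}"
      unfolding eventually_nhds_metric by blast
  qed
  have sides: "line_level (?\<gamma> t + \<epsilon> *\<^sub>R ?\<nu> t) > 0 \<and>
        line_level (?\<gamma> t - \<epsilon> *\<^sub>R ?\<nu> t) < 0"
    if "\<epsilon> > 0" for t \<epsilon>
  proof -
    have "\<epsilon> * (5 * sqrt 5) > 0" using that by simp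
    moreover have "snd q + fst q * 2 = 2" using q by (simp add: line_level_def)
    ultimately show ?thesis
      unfolding curve_normal_line by (simp add: line_level_def curve_def field_simps)
  qed
  show "\<forall>\<^sub>F t in nhds 0. \<forall>\<^sub>F \<epsilon> in at_right 0.
        line_level (?\<gamma> t + \<epsilon> *\<^sub>R ?\<nu> t) > 0 \<and>
        line_level (?\<gamma> t - \<epsilon> *\<^sub>R ?\<nu> t) < 0"
    by (rule always_eventually, rule allI, rule eventually_mono[OF eventually_at_right_less], rule sides)
qed simp_all

lemma stencil_explicit: "stencil = {(-1,-1), (-1,0), (-1,1), (0,-1), (0,0), (0,1), (1,-1), (1,0), (1,1),
    (-2,0), (0,-2), (0,2), (2,0)}"
  by (simp add: stencil_def inner_offsets_def outer_offsets_def insert_Times_insert insert_commute)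

lemma line_nodes: "kl \<in> stencil \<Longrightarrow> kl \<in> plus_nodes line_data \<longleftrightarrow> kl \<noteq> (1, 1) \<and> kl \<noteq> (2, 0)"
proof -
  assume kl: "kl \<in> stencil"
  have "kl \<in> plus_nodes line_data \<longleftrightarrow> level line_data (node line_data kl) \<ge> 0"
    using kl by (auto simp: stencil_def d_plus_def e_plus_def)
  also have "level line_data (node line_data kl) = of_int (2 - 2 * fst kl - snd kl)"
    by (simp add: line_data_def node_def line_level_def case_prod_unfold)
  finally have "kl \<in> plus_nodes line_data \<longleftrightarrow> 2 - 2 * fst kl - snd kl \<ge> 0" by (simp only: of_int_0_le_iff)
  with kl show ?thesis unfolding stencil_explicit by (elim insertE emptyE) simp_all
qed

lemma line_v0_w0: "v0 line_data = - 3 / 4" "w0 line_data = - 1 / 2"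
  by (simp_all add: v0_def w0_def node_def line_data_def)

lemma smooth_near_const: "smooth_near p (\<lambda>q. c)"
  unfolding smooth_near_def using smooth_on_const[OF open_UNIV] by blast

lemma line_admissible: "admissible line_data"
proof -
  have "smooth_on UNIV (\<lambda>q. ((-2) * fst q + (-1) * snd q) + 2)"
    by (intro smooth_on_add smooth_on_linear smooth_on_const open_UNIV)
  then have level: "smooth_on UNIV line_level"
    by (rule smooth_on_cong) (simp add: line_level_def)
  have "(0, 0) \<in> d_plus line_data" "(1, 1) \<in> d_minus line_data"
    by (simp_all add: d_plus_def d_minus_def inner_offsets_def line_data_def node_def line_level_def)
  then have nodes: "d_plus line_data \<noteq> {}" "d_minus line_data \<noteq> {}" by auto
  have interface: "\<forall>q \<in> {L1 line_data<..<L2 line_data} \<times> {L3 line_data<..<L4 line_data}. level line_data q = 0 \<longrightarrow>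
        (\<exists>r s \<sigma>. local_interface (level line_data) q r s \<sigma>)"
  proof (intro ballI impI)
    fix q assume "level line_data q = 0"
    then have "local_interface (level line_data) q (\<lambda>t. t) (\<lambda>t. -2 * t) 1"
      using line_interface by (simp add: line_data_def)
    then show "\<exists>r s \<sigma>. local_interface (level line_data) q r s \<sigma>" by blast
  qed
  have base: "local_interface (level line_data) (base_pt line_data) (curve_r line_data) (curve_s line_data) (orient line_data)"
    using line_interface[of "(3/4, 1/2)"] by (simp add: line_data_def line_level_def)
  show ?thesis
    unfolding admissible_def line_v0_w0
  proof (intro conjI interface nodes base)
    show "\<exists>U. {L1 line_data..L2 line_data} \<times> {L3 line_data..L4 line_data} \<subseteq> U \<and> smooth_on U (level line_data)"
      using level by (intro exI[of _ UNIV]) (simp add: line_data_def)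
  qed (simp_all add: line_data_def line_level_def smooth_near_const)
qed

text \<open>In coordinates centred at the base point, the reflection in the interface maps \<open>\<zeta>\<close> to
  \<open>mirror * cnj \<zeta>\<close>, where \<open>mirror\<close> is the square of the unit direction \<open>(1 - 2 \<i>) / sqrt 5\<close>. With \<open>U\<close> the
  real part of \<open>\<alpha> \<zeta>\<^sup>k\<close>, the function \<open>2 U - U \<circ> R\<close> is the real part of \<open>reflected_weight \<alpha> k * \<zeta>\<^sup>k\<close>.\<close>

abbreviation "base_z \<equiv> Complex (3/4) (1/2)"
abbreviation "mirror \<equiv> Complex (-3/5) (-4/5)"

abbreviation "reflected_weight \<alpha> k \<equiv> 2 * \<alpha> - cnj (\<alpha> * mirror ^ k)"

abbreviation "line_curve \<equiv> curve (\<lambda>t. t) (\<lambda>t. -2 * t) (3/4, 1/2)"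
abbreviation "direction \<equiv> Complex 1 (-2)"

lemma line_point: "Complex (fst (line_curve t)) (snd (line_curve t)) - base_z = of_real t * direction"
  by (simp add: curve_def complex_eq_iff)

lemma harmonic_power_on_line:
  "harmonic_power \<beta> k base_z (line_curve t) = t ^ k * Re (\<beta> * direction ^ k)"
proof -
  have "\<beta> * (of_real t * direction) ^ k = of_real (t ^ k) * (\<beta> * direction ^ k)"
    by (simp add: power_mult_distrib mult_ac)
  then show ?thesis
    unfolding harmonic_power_def line_point
    by (simp only: times_complex.sel(1)[of "of_real (t ^ k)"] Re_complex_of_real Im_complex_of_real mult_zero_left diff_zero)
qed

lemma flux_on_line:
  "flux (\<lambda>q. c) (harmonic_power \<beta> k base_z) (line_curve t) (curve_normal (\<lambda>t. t) (\<lambda>t. -2 * t) 1 t) =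
     c * (real k * t ^ (k - 1)) * Im (\<beta> * direction ^ k) / sqrt 5"
proof (cases k)
  case 0
  then show ?thesis by (simp add: flux_def dx_harmonic_power dy_harmonic_power harmonic_power_def inner_prod_def)
next
  case (Suc j)
  let ?d = "2 * harmonic_power (\<beta> * of_nat k) j base_z (line_curve t) + harmonic_power (\<beta> * of_nat k * \<i>) j base_z (line_curve t)"
  have "?d =
     Re ((2 + \<i>) * (of_real (real k * t ^ j) * (\<beta> * direction ^ j)))"
    unfolding harmonic_power_on_line by (simp add: algebra_simps)
  also have "(2 + \<i>) * (of_real (real k * t ^ j) * (\<beta> * direction ^ j)) = \<i> * (of_real (real k * t ^ j) * (\<beta> * direction ^ k))"
  proof -
    have "2 + \<i> = \<i> * direction" by (simp add: complex_eq_iff)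
    then show ?thesis by (simp only: Suc power_Suc mult_ac)
  qed
  also have "Re \<dots> = - (real k * t ^ j * Im (\<beta> * direction ^ k))" by simp
  finally have "?d =
     - (real k * t ^ j * Im (\<beta> * direction ^ k))" .
  moreover have "flux (\<lambda>q. c) (harmonic_power \<beta> k base_z) (line_curve t) (curve_normal (\<lambda>t. t) (\<lambda>t. -2 * t) 1 t) =
     - c * ?d / sqrt 5"
    unfolding curve_normal_line by (simp add: flux_def dx_harmonic_power dy_harmonic_power Suc field_simps)
  ultimately show ?thesis by (simp add: Suc)
qed

lemma reflected_weight_on_line:
  "reflected_weight \<alpha> k * direction ^ k = 2 * (\<alpha> * direction ^ k) - cnj (\<alpha> * direction ^ k)"
proof -
  have "cnj direction * mirror = direction"  "cnj mirror * direction = cnj direction" by (simp_all add: complex_eq_iff)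
  then have "cnj (mirror ^ k) * direction ^ k = cnj (direction ^ k)"
    by (simp only: complex_cnj_power power_mult_distrib[symmetric])
  then have "cnj (\<alpha> * mirror ^ k) * direction ^ k = cnj (\<alpha> * direction ^ k)"
    by (simp only: complex_cnj_mult mult.assoc)
  then show ?thesis by (simp only: left_diff_distrib mult.assoc)
qed

text \<open>On the line \<open>U \<circ> R\<close> equals \<open>U\<close> and has the opposite normal derivative. So \<open>2 U - U \<circ> R\<close> has the value
  of \<open>U\<close> and three times its normal derivative, which matches the ratio of the coefficients.\<close>

lemma transmitted_pair:
  "local_solution line_data (harmonic_power \<alpha> k base_z) (harmonic_power (reflected_weight \<alpha> k) k base_z)
     (\<lambda>q. 0) (\<lambda>q. 0) (\<lambda>q. 0) (\<lambda>q. 0)"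
proof -
  have smooth: "smooth_near p (harmonic_power \<beta> k base_z)" for p \<beta>
    unfolding smooth_near_def using smooth_on_harmonic_power by blast
  have parts: "Re (2 * A - cnj A) = Re A" "Im (2 * A - cnj A) = 3 * Im A" for A by simp_all
  have "harmonic_power \<alpha> k base_z (line_curve t) - harmonic_power (reflected_weight \<alpha> k) k base_z (line_curve t) = 0" for t
    unfolding harmonic_power_on_line reflected_weight_on_line parts by simp
  moreover have "flux (\<lambda>q. 3) (harmonic_power \<alpha> k base_z) (line_curve t) (curve_normal (\<lambda>t. t) (\<lambda>t. -2 * t) 1 t) -
     flux (\<lambda>q. 1) (harmonic_power (reflected_weight \<alpha> k) k base_z) (line_curve t) (curve_normal (\<lambda>t. t) (\<lambda>t. -2 * t) 1 t) = 0" for t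
    unfolding flux_on_line reflected_weight_on_line parts by simp
  ultimately show ?thesis
    unfolding local_solution_def Let_def
    by (auto simp: line_data_def smooth smooth_near_const harmonic_power_harmonic)
qed

lemma pd_zero: "pd m n (\<lambda>q. 0) = (\<lambda>q. 0)"
proof -
  have "dx (\<lambda>q. 0) = (\<lambda>q. 0)" "dy (\<lambda>q. 0) = (\<lambda>q. 0)" by (simp_all add: dx_def dy_def fun_eq_iff)
  then have "pd 0 n (\<lambda>q. 0) = (\<lambda>q. 0)" for n by (induction n) (simp_all add: pd_0_Suc)
  with \<open>dx (\<lambda>q. 0) = (\<lambda>q. 0)\<close> show ?thesis by (induction m) (simp_all add: pd_Suc_left)
qed

text \<open>Cancelling \<open>h\<^sup>k\<close> leaves a polynomial that tends to \<open>0\<close>.\<close>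

lemma poly_vanishes_at_0:
  fixes q :: "real poly"
  assumes "(\<lambda>h. h ^ k * poly q h) \<in> O[at_right 0](\<lambda>h. h ^ N)" "k < N"
  shows "poly q 0 = 0"
proof -
  have "(\<lambda>h. h ^ k * poly q h) \<in> O[at_right 0](\<lambda>h :: real. h ^ k * h ^ (N - k))"
    using assms by (simp add: power_add[symmetric])
  moreover have "\<forall>\<^sub>F h in at_right 0. (h :: real) ^ k \<noteq> 0"
    by (rule eventually_mono[OF eventually_at_right_less]) simp
  ultimately have "(\<lambda>h. poly q h) \<in> O[at_right 0](\<lambda>h. h ^ (N - k))"
    by (simp add: landau_o.big.mult_cancel_left)
  then obtain c where "\<forall>\<^sub>F h in at_right 0. norm (poly q h) \<le> c * norm (h ^ (N - k))"
    using landau_o.bigE by blast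
  moreover have "((\<lambda>h :: real. c * norm (h ^ (N - k))) \<longlongrightarrow> 0) (at_right 0)"
    using assms(2) by (auto intro!: tendsto_eq_intros)
  ultimately have "((\<lambda>h. poly q h) \<longlongrightarrow> 0) (at_right 0)"
    by (rule Lim_null_comparison)
  moreover have "((\<lambda>h. poly q h) \<longlongrightarrow> poly q 0) (at_right 0)"
    by (intro tendsto_poly tendsto_ident_at)
  ultimately show ?thesis using tendsto_unique[of "at_right (0 :: real)"] by (metis trivial_limit_at_right_real)
qed

text \<open>The harmonic polynomials \<open>Im z\<^sup>4\<close> and \<open>Im (z\<^sup>6 + 4 z\<^sup>2)\<close> vanish at all thirteen nodes. Applied to
  them, the conditions only see the reflections \<open>w\<close> of the two minus nodes, and the matrix of their values at these
  two points is invertible; hence the weights of the minus nodes vanish. What remains are the moment conditions of a scheme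
  without interface on the other eleven nodes. They split according to parity in \<open>x\<close> and \<open>y\<close>, and each part has only
  the trivial solution.\<close>

lemma stencil_moments:
  fixes c :: "int \<times> int \<Rightarrow> real"
  defines "w \<equiv> \<lambda>kl. if kl = (1, 1) then Complex (1/5) (3/5) else Complex (2/5) (-4/5)"
  assumes moments: "\<And>n. n \<le> 6 \<Longrightarrow> (\<Sum>kl\<in>stencil. of_real (c kl) *
     (if kl = (1, 1) \<or> kl = (2, 0) then 2 * Complex (fst kl) (snd kl) ^ n - w kl ^ n else Complex (fst kl) (snd kl) ^ n)) = 0"
  shows "kl \<in> stencil \<Longrightarrow> c kl = 0"
proof -
  have power_2: "Re (Complex a b ^ 2) = a ^ 2 - b ^ 2" "Im (Complex a b ^ 2) = 2 * a * b" for a b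
    by (simp_all add: power2_eq_square)
  have power_3: "Re (Complex a b ^ 3) = a ^ 3 - 3 * a * b ^ 2" "Im (Complex a b ^ 3) = 3 * a ^ 2 * b - b ^ 3" for a b
    by (simp_all add: eval_nat_numeral algebra_simps)
  have power_4: "Re (Complex a b ^ 4) = a ^ 4 - 6 * a ^ 2 * b ^ 2 + b ^ 4"
      "Im (Complex a b ^ 4) = 4 * a ^ 3 * b - 4 * a * b ^ 3" for a b
    by (simp_all add: eval_nat_numeral algebra_simps)
  have power_5: "Re (Complex a b ^ 5) = a ^ 5 - 10 * a ^ 3 * b ^ 2 + 5 * a * b ^ 4"
      "Im (Complex a b ^ 5) = 5 * a ^ 4 * b - 10 * a ^ 2 * b ^ 3 + b ^ 5" for a b
    by (simp_all add: eval_nat_numeral algebra_simps)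
  have power_6: "Re (Complex a b ^ 6) = a ^ 6 - 15 * a ^ 4 * b ^ 2 + 15 * a ^ 2 * b ^ 4 - b ^ 6"
      "Im (Complex a b ^ 6) = 6 * a ^ 5 * b - 20 * a ^ 3 * b ^ 3 + 6 * a * b ^ 5" for a b
    by (simp_all add: eval_nat_numeral algebra_simps)
  note m = moments[unfolded stencil_explicit w_def complex_eq_iff]
  note R0 = m[of 0, simplified]
  note R1 = m[of 1, simplified]
  note R2 = m[of 2, simplified, simplified power_2 power_divide, simplified, simplified power_divide, simplified]
  note R3 = m[of 3, simplified, simplified power_3 power_divide, simplified, simplified power_divide, simplified]
  note R4 = m[of 4, simplified, simplified power_4 power_divide, simplified, simplified power_divide, simplified]
  note R5 = m[of 5, simplified, simplified power_5 power_divide, simplified, simplified power_divide, simplified]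
  note R6 = m[of 6, simplified, simplified power_6 power_divide, simplified, simplified power_divide, simplified]
  \<comment> \<open>The imaginary parts of order four, and of orders six and two combined, only contain these two weights.\<close>
  have corner: "c (1,1) = 0" and tip: "c (2,0) = 0"
    using conjunct2[OF R4] conjunct2[OF R6] conjunct2[OF R2] by linarith+
  have odd_x: "(c (-1,-1) + c (-1,1) - c (1,-1)) - (c (1,0) - c (-1,0)) + 2 * c (-2,0) = 0"
    "2 * (c (-1,-1) + c (-1,1) - c (1,-1)) + (c (1,0) - c (-1,0)) - 8 * c (-2,0) = 0"
    "4 * (c (-1,-1) + c (-1,1) - c (1,-1)) + (c (1,0) - c (-1,0)) - 32 * c (-2,0) = 0"
    using conjunct1[OF R1] conjunct1[OF R3] conjunct1[OF R5] corner tip by simp_all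
  have odd_y: "(c (-1,1) - c (1,-1) - c (-1,-1)) + (c (0,1) - c (0,-1)) + 2 * (c (0,2) - c (0,-2)) = 0"
    "2 * (c (-1,1) - c (1,-1) - c (-1,-1)) - (c (0,1) - c (0,-1)) - 8 * (c (0,2) - c (0,-2)) = 0"
    "4 * (c (-1,1) - c (1,-1) - c (-1,-1)) - (c (0,1) - c (0,-1)) - 32 * (c (0,2) - c (0,-2)) = 0"
    using conjunct2[OF R1] conjunct2[OF R3] conjunct2[OF R5] corner tip by simp_all
  have left: "c (-2,0) = 0" using odd_x by argo
  then have x: "c (-1,-1) + c (-1,1) - c (1,-1) = 0" "c (1,0) - c (-1,0) = 0" using odd_x by argo+
  have vertical: "c (0,2) - c (0,-2) = 0" using odd_y by argo
  then have y: "c (-1,1) - c (1,-1) - c (-1,-1) = 0" "c (0,1) - c (0,-1) = 0" using odd_y by argo+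
  have "c (-1,-1) - c (-1,1) - c (1,-1) = 0" using conjunct2[OF R2] corner tip by simp
  with x(1) y(1) have corners: "c (-1,-1) = 0" "c (-1,1) = 0" "c (1,-1) = 0" by argo+
  have even: "2 * c (-1,0) - 2 * c (0,-1) - 8 * c (0,-2) = 0" "2 * c (-1,0) + 2 * c (0,-1) + 32 * c (0,-2) = 0"
    "2 * c (-1,0) - 2 * c (0,-1) - 128 * c (0,-2) = 0"
    using conjunct1[OF R2] conjunct1[OF R4] conjunct1[OF R6] corner tip left x(2) y(2) vertical corners by simp_all
  then have bottom: "c (0,-2) = 0" by argo
  with even have axes: "c (-1,0) = 0" "c (0,-1) = 0" by argo+
  have rest: "c (1,0) = 0" "c (0,1) = 0" "c (0,2) = 0" using axes x(2) y(2) vertical bottom by simp_all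
  have "c (0,0) = 0" using R0 corner tip left corners bottom axes rest by simp
  moreover assume "kl \<in> stencil"
  ultimately show ?thesis using corner tip left corners bottom axes rest
    unfolding stencil_explicit by (elim insertE emptyE) simp_all
qed


abbreviation "node_z kl \<equiv> Complex (v0 line_data + of_int (fst kl)) (w0 line_data + of_int (snd kl))"

lemma exact_value_transmitted_pair:
  "exact_value line_data (harmonic_power \<alpha> n base_z) (harmonic_power (reflected_weight \<alpha> n) n base_z) h kl =
     h ^ n * Re ((if kl \<in> plus_nodes line_data then \<alpha> else reflected_weight \<alpha> n) * node_z kl ^ n)"
proof -
  let ?x = "fst (base_pt line_data) + (v0 line_data + of_int (fst kl)) * h"
    and ?y = "snd (base_pt line_data) + (w0 line_data + of_int (snd kl)) * h"
  have base: "fst (base_pt line_data) = 3/4" "snd (base_pt line_data) = 1/2" by (simp_all add: line_data_def)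
  have point: "Complex (?x)
      (?y) - base_z = of_real h * node_z kl"
    unfolding base by (simp add: complex_eq_iff)
  have "\<beta> * (of_real h * node_z kl) ^ n = of_real (h ^ n) * (\<beta> * node_z kl ^ n)" for \<beta>
    by (simp add: power_mult_distrib mult_ac)
  then have "harmonic_power \<beta> n base_z (?x,
      ?y) = h ^ n * Re (\<beta> * node_z kl ^ n)" for \<beta>
    unfolding harmonic_power_def fst_conv snd_conv point
    by (simp only: times_complex.sel(1)[of "of_real (h ^ n)"] Re_complex_of_real Im_complex_of_real mult_zero_left diff_zero)
  then show ?thesis by (simp add: exact_value_def case_prod_unfold)
qed

text \<open>The pair built from \<open>\<alpha> \<zeta>\<^sup>n\<close> is homogeneous of degree \<open>n \<le> 6\<close> and has vanishing data, so the error is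
  \<open>h\<^sup>n\<close> times a polynomial in \<open>h\<close>, whose value at \<open>0\<close> has to vanish. Both \<open>\<alpha> = 1\<close> and \<open>\<alpha> = - \<i>\<close> are used to obtain a complex
  identity.\<close>

lemma moments_about_base_point:
  assumes acc: "has_accuracy_order line_data S ord" and ord: "ord \<ge> 6" and n: "n \<le> 6"
  shows "(\<Sum>kl\<in>stencil. of_real (poly (stencil_coeff S kl) 0) *
     (if kl \<in> plus_nodes line_data then node_z kl ^ n else 2 * node_z kl ^ n - (mirror * cnj (node_z kl)) ^ n)) = 0"
    (is "?\<Lambda> = 0")
proof -
  let ?C = "stencil_coeff S"
  have Re0: "Re (\<alpha> * ?\<Lambda>) = 0" for \<alpha>
  proof -
    let ?E = "\<lambda>kl. Re ((if kl \<in> plus_nodes line_data then \<alpha> else reflected_weight \<alpha> n) * node_z kl ^ n)"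
    let ?q = "\<Sum>kl\<in>stencil. smult (?E kl) (?C kl)"
    have rhs: "scheme_rhs S p (\<lambda>q. 0) (\<lambda>q. 0) (\<lambda>q. 0) (\<lambda>q. 0) h = 0" for p h
      by (simp add: scheme_rhs_def pd_zero)
    have lhs: "(\<Sum>kl\<in>stencil. poly (?C kl) h * exact_value line_data (harmonic_power \<alpha> n base_z)
        (harmonic_power (reflected_weight \<alpha> n) n base_z) h kl) = h ^ n * poly ?q h" for h
      unfolding exact_value_transmitted_pair poly_sum poly_smult sum_distrib_left
      by (intro sum.cong refl) (simp only: mult_ac)
    have "(\<lambda>h. (\<Sum>kl\<in>stencil. poly (?C kl) h * exact_value line_data (harmonic_power \<alpha> n base_z)
        (harmonic_power (reflected_weight \<alpha> n) n base_z) h kl) -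
        scheme_rhs S (base_pt line_data) (\<lambda>q. 0) (\<lambda>q. 0) (\<lambda>q. 0) (\<lambda>q. 0) h) \<in> O[at_right 0](\<lambda>h. h ^ (ord + 1))"
      using acc[unfolded has_accuracy_order_def, rule_format, OF transmitted_pair] .
    then have "(\<lambda>h. h ^ n * poly ?q h) \<in> O[at_right 0](\<lambda>h. h ^ (ord + 1))"
      unfolding lhs rhs diff_zero .
    then have "poly ?q 0 = 0" by (rule poly_vanishes_at_0) (use ord n in simp)
    then have "(\<Sum>kl\<in>stencil. poly (?C kl) 0 * ?E kl) = 0"
      unfolding poly_sum poly_smult by (simp only: mult.commute)
    moreover have "?E kl = Re (\<alpha> * (if kl \<in> plus_nodes line_data then node_z kl ^ n else 2 * node_z kl ^ n - (mirror * cnj (node_z kl)) ^ n))" for kl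
    proof -
      have "cnj (\<alpha> * (mirror * cnj (node_z kl)) ^ n) = cnj (\<alpha> * mirror ^ n) * node_z kl ^ n"
        by (simp only: power_mult_distrib complex_cnj_mult complex_cnj_power complex_cnj_cnj mult.assoc)
      then have "Re (cnj (\<alpha> * mirror ^ n) * node_z kl ^ n) = Re (\<alpha> * (mirror * cnj (node_z kl)) ^ n)"
        by (metis complex_cnj(1) complex.sel(1) cnj.sel(1))
      then show ?thesis by (simp only: if_distrib left_diff_distrib right_diff_distrib minus_complex.sel mult_ac split: if_split) simp
    qed
    moreover have "Re (\<alpha> * (of_real x * y)) = x * Re (\<alpha> * y)" for x y by (simp add: algebra_simps)
    ultimately show ?thesis unfolding sum_distrib_left Re_sum by simp
  qed
  have "Re ?\<Lambda> = 0" using Re0[of 1] by (simp only: mult_1_left)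
  moreover have "Im ?\<Lambda> = 0" using Re0[of "- \<i>"] by (simp only: times_complex.sel uminus_complex.sel imaginary_unit.sel)
  ultimately show ?thesis by (simp only: complex_eq_iff zero_complex.sel)
qed

text \<open>The moments about the base point become moments about the central node by the binomial theorem, where the nodes
  have integer coordinates.\<close>

lemma line_order_at_most_5:
  assumes S: "is_13_point_scheme S" and acc: "has_accuracy_order line_data S ord"
  shows "ord \<le> 5"
proof (rule ccontr)
  assume "\<not> ord \<le> 5"
  then have ord: "ord \<ge> 6" by simp
  let ?c = "\<lambda>kl. poly (stencil_coeff S kl) 0"
  let ?P = "plus_nodes line_data"
  let ?t = "\<lambda>n kl. if kl \<in> ?P then node_z kl ^ n else 2 * node_z kl ^ n - (mirror * cnj (node_z kl)) ^ n"
  have "(\<Sum>kl\<in>stencil. of_real (?c kl) *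
     (if kl = (1, 1) \<or> kl = (2, 0) then 2 * Complex (fst kl) (snd kl) ^ n -
        (if kl = (1, 1) then Complex (1/5) (3/5) else Complex (2/5) (-4/5)) ^ n else Complex (fst kl) (snd kl) ^ n)) = 0"
    if n: "n \<le> 6" for n
  proof -
    have z: "node_z kl + base_z = Complex (fst kl) (snd kl)" for kl
      by (simp add: complex_eq_iff line_v0_w0)
    have w: "mirror * cnj (node_z kl) + base_z = (if kl = (1, 1) then Complex (1/5) (3/5) else Complex (2/5) (-4/5))"
      if "kl = (1, 1) \<or> kl = (2, 0)" for kl
      using that by (auto simp: complex_eq_iff line_v0_w0)
    have shift: "(\<Sum>k\<le>n. of_nat (n choose k) * ?t k kl * base_z ^ (n - k)) =
       (if kl \<in> ?P then (node_z kl + base_z) ^ n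
        else 2 * (node_z kl + base_z) ^ n - (mirror * cnj (node_z kl) + base_z) ^ n)" for kl
      unfolding binomial_ring by (simp add: sum_subtractf sum_distrib_left algebra_simps)
    have "(\<Sum>kl\<in>stencil. of_real (?c kl) * (\<Sum>k\<le>n. of_nat (n choose k) * ?t k kl * base_z ^ (n - k))) =
      (\<Sum>k\<le>n. of_nat (n choose k) * base_z ^ (n - k) * (\<Sum>kl\<in>stencil. of_real (?c kl) * ?t k kl))"
      unfolding sum_distrib_left by (subst sum.swap) (intro sum.cong refl, simp only: mult_ac)
    also have "\<dots> = 0"
      using moments_about_base_point[OF acc ord] n by (intro sum.neutral) simp
    finally have "(\<Sum>kl\<in>stencil. of_real (?c kl) * (if kl \<in> ?P then (node_z kl + base_z) ^ n
        else 2 * (node_z kl + base_z) ^ n - (mirror * cnj (node_z kl) + base_z) ^ n)) = 0"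
      unfolding shift .
    moreover have "(if kl \<in> ?P then (node_z kl + base_z) ^ n
        else 2 * (node_z kl + base_z) ^ n - (mirror * cnj (node_z kl) + base_z) ^ n) =
       (if kl = (1, 1) \<or> kl = (2, 0) then 2 * Complex (fst kl) (snd kl) ^ n -
        (if kl = (1, 1) then Complex (1/5) (3/5) else Complex (2/5) (-4/5)) ^ n else Complex (fst kl) (snd kl) ^ n)"
      if "kl \<in> stencil" for kl
      using w[of kl] line_nodes[OF that] unfolding z by auto
    ultimately show ?thesis by (simp only: cong: sum.cong)
  qed
  from stencil_moments[OF this] have "?c kl = 0" if "kl \<in> stencil" for kl using that by blast
  with S show False unfolding is_13_point_scheme_def nontrivial_def by blast
qed

theorem order_at_most_5: "order_attainable ord \<Longrightarrow> ord \<le> 5"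
  unfolding order_attainable_def using line_admissible line_order_at_most_5 by blast

theorem theorem2p8:
  shows "(\<forall>D c. admissible D \<and> nontrivial (coeff_polys c) \<and> solves_system D (coeff_polys c) \<longrightarrow>
            is_13_point_scheme (interface_scheme D (coeff_polys c)) \<and>
            has_accuracy_order D (interface_scheme D (coeff_polys c)) 5) \<and>
         order_attainable 5 \<and> (\<forall>p. order_attainable p \<longrightarrow> p \<le> 5)"
  using interface_scheme_is_scheme interface_scheme_accuracy order_5_attainable order_at_most_5 by blast

end
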